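(* Suppose that, in addition, $A$, $B$, $f$ are periodic with the same period $T>0$. Then $H^{1,2}_\#(\mathbb{R}^{1+n},\nu)$ is compactly embedded in $L^2_\#(\mathbb{R}^{1+n},\nu)$.
   Context: Standing assumptions. $A,B:\mathbb{R}\to\mathcal{L}(\mathbb{R}^n)$ and $f:\mathbb{R}\to\mathbb{R}^n$ are continuous and bounded. There is $\mu_0>0$ with $\|B(t)x\|\ge\mu_0\|x\|$ for all $t\in\mathbb{R}$, $x\in\mathbb{R}^n$. $U(t,s)$ ($t,s\in\mathbb{R}$) is the evolution family generated by $A(\cdot)$, i.e. $\partial_tU(t,s)=A(t)U(t,s)$, $U(s,s)=I$, and its growth bound $\omega_0(U):=\inf\{\omega\in\mathbb{R}:\exists M=M(\omega)\text{ such that }\|U(t,s)\|\le Me^{\omega(t-s)},\ -\infty<s\le t<\infty\}$ satisfies $\omega_0(U)<0$. Measures. For $-\infty\le s<t$ put $g(t,s)=\int_s^tU(t,r)f(r)\,dr$ and $Q(t,s)=\int_s^tU(t,r)B(r)B^*(r)U^*(t,r)\,dr$. $\mathcal{N}_{m,Q}$ is the Gaussian measure on $\mathbb{R}^n$ with mean $m$ and covariance $Q$. Set $\nu_t=\mathcal{N}_{g(t,-\infty),Q(t,-\infty)}$, and let $\nu$ be the Borel measure on $\mathbb{R}^{1+n}$ with $\nu(I\times K)=\int_I\nu_t(K)\,dt$ for Borel $I\subset\mathbb{R}$, $K\subset\mathbb{R}^n$. Periodic spaces. $L^2_\#(\mathbb{R}^{1+n},\nu)$ is the Hilbert space of Lebesgue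 measurable $u:\mathbb{R}^{1+n}\to\mathbb{R}$ with $u(t,x)=u(t+T,x)$ a.e. and $u|_{(0,T)\times\mathbb{R}^n}\in L^2((0,T)\times\mathbb{R}^n,\nu)$, with norm $\big(\frac1T\int_0^T\int_{\mathbb{R}^n}u(t,x)^2\,d\nu_t\,dt\big)^{1/2}$. $H^{1,2}_\#(\mathbb{R}^{1+n},\nu)$ is the space of $u$ such that the weak derivatives $\partial_tu$ and $D_x^\alpha u$, $|\alpha|\le2$ (including $u$ itself), are locally square integrable on $\mathbb{R}^{1+n}$ and belong to $L^2_\#(\mathbb{R}^{1+n},\nu)$, with its natural norm. *)

theory Defs
  imports "HOL-Analysis.Analysis"
begin

section \<open>Evolution families\<close>

text \<open>Linear operators on the space \<open>real ^ 'n\<close> are represented by their matrices.\<close>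

definition evolution_family ::
    "(real \<Rightarrow> real ^ 'n ^ 'n) \<Rightarrow> (real \<Rightarrow> real \<Rightarrow> real ^ 'n ^ 'n) \<Rightarrow> bool" where
  "evolution_family A U \<longleftrightarrow>
     (\<forall>s. U s s = mat 1) \<and>
     (\<forall>t s. ((\<lambda>\<tau>. U \<tau> s) has_vector_derivative (A t ** U t s)) (at t))"

text \<open>The infimum is taken in the extended reals, so that it is meaningful for every \<open>U\<close>
  (\<open>\<infinity>\<close> if there is no exponential bound at all). The norm is the operator norm, whereas
  \<open>norm\<close> on matrices would be the Frobenius norm.\<close>

definition growth_bound :: "(real \<Rightarrow> real \<Rightarrow> real ^ 'n ^ 'n) \<Rightarrow> ereal" where
  "growth_bound U =
     Inf {ereal \<omega> |\<omega>. \<exists>M. \<forall>t s. s \<le> t \<longrightarrow>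
            onorm (\<lambda>x. U t s *v x) \<le> M * exp (\<omega> * (t - s))}"

section \<open>The evolution system of measures\<close>

text \<open>The lower endpoint may be \<open>-\<infinity>\<close>.\<close>

definition mean_g ::
    "(real \<Rightarrow> real \<Rightarrow> real ^ 'n ^ 'n) \<Rightarrow> (real \<Rightarrow> real ^ 'n) \<Rightarrow> real \<Rightarrow> ereal \<Rightarrow> real ^ 'n" where
  "mean_g U f t s = (LBINT r=s..ereal t. U t r *v f r)"

definition cov_Q ::
    "(real \<Rightarrow> real \<Rightarrow> real ^ 'n ^ 'n) \<Rightarrow> (real \<Rightarrow> real ^ 'n ^ 'n) \<Rightarrow> real \<Rightarrow> ereal \<Rightarrow> real ^ 'n ^ 'n" where
  "cov_Q U B t s =
     (LBINT r=s..ereal t. U t r ** B r ** transpose (B r) ** transpose (U t r))"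

text \<open>The Gaussian measure with mean \<open>m\<close> and covariance \<open>Q\<close>, for positive definite \<open>Q\<close>
  (the only case that occurs below, as \<open>B\<close> is uniformly nondegenerate).\<close>

definition gaussian :: "real ^ 'n \<Rightarrow> real ^ 'n ^ 'n \<Rightarrow> (real ^ 'n) measure" where
  "gaussian m Q = density lborel (\<lambda>x. ennreal
     (exp (- ((x - m) \<bullet> (matrix_inv Q *v (x - m))) / 2) / sqrt ((2 * pi) ^ CARD('n) * det Q)))"

definition nu_t ::
    "(real \<Rightarrow> real \<Rightarrow> real ^ 'n ^ 'n) \<Rightarrow> (real \<Rightarrow> real ^ 'n ^ 'n) \<Rightarrow> (real \<Rightarrow> real ^ 'n)
      \<Rightarrow> real \<Rightarrow> (real ^ 'n) measure" where
  "nu_t U B f t = gaussian (mean_g U f t (-\<infinity>)) (cov_Q U B t (-\<infinity>))"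

definition is_space_time_measure ::
    "(real \<Rightarrow> (real ^ 'n) measure) \<Rightarrow> (real \<times> (real ^ 'n)) measure \<Rightarrow> bool" where
  "is_space_time_measure \<nu>t \<nu> \<longleftrightarrow>
     sets \<nu> = sets borel \<and>
     (\<forall>I \<in> sets borel. \<forall>K \<in> sets borel.
        emeasure \<nu> (I \<times> K) = (\<integral>\<^sup>+ t\<in>I. emeasure (\<nu>t t) K \<partial>lborel))"

section \<open>Weak derivatives\<close>

text \<open>\<open>iter_deriv vs \<phi>\<close> is the iterated directional derivative along the vectors in \<open>vs\<close>.\<close>

fun iter_deriv :: "'a list \<Rightarrow> ('a::euclidean_space \<Rightarrow> real) \<Rightarrow> 'a \<Rightarrow> real" where
  "iter_deriv [] \<phi> = \<phi>"
| "iter_deriv (v # vs) \<phi> = (\<lambda>z. frechet_derivative (iter_deriv vs \<phi>) (at z) v)"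

definition test_functions :: "('a::euclidean_space \<Rightarrow> real) set" where
  "test_functions = {\<phi>.
     (\<forall>vs z. set vs \<subseteq> Basis \<longrightarrow> iter_deriv vs \<phi> differentiable (at z)) \<and>
     compact (closure {z. \<phi> z \<noteq> 0})}"

definition locally_integrable :: "('a::euclidean_space \<Rightarrow> real) \<Rightarrow> bool" where
  "locally_integrable u \<longleftrightarrow>
     (\<forall>K. compact K \<longrightarrow> u absolutely_integrable_on K)"

definition locally_square_integrable :: "('a::euclidean_space \<Rightarrow> real) \<Rightarrow> bool" where
  "locally_square_integrable u \<longleftrightarrow>
     u \<in> borel_measurable lebesgue \<and>
     (\<forall>K. compact K \<longrightarrow> (\<lambda>z. (u z)\<^sup>2) absolutely_integrable_on K)"

definition has_weak_deriv ::
    "'a list \<Rightarrow> ('a::euclidean_space \<Rightarrow> real) \<Rightarrow> ('a \<Rightarrow> real) \<Rightarrow> bool" where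
  "has_weak_deriv vs u w \<longleftrightarrow>
     locally_integrable u \<and> locally_integrable w \<and>
     (\<forall>\<phi>\<in>test_functions.
        (LINT z|lebesgue. u z * iter_deriv vs \<phi> z)
          = (-1) ^ length vs * (LINT z|lebesgue. w z * \<phi> z))"

text \<open>Weak derivatives are unique up to Lebesgue null sets; this picks a representative.\<close>

definition weak_deriv :: "'a list \<Rightarrow> ('a::euclidean_space \<Rightarrow> real) \<Rightarrow> 'a \<Rightarrow> real" where
  "weak_deriv vs u = (SOME w. has_weak_deriv vs u w)"

section \<open>Spaces of time-periodic functions\<close>

text \<open>Elements of the spaces are functions rather than classes of functions that agree almost
  everywhere, so the norms below are seminorms. The integrals are nonnegative Lebesgue integrals,
  which take the expected value also for functions that are only Lebesgue measurable
  (see \<open>nn_integral_completion\<close>); the Bochner integral with respect to a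
  measure on the Borel sets would not.\<close>

definition L2_per ::
    "real \<Rightarrow> (real \<times> (real ^ 'n)) measure \<Rightarrow> (real \<times> (real ^ 'n) \<Rightarrow> real) set" where
  "L2_per T \<nu> = {u.
     u \<in> borel_measurable lebesgue \<and>
     (AE z in lebesgue. u z = u (fst z + T, snd z)) \<and>
     (\<integral>\<^sup>+ z \<in> {0<..<T} \<times> UNIV. ennreal ((u z)\<^sup>2) \<partial>\<nu>) < \<infinity>}"

definition L2_per_norm ::
    "real \<Rightarrow> (real \<Rightarrow> (real ^ 'n) measure) \<Rightarrow> (real \<times> (real ^ 'n) \<Rightarrow> real) \<Rightarrow> real" where
  "L2_per_norm T \<nu>t u =
     sqrt (1 / T * enn2real (\<integral>\<^sup>+ t \<in> {0<..<T}. (\<integral>\<^sup>+ x. ennreal ((u (t, x))\<^sup>2) \<partial>\<nu>t t) \<partial>lborel))"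

text \<open>The directions of the derivatives \<open>u\<close>, \<open>\<partial>\<^sub>t u\<close>, \<open>D\<^sub>i u\<close> and \<open>D\<^sub>i D\<^sub>j u\<close>. Ordered pairs
  \<open>(i, j)\<close> are used in place of multi-indices, so in the norm below each mixed second derivative
  is counted twice (the Frobenius norm of the Hessian).\<close>

definition parabolic_directions :: "(real \<times> (real ^ 'n)) list set" where
  "parabolic_directions =
     {[], [(1, 0)]} \<union> range (\<lambda>i. [(0, axis i 1)])
       \<union> range (\<lambda>(i, j). [(0, axis i 1), (0, axis j 1)])"

definition H12_per ::
    "real \<Rightarrow> (real \<times> (real ^ 'n)) measure \<Rightarrow> (real \<times> (real ^ 'n) \<Rightarrow> real) set" where
  "H12_per T \<nu> = {u. \<forall>vs \<in> parabolic_directions.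
     \<exists>w. has_weak_deriv vs u w \<and> locally_square_integrable w \<and> w \<in> L2_per T \<nu>}"

definition H12_per_norm ::
    "real \<Rightarrow> (real \<Rightarrow> (real ^ 'n) measure) \<Rightarrow> (real \<times> (real ^ 'n) \<Rightarrow> real) \<Rightarrow> real" where
  "H12_per_norm T \<nu>t u =
     sqrt (\<Sum>vs \<in> parabolic_directions. (L2_per_norm T \<nu>t (weak_deriv vs u))\<^sup>2)"

section \<open>Compact embeddings\<close>

definition compactly_embedded ::
    "('a \<Rightarrow> real) set \<Rightarrow> (('a \<Rightarrow> real) \<Rightarrow> real) \<Rightarrow> ('a \<Rightarrow> real) set \<Rightarrow> (('a \<Rightarrow> real) \<Rightarrow> real) \<Rightarrow> bool" where
  "compactly_embedded X nX Y nY \<longleftrightarrow>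
     X \<subseteq> Y \<and>
     (\<exists>C. \<forall>u\<in>X. nY u \<le> C * nX u) \<and>
     (\<forall>u :: nat \<Rightarrow> 'a \<Rightarrow> real. (\<forall>k. u k \<in> X) \<and> (\<exists>M. \<forall>k. nX (u k) \<le> M) \<longrightarrow>
        (\<exists>r v. strict_mono r \<and> v \<in> Y \<and> (\<lambda>k. nY (\<lambda>z. u (r k) z - v z)) \<longlonglongrightarrow> 0))"

end

theory Submission
  imports Defs "HOL-Complex_Analysis.Great_Picard"
begin

text \<open>Let \<open>\<rho>\<close> be the density of \<open>\<nu>\<close>; it is continuous and positive. A weak derivative \<open>w\<close> of \<open>u\<close> in a
  coordinate direction \<open>b\<close> satisfies \<open>u (z + h b) - u z = \<integral> w (z + s b) ds\<close> over \<open>[0, h]\<close>, for each \<open>h\<close> and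
  almost every \<open>z\<close>; this one formula is used twice. First, it bounds the distance in \<open>L\<^sup>2\<close> on a bounded
  set between \<open>u\<close> and its averages over the cells of a grid of width \<open>h\<close> by \<open>h\<close> times the norm of
  the gradient. There are countably many cells, so along a subsequence all averages converge, and a
  bounded sequence has a subsequence that is Cauchy locally in \<open>L\<^sup>2\<close>. Second, the mass of
  \<open>u\<^sup>2 \<rho>\<close> far out is small, uniformly in \<open>u\<close>: far from the mean some component of the gradient of the exponent is
  large, and a unit step along that axis towards the mean multiplies \<open>\<rho>\<close> by a large factor, so
  \<open>u\<^sup>2 \<rho>\<close> is controlled by its values one step inwards and by \<open>w\<^sup>2 \<rho>\<close>.\<close>

section \<open>Smooth bump functions\<close>

text \<open>The elements of the spaces are merely measurable with weak derivatives, so every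
  estimate has to be drawn from the test identity itself. The difference formula results from
  testing with a bump averaged along a segment: the derivative of such an average is a difference of
  two bumps. Hence test functions must include increments of primitives of bumps, and smoothness is
  proved for a whole algebra. Time and space play different roles. A step in time may leave the
  strip over which the norms integrate. So tails are treated by spatial steps inside one time slice,
  while boxes that stick out of the strip are handled by periodicity and a positive lower bound of
  the density on compact sets. Local compactness is thus unweighted; the weight enters through an
  upper bound on a box and through the tail. In the tail estimate a unit step with slope
  \<open>L\<close> costs a factor \<open>exp M / L\<close>, where \<open>M\<close> absorbs the
  curvature of the exponent and is fixed before \<open>L\<close>; letting \<open>L\<close> grow with
  the radius gives uniform smallness. The negative growth bound makes mean and covariance converge,
  and the lower bound on \<open>B\<close> makes the covariance positive definite.\<close>

definition flat_exp :: "real poly \<Rightarrow> real \<Rightarrow> real" where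
  "flat_exp p x = (if x > 0 then poly p (1 / x) * exp (- 1 / x) else 0)"

lemma tendsto_poly_times_exp_0: "((\<lambda>t. poly p t * exp (- t)) \<longlongrightarrow> (0::real)) at_top"
proof -
  have "((\<lambda>t. \<Sum>i\<le>degree p. coeff p i * (t ^ i / exp t)) \<longlongrightarrow> (\<Sum>i\<le>degree p. coeff p i * 0)) at_top"
    by (intro tendsto_intros tendsto_power_div_exp_0)
  moreover have "(\<lambda>t. \<Sum>i\<le>degree p. coeff p i * (t ^ i / exp t)) = (\<lambda>t. poly p t * exp (- t))"
    by (simp add: poly_altdef sum_distrib_right exp_minus divide_inverse mult.assoc)
  ultimately show ?thesis by simp
qed

text \<open>The polynomial factor makes the family closed under differentiation: for positive
  \<open>x\<close> the chain rule turns \<open>p\<close> into \<open>X^2 * (p - p')\<close>,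
  evaluated at \<open>1 / x\<close>. At 0 both one-sided difference quotients tend to 0, as
  exponential decay beats every polynomial.\<close>

lemma DERIV_flat_exp:
  "(flat_exp p has_real_derivative flat_exp ([:0, 0, 1:] * (p - pderiv p)) x) (at x)"
proof -
  consider "x > 0" | "x < 0" | "x = 0" by linarith
  then show ?thesis
  proof cases
    case 1
    have "((\<lambda>x. poly p (1 / x) * exp (- 1 / x)) has_real_derivative
        flat_exp ([:0, 0, 1:] * (p - pderiv p)) x) (at x)"
      using 1 by (auto intro!: derivative_eq_intros DERIV_chain'[OF _ poly_DERIV]
          simp: flat_exp_def field_simps power2_eq_square)
    moreover have "\<forall>\<^sub>F y in nhds x. flat_exp p y = poly p (1 / y) * exp (- 1 / y)"
      using eventually_nhds_in_open[of "{0<..}" x] 1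
      by (auto elim!: eventually_mono simp: flat_exp_def)
    ultimately show ?thesis
      by (subst DERIV_cong_ev[OF refl _ refl])
  next
    case 2
    have "((\<lambda>x. 0) has_real_derivative flat_exp ([:0, 0, 1:] * (p - pderiv p)) x) (at x)"
      using 2 by (auto simp: flat_exp_def)
    moreover have "\<forall>\<^sub>F y in nhds x. flat_exp p y = 0"
      using eventually_nhds_in_open[of "{..<0}" x] 2
      by (auto elim!: eventually_mono simp: flat_exp_def)
    ultimately show ?thesis
      by (subst DERIV_cong_ev[OF refl _ refl])
  next
    case 3
    \<comment> \<open>With \<open>y = 1 / t\<close> the division by \<open>y\<close> becomes
      multiplication by \<open>t\<close>, so the quotient is again a polynomial times
      \<open>exp (- t)\<close>, with \<open>pCons 0 p\<close> in place of \<open>p\<close>.\<close>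
    have r: "((\<lambda>y. flat_exp p y / y) \<longlongrightarrow> 0) (at_right 0)"
    proof (subst filterlim_at_right_to_top)
      have "\<forall>\<^sub>F t in at_top. poly (pCons 0 p) t * exp (- t) = flat_exp p (inverse t) / inverse t"
        using eventually_gt_at_top[of "0::real"]
        by eventually_elim (auto simp: flat_exp_def field_simps)
      then show "((\<lambda>t. flat_exp p (inverse t) / inverse t) \<longlongrightarrow> 0) at_top"
        using tendsto_poly_times_exp_0[of "pCons 0 p"] by (rule Lim_transform_eventually[rotated])
    qed
    have l: "((\<lambda>y. flat_exp p y / y) \<longlongrightarrow> 0) (at_left 0)"
    proof -
      have "\<forall>\<^sub>F y in at_left 0. 0 = flat_exp p y / y"
        by (auto simp: eventually_at_filter flat_exp_def)
      then show ?thesis by (rule Lim_transform_eventually[OF tendsto_const])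
    qed
    have "((\<lambda>y. flat_exp p y / y) \<longlongrightarrow> 0) (at 0)"
      using l r by (rule filterlim_split_at)
    then show ?thesis
      using 3 by (auto simp: has_field_derivative_iff flat_exp_def)
  qed
qed

text \<open>An algebra of functions that is closed under directional derivatives (whence its members
  are smooth) and contains the bump functions, as well as their primitives in one direction.\<close>

inductive_set smooth_alg :: "('a::euclidean_space \<Rightarrow> real) set" where
  flat_exp: "(\<lambda>z. flat_exp p (z \<bullet> v + c)) \<in> smooth_alg"
| const: "(\<lambda>z. c) \<in> smooth_alg"
| add: "f \<in> smooth_alg \<Longrightarrow> g \<in> smooth_alg \<Longrightarrow> (\<lambda>z. f z + g z) \<in> smooth_alg"
| mult: "f \<in> smooth_alg \<Longrightarrow> g \<in> smooth_alg \<Longrightarrow> (\<lambda>z. f z * g z) \<in> smooth_alg"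
| prim: "(\<And>z. (F has_derivative (\<lambda>h. (h \<bullet> v) * f z)) (at z)) \<Longrightarrow> f \<in> smooth_alg \<Longrightarrow>
    F \<in> smooth_alg"

lemmas smooth_alg_intros =
  smooth_alg.flat_exp smooth_alg.const smooth_alg.add smooth_alg.mult

text \<open>The differential is exhibited as a function \<open>D z v\<close> that lies again in the
  algebra for each fixed direction \<open>v\<close>; in this form \<open>iter_deriv\<close> can
  iterate it, by induction on the list of directions.\<close>

lemma smooth_alg_has_derivative:
  assumes "f \<in> smooth_alg"
  shows "\<exists>D. (\<forall>z. (f has_derivative D z) (at z)) \<and> (\<forall>v. (\<lambda>z. D z v) \<in> smooth_alg)"
  using assms
proof induction
  case (flat_exp p v c)
  let ?q = "[:0, 0, 1:] * (p - pderiv p)"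
  have "((\<lambda>z. flat_exp p (z \<bullet> v + c)) has_derivative
      (\<lambda>h. flat_exp ?q (z \<bullet> v + c) * (h \<bullet> v))) (at z)" for z
    by (rule has_derivative_compose[OF _ DERIV_flat_exp[unfolded has_field_derivative_def]])
       (auto intro!: derivative_eq_intros)
  then show ?case
    by (intro exI[of _ "\<lambda>z h. flat_exp ?q (z \<bullet> v + c) * (h \<bullet> v)"])
       (auto intro: smooth_alg_intros)
next
  case (const c)
  then show ?case
    by (intro exI[of _ "\<lambda>z h. 0"]) (auto intro: smooth_alg_intros)
next
  case (add f g)
  then obtain D E where "\<forall>z. (f has_derivative D z) (at z)" "\<forall>v. (\<lambda>z. D z v) \<in> smooth_alg"
    "\<forall>z. (g has_derivative E z) (at z)" "\<forall>v. (\<lambda>z. E z v) \<in> smooth_alg" by blast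
  then show ?case
    by (intro exI[of _ "\<lambda>z h. D z h + E z h"])
       (auto intro: smooth_alg_intros intro!: has_derivative_add)
next
  case (mult f g)
  then obtain D E where "\<forall>z. (f has_derivative D z) (at z)" "\<forall>v. (\<lambda>z. D z v) \<in> smooth_alg"
    "\<forall>z. (g has_derivative E z) (at z)" "\<forall>v. (\<lambda>z. E z v) \<in> smooth_alg" by blast
  then show ?case
    using mult.hyps
    by (intro exI[of _ "\<lambda>z h. f z * E z h + D z h * g z"] conjI allI
        smooth_alg.add smooth_alg.mult has_derivative_mult) auto
next
  case (prim F v f)
  then show ?case
    by (intro exI[of _ "\<lambda>z h. (h \<bullet> v) * f z"]) (auto intro: smooth_alg_intros)
qed

lemma iter_deriv_smooth_alg: "f \<in> smooth_alg \<Longrightarrow> iter_deriv vs f \<in> smooth_alg"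
proof (induction vs)
  case (Cons v vs)
  then obtain D where D: "\<forall>z. (iter_deriv vs f has_derivative D z) (at z)"
    "\<forall>v. (\<lambda>z. D z v) \<in> smooth_alg" using smooth_alg_has_derivative by blast
  then have "frechet_derivative (iter_deriv vs f) (at z) = D z" for z
    using frechet_derivative_at by metis
  then have "iter_deriv (v # vs) f = (\<lambda>z. D z v)" by simp
  then show ?case using D by metis
qed simp

lemma smooth_alg_differentiable: "f \<in> smooth_alg \<Longrightarrow> f differentiable (at z)"
  using smooth_alg_has_derivative[of f] by (auto simp: differentiable_def)

lemma smooth_alg_continuous: "f \<in> smooth_alg \<Longrightarrow> continuous_on S f"
  by (simp add: smooth_alg_differentiable differentiable_imp_continuous_within
      continuous_at_imp_continuous_on)

lemma smooth_alg_test_function: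
  assumes "f \<in> smooth_alg" "\<And>z. z \<notin> cbox a b \<Longrightarrow> f z = 0"
  shows "f \<in> test_functions"
proof -
  have "closure {z. f z \<noteq> 0} \<subseteq> cbox a b"
    using assms(2) by (intro closure_minimal) auto
  then have "compact (closure {z. f z \<noteq> 0})"
    by (meson bounded_cbox bounded_subset closed_closure compact_eq_bounded_closed)
  then show ?thesis
    using assms(1) iter_deriv_smooth_alg smooth_alg_differentiable
    by (fastforce simp: test_functions_def)
qed

lemma smooth_alg_prod:
  assumes "finite I" "\<And>i. i \<in> I \<Longrightarrow> f i \<in> smooth_alg"
  shows "(\<lambda>z. \<Prod>i\<in>I. f i z) \<in> smooth_alg"
  using assms
  by (induction I rule: finite_induct) (auto intro: smooth_alg_intros)

text \<open>\<open>k\<close> governs only the steepness: for every \<open>k > 0\<close> the values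
  lie between 0 and 1 and vanish off the open interval, and for growing \<open>k\<close> they tend
  to its indicator. The product form of \<open>bump\<close> isolates one coordinate, which can then
  be integrated along its axis.\<close>

definition bump1 :: "real \<Rightarrow> real \<Rightarrow> real \<Rightarrow> real \<Rightarrow> real" where
  "bump1 k a b x = flat_exp 1 (k * (x - a)) * flat_exp 1 (k * (b - x))"

definition bump :: "real \<Rightarrow> 'a::euclidean_space \<Rightarrow> 'a \<Rightarrow> 'a \<Rightarrow> real" where
  "bump k a b z = (\<Prod>c\<in>Basis. bump1 k (a \<bullet> c) (b \<bullet> c) (z \<bullet> c))"

lemma flat_exp_1_bounds: "0 \<le> flat_exp 1 x" "flat_exp 1 x \<le> 1"
  by (auto simp: flat_exp_def)

lemma bump1_bounds: "0 \<le> bump1 k a b x" "bump1 k a b x \<le> 1"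
  by (auto simp: bump1_def flat_exp_1_bounds mult_le_one)

lemma bump1_eq_0: "k > 0 \<Longrightarrow> x \<notin> {a<..<b} \<Longrightarrow> bump1 k a b x = 0"
  by (auto simp: bump1_def flat_exp_def zero_less_mult_iff)

lemma bump_bounds: "0 \<le> bump k a b z" "bump k a b z \<le> 1"
  by (auto simp: bump_def bump1_bounds intro!: prod_nonneg prod_le_1)

lemma bump_eq_0: "k > 0 \<Longrightarrow> z \<notin> box a b \<Longrightarrow> bump k a b z = 0"
  by (auto simp: bump_def box_def intro!: bump1_eq_0)

lemma flat_exp_affine_alg: "(\<lambda>z. flat_exp p (k * (z \<bullet> c - r))) \<in> smooth_alg"
  "(\<lambda>z. flat_exp p (k * (r - z \<bullet> c))) \<in> smooth_alg"
  using smooth_alg.flat_exp[of p "k *\<^sub>R c" "- k * r"]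
    smooth_alg.flat_exp[of p "- k *\<^sub>R c" "k * r"]
  by (auto simp: algebra_simps)

lemma bump1_alg: "(\<lambda>z. bump1 k r s (z \<bullet> c)) \<in> smooth_alg"
  unfolding bump1_def by (intro smooth_alg.mult flat_exp_affine_alg)

lemma bump_alg: "bump k a b \<in> smooth_alg"
  unfolding bump_def[abs_def] by (intro smooth_alg_prod bump1_alg) auto

lemma bump_test_function: "k > 0 \<Longrightarrow> bump k a b \<in> test_functions"
  using bump_eq_0[of k _ a b] box_subset_cbox[of a b]
  by (intro smooth_alg_test_function[OF bump_alg, of a b]) auto

lemma borel_measurable_bump [measurable]: "bump k a b \<in> borel_measurable borel"
  by (intro borel_measurable_continuous_onI smooth_alg_continuous bump_alg)

lemma flat_exp_tendsto: "(\<lambda>k. flat_exp 1 (real (Suc k) * x)) \<longlonglongrightarrow> (if x > 0 then 1 else 0)"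
proof (cases "x > 0")
  case True
  have "(\<lambda>k. exp (- ((1 / x) * (1 / real (Suc k))))) \<longlonglongrightarrow> exp (- ((1 / x) * 0))"
    using LIMSEQ_inverse_real_of_nat by (intro tendsto_intros) (simp add: inverse_eq_divide)
  moreover have "(\<lambda>k. flat_exp 1 (real (Suc k) * x)) = (\<lambda>k. exp (- ((1 / x) * (1 / real (Suc k)))))"
  proof
    fix k
    have "real (Suc k) * x > 0" using True by simp
    then show "flat_exp 1 (real (Suc k) * x) = exp (- ((1 / x) * (1 / real (Suc k))))"
      unfolding flat_exp_def by (simp del: of_nat_Suc add: mult.commute)
  qed
  ultimately show ?thesis using True by simp
next
  case False
  then have "(\<lambda>k. flat_exp 1 (real (Suc k) * x)) = (\<lambda>k. 0)"
    by (auto simp: flat_exp_def zero_less_mult_iff simp del: of_nat_Suc)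
  then show ?thesis using False by simp
qed

lemma bump_tendsto: "(\<lambda>k. bump (real (Suc k)) a b z) \<longlonglongrightarrow> indicator (box a b) z"
proof -
  have "(\<lambda>k. bump (real (Suc k)) a b z) \<longlonglongrightarrow>
      (\<Prod>c\<in>Basis. (if z \<bullet> c - a \<bullet> c > 0 then 1 else 0) * (if b \<bullet> c - z \<bullet> c > 0 then 1 else 0))"
    unfolding bump_def bump1_def
    by (intro tendsto_prod tendsto_mult flat_exp_tendsto)
  moreover have "(\<Prod>c\<in>Basis. (if z \<bullet> c - a \<bullet> c > 0 then 1 else 0) * (if b \<bullet> c - z \<bullet> c > 0 then 1 else (0::real)))
      = indicator (box a b) z"
    by (auto simp: indicator_def box_def intro!: prod.neutral prod_zero split: if_splits)
  ultimately show ?thesis by simp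
qed

section \<open>Uniqueness of weak derivatives\<close>

text \<open>Restriction to one box makes \<open>F\<close> integrable. The sets over which the
  restriction \<open>H\<close> has integral 0 then form a Dynkin system that contains the boxes, an
  intersection-stable generator of the Borel sets. Countably many boxes exhaust the space.\<close>

lemma AE_zero_if_box_integrals_zero:
  fixes F :: "'a::euclidean_space \<Rightarrow> real"
  assumes int: "\<And>a b. set_integrable lborel (box a b) F"
    and zero: "\<And>a b. (LINT z:box a b|lborel. F z) = 0"
  shows "AE z in lborel. F z = 0"
proof -
  have "AE z in lborel. z \<in> box a b \<longrightarrow> F z = 0" for a b :: 'a
  proof -
    define H where "H = (\<lambda>z. indicator (box a b) z * F z)"
    have H: "integrable lborel H"
      using int[of a b] by (simp add: set_integrable_def H_def)
    have Hs: "set_integrable lborel A H" if "A \<in> sets borel" for A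
      using integrable_mult_indicator[of A lborel H] H that by (simp add: set_integrable_def)
    \<comment> \<open>Two boxes meet in a box, so the hypothesis on \<open>F\<close> also settles
      the box integrals of the restriction \<open>H\<close>.\<close>
    have Hbox: "(LINT z:box c d|lborel. H z) = 0" for c d
    proof -
      have "\<exists>e f. box c d \<inter> box a b = box e f" unfolding box_Int_box by blast
      then obtain e f where ef: "box c d \<inter> box a b = box e f" by blast
      have "(LINT z:box c d|lborel. H z) = (LINT z:box e f|lborel. F z)"
        unfolding set_lebesgue_integral_def H_def ef[symmetric]
        by (intro Bochner_Integration.integral_cong) (auto simp: indicator_def)
      then show ?thesis using zero by simp
    qed
    have tot: "integral\<^sup>L lborel H = 0"
      using zero[of a b] by (simp add: set_lebesgue_integral_def H_def)
    have "(LINT z:A|lborel. H z) = 0" if "A \<in> sets lborel" for A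
    proof -
      have "Int_stable (range (\<lambda>(a, b). box a b :: 'a set))"
      proof -
        have "box x y \<in> range (\<lambda>(a, b). box a b)" for x y :: 'a
          by (rule image_eqI[of _ _ "(x, y)"]) auto
        then show ?thesis by (intro Int_stableI) (auto simp: box_Int_box)
      qed
      moreover have "range (\<lambda>(a, b). box a b :: 'a set) \<subseteq> Pow UNIV" by simp
      moreover have "A \<in> sigma_sets UNIV (range (\<lambda>(a, b). box a b :: 'a set))"
        using that by (simp add: borel_eq_box)
      ultimately show ?thesis
      proof (induct rule: sigma_sets_induct_disjoint)
        case (compl A)
        have Ab: "A \<in> sets borel" using compl(1) by (simp add: borel_eq_box)
        have "(LINT z:UNIV - A|lborel. H z) = integral\<^sup>L lborel H - (LINT z:A|lborel. H z)"
        proof -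
          have "(LINT z:UNIV - A|lborel. H z)
              = (\<integral>z. H z - indicator A z * H z \<partial>lborel)"
            unfolding set_lebesgue_integral_def
            by (intro Bochner_Integration.integral_cong) (auto simp: indicator_def)
          also have "\<dots> = integral\<^sup>L lborel H - (\<integral>z. indicator A z * H z \<partial>lborel)"
            using Hs[OF Ab] by (intro Bochner_Integration.integral_diff H) (simp add: set_integrable_def)
          finally show ?thesis by (simp add: set_lebesgue_integral_def)
        qed
        then show "(LINT z:UNIV - A|lborel. H z) = 0" using compl(2) tot by simp
      next
        case (union A)
        have Ab: "A i \<in> sets borel" for i using union(2) by (auto simp: borel_eq_box)
        have "(LINT z:(\<Union>i. A i)|lborel. H z) = (\<Sum>i. LINT z:A i|lborel. H z)"
          using union(1) Ab by (intro lebesgue_integral_countable_add Hs)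
            (auto simp: disjoint_family_on_def)
        then show "(LINT z:(\<Union>i. A i)|lborel. H z) = 0" using union(3) by simp
      qed (auto simp: Hbox set_lebesgue_integral_def[of _ "{}"])
    qed
    then have "AE z in lborel. H z = 0"
      using H by (intro density_unique_real) (auto simp: set_lebesgue_integral_def)
    then show ?thesis by eventually_elim (auto simp: H_def)
  qed
  then have "AE z in lborel. \<forall>n::nat. z \<in> box (- (real n *\<^sub>R One)) (real n *\<^sub>R One) \<longrightarrow> F z = 0"
    by (subst AE_all_countable) auto
  then show ?thesis
  proof eventually_elim
    fix z :: 'a assume *: "\<forall>n::nat. z \<in> box (- (real n *\<^sub>R One)) (real n *\<^sub>R One) \<longrightarrow> F z = 0"
    have "z \<in> (\<Union>n::nat. box (- (real n *\<^sub>R One)) (real n *\<^sub>R One))"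
      by (simp only: UN_box_eq_UNIV UNIV_I)
    then show "F z = 0" using * by blast
  qed
qed

text \<open>Indicators of boxes are not test functions, but they are limits of bumps supported in
  the same box; the restriction of \<open>F\<close> to that box dominates.\<close>

lemma AE_zero_if_bump_integrals_zero:
  fixes F :: "'a::euclidean_space \<Rightarrow> real"
  assumes int: "\<And>a b. set_integrable lborel (box a b) F"
    and zero: "\<And>k a b. k > 0 \<Longrightarrow> (LINT z|lborel. F z * bump k a b z) = 0"
    and [measurable]: "F \<in> borel_measurable borel"
  shows "AE z in lborel. F z = 0"
proof (rule AE_zero_if_box_integrals_zero[OF int])
  fix a b :: 'a
  have "(\<lambda>k. LINT z|lborel. F z * bump (real (Suc k)) a b z)
      \<longlonglongrightarrow> (LINT z|lborel. F z * indicator (box a b) z)"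
  proof (rule integral_dominated_convergence[where w = "\<lambda>z. norm (indicator (box a b) z * F z)"])
    show "integrable lborel (\<lambda>z. norm (indicator (box a b) z * F z))"
      using int[of a b] by (auto simp: set_integrable_def)
    show "AE z in lborel. (\<lambda>k. F z * bump (real (Suc k)) a b z) \<longlonglongrightarrow> F z * indicator (box a b) z"
      by (intro always_eventually allI tendsto_intros bump_tendsto)
    show "AE z in lborel. norm (F z * bump (real (Suc k)) a b z) \<le> norm (indicator (box a b) z * F z)" for k
    proof (intro always_eventually allI)
      fix z show "norm (F z * bump (real (Suc k)) a b z) \<le> norm (indicator (box a b) z * F z)"
        using bump_bounds[of "real (Suc k)" a b z] bump_eq_0[of "real (Suc k)" z a b]
        by (cases "z \<in> box a b") (auto simp: abs_mult mult_left_le)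
    qed
  qed auto
  then have "(LINT z|lborel. F z * indicator (box a b) z) = 0"
    using zero by (simp add: LIMSEQ_const_iff del: of_nat_Suc)
  then show "(LINT z:box a b|lborel. F z) = 0"
    by (simp add: set_lebesgue_integral_def mult.commute)
qed

lemma locally_integrable_box:
  assumes "locally_integrable u" and [measurable]: "u \<in> borel_measurable borel"
  shows "set_integrable lborel (box a b) u" "set_integrable lborel (cbox a b) u"
proof -
  have "set_integrable lebesgue (cbox a b) u"
    using assms(1) by (simp add: locally_integrable_def)
  then show *: "set_integrable lborel (cbox a b) u"
    by (simp add: set_integrable_def integrable_completion)
  show "set_integrable lborel (box a b) u"
    by (rule set_integrable_subset[OF *]) (auto intro: box_subset_cbox[THEN subsetD])
qed

lemma locally_integrable_measurable:
  assumes "locally_integrable u" shows "u \<in> borel_measurable lebesgue"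
proof -
  have "(\<lambda>z. indicator (cbox (- (real n *\<^sub>R One)) (real n *\<^sub>R One)) z * u z) \<in> borel_measurable lebesgue" for n
  proof -
    have "integrable lebesgue (\<lambda>z. indicator (cbox (- (real n *\<^sub>R One)) (real n *\<^sub>R One)) z *\<^sub>R u z)"
      using assms compact_cbox unfolding locally_integrable_def set_integrable_def by blast
    then show ?thesis by (auto dest: borel_measurable_integrable)
  qed
  moreover have "(\<lambda>n. indicator (cbox (- (real n *\<^sub>R One)) (real n *\<^sub>R One)) z * u z) \<longlonglongrightarrow> u z" for z
  proof -
    have "z \<in> (\<Union>n::nat. box (- (real n *\<^sub>R One)) (real n *\<^sub>R One))"
      by (simp only: UN_box_eq_UNIV UNIV_I)
    then obtain N :: nat where N: "z \<in> box (- (real N *\<^sub>R One)) (real N *\<^sub>R One)" by blast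
    have "z \<in> cbox (- (real n *\<^sub>R One)) (real n *\<^sub>R One)" if "n \<ge> N" for n
      unfolding mem_box
    proof
      fix i :: 'a assume i: "i \<in> Basis"
      then have "- real N < z \<bullet> i" "z \<bullet> i < real N" using N by (auto simp: mem_box)
      then show "- (real n *\<^sub>R One) \<bullet> i \<le> z \<bullet> i \<and> z \<bullet> i \<le> real n *\<^sub>R One \<bullet> i"
        using i that by auto
    qed
    then have "\<forall>\<^sub>F n in sequentially. u z = indicator (cbox (- (real n *\<^sub>R One)) (real n *\<^sub>R One)) z * u z"
      by (auto simp: eventually_sequentially intro!: exI[of _ N])
    then show ?thesis by (rule Lim_transform_eventually[OF tendsto_const])
  qed
  ultimately show ?thesis by (rule borel_measurable_LIMSEQ_real[rotated])
qed

lemma locally_integrable_cong_AE: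
  assumes "locally_integrable u" "AE z in lebesgue. u z = v z" "v \<in> borel_measurable lebesgue"
  shows "locally_integrable v"
  unfolding locally_integrable_def
proof safe
  fix K :: "'a set" assume K: "compact K"
  then have [measurable]: "K \<in> sets lebesgue" by (simp add: borel_compact)
  note [measurable] = assms(3) locally_integrable_measurable[OF assms(1)]
  have "integrable lebesgue (\<lambda>z. indicator K z *\<^sub>R v z) \<longleftrightarrow> integrable lebesgue (\<lambda>z. indicator K z *\<^sub>R u z)"
    using assms(2) by (intro integrable_cong_AE) auto
  then show "v absolutely_integrable_on K"
    using K assms(1) by (auto simp: locally_integrable_def set_integrable_def)
qed

lemma test_function_deriv_continuous:
  assumes "\<phi> \<in> test_functions" "set vs \<subseteq> Basis"
  shows "continuous_on UNIV (iter_deriv vs \<phi>)"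
proof -
  have "iter_deriv vs \<phi> differentiable (at z)" for z
    using assms by (simp add: test_functions_def)
  then show ?thesis
    by (simp add: differentiable_imp_continuous_within continuous_at_imp_continuous_on)
qed

text \<open>Serves to pass to Borel representatives: the spaces admit Lebesgue measurable functions,
  whereas the translation and Fubini arguments take place on \<open>lborel\<close>. For directions
  in \<open>Basis\<close> the iterated derivatives of test functions are continuous, hence
  measurable.\<close>

lemma has_weak_deriv_cong_AE:
  assumes "has_weak_deriv vs u w" "set vs \<subseteq> Basis"
    and u: "AE z in lebesgue. u z = u' z" "u' \<in> borel_measurable lebesgue"
    and w: "AE z in lebesgue. w z = w' z" "w' \<in> borel_measurable lebesgue"
  shows "has_weak_deriv vs u' w'"
proof -
  have li: "locally_integrable u" "locally_integrable w"
    using assms(1) by (auto simp: has_weak_deriv_def)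
  note [measurable] = li[THEN locally_integrable_measurable] u(2) w(2)
  have "(LINT z|lebesgue. u' z * iter_deriv vs \<phi> z) = (-1) ^ length vs * (LINT z|lebesgue. w' z * \<phi> z)"
    if \<phi>: "\<phi> \<in> test_functions" for \<phi>
  proof -
    have [measurable]: "\<phi> \<in> borel_measurable lebesgue" "iter_deriv vs \<phi> \<in> borel_measurable lebesgue"
      using test_function_deriv_continuous[OF \<phi>, of "[]"] test_function_deriv_continuous[OF \<phi> assms(2)]
      by (auto intro!: measurable_completion borel_measurable_continuous_onI)
    have "(LINT z|lebesgue. u' z * iter_deriv vs \<phi> z) = (LINT z|lebesgue. u z * iter_deriv vs \<phi> z)"
      using u(1) by (intro integral_cong_AE) auto
    moreover have "(LINT z|lebesgue. w' z * \<phi> z) = (LINT z|lebesgue. w z * \<phi> z)"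
      using w(1) by (intro integral_cong_AE) auto
    ultimately show ?thesis using assms(1) \<phi> by (simp add: has_weak_deriv_def)
  qed
  then show ?thesis
    using li assms by (auto simp: has_weak_deriv_def intro: locally_integrable_cong_AE)
qed

lemma bump_mult_integrable:
  assumes k: "k > 0" and u: "\<And>a b. set_integrable lborel (box a b) u"
    and [measurable]: "u \<in> borel_measurable borel"
  shows "integrable lborel (\<lambda>z. u z * bump k a b z)"
proof (rule Bochner_Integration.integrable_bound)
  show "integrable lborel (\<lambda>z. indicator (box a b) z *\<^sub>R u z)"
    using u by (simp add: set_integrable_def)
  show "AE z in lborel. norm (u z * bump k a b z) \<le> norm (indicator (box a b) z *\<^sub>R u z)"
  proof (intro always_eventually allI)
    fix z show "norm (u z * bump k a b z) \<le> norm (indicator (box a b) z *\<^sub>R u z)"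
      using bump_bounds[of k a b z] bump_eq_0[OF k, of z a b]
      by (cases "z \<in> box a b") (auto simp: abs_mult mult_left_le)
  qed
qed auto

lemma lebesgue_ex_borel_representative:
  fixes u :: "'a::euclidean_space \<Rightarrow> real"
  assumes "u \<in> borel_measurable lebesgue"
  obtains u' where "u' \<in> borel_measurable borel" "AE z in lebesgue. u z = u' z"
  using completion_ex_borel_measurable_real[OF assms] by (auto simp: AE_completion_iff)

text \<open>The fundamental lemma of the calculus of variations. Borel representatives carry the
  integrals from \<open>lebesgue\<close> to \<open>lborel\<close> and the conclusion back.\<close>

lemma AE_eq_if_bump_integrals_eq:
  fixes u w :: "'a::euclidean_space \<Rightarrow> real"
  assumes u: "locally_integrable u" and w: "locally_integrable w"
    and eq: "\<And>k a b. k > 0 \<Longrightarrow> (LINT z|lebesgue. u z * bump k a b z) = (LINT z|lebesgue. w z * bump k a b z)"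
  shows "AE z in lebesgue. u z = w z"
proof -
  note [measurable] = locally_integrable_measurable[OF u] locally_integrable_measurable[OF w]
  obtain u' where u': "u' \<in> borel_measurable borel" "AE z in lebesgue. u z = u' z"
    using lebesgue_ex_borel_representative locally_integrable_measurable[OF u] by blast
  obtain w' where w': "w' \<in> borel_measurable borel" "AE z in lebesgue. w z = w' z"
    using lebesgue_ex_borel_representative locally_integrable_measurable[OF w] by blast
  note [measurable] = u'(1) w'(1)
  have li: "locally_integrable u'" "locally_integrable w'"
    by (auto intro!: locally_integrable_cong_AE[OF u u'(2)] locally_integrable_cong_AE[OF w w'(2)]
        measurable_completion)
  note box = locally_integrable_box(1)[OF li(1) u'(1)] locally_integrable_box(1)[OF li(2) w'(1)]
  have "AE z in lborel. u' z - w' z = 0"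
  proof (rule AE_zero_if_bump_integrals_zero)
    show "set_integrable lborel (box a b) (\<lambda>z. u' z - w' z)" for a b
      by (intro set_integral_diff box)
    fix k :: real and a b :: 'a assume k: "k > 0"
    have [measurable]: "bump k a b \<in> borel_measurable lebesgue"
      "u' \<in> borel_measurable lebesgue" "w' \<in> borel_measurable lebesgue"
      by (auto intro!: measurable_completion)
    have "(LINT z|lborel. (u' z - w' z) * bump k a b z)
        = (LINT z|lborel. u' z * bump k a b z) - (LINT z|lborel. w' z * bump k a b z)"
      using bump_mult_integrable[OF k box(1)] bump_mult_integrable[OF k box(2)]
      by (simp add: left_diff_distrib)
    also have "(LINT z|lborel. u' z * bump k a b z) = (LINT z|lebesgue. u' z * bump k a b z)"
      by (simp add: integral_completion)
    also have "\<dots> = (LINT z|lebesgue. u z * bump k a b z)"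
      using u'(2) by (intro integral_cong_AE) auto
    also have "(LINT z|lborel. w' z * bump k a b z) = (LINT z|lebesgue. w' z * bump k a b z)"
      by (simp add: integral_completion)
    also have "\<dots> = (LINT z|lebesgue. w z * bump k a b z)"
      using w'(2) by (intro integral_cong_AE) auto
    finally show "(LINT z|lborel. (u' z - w' z) * bump k a b z) = 0"
      using eq[OF k] by simp
  qed auto
  then have "AE z in lebesgue. u' z - w' z = 0" by (rule AE_completion)
  then show ?thesis using u'(2) w'(2) by eventually_elim auto
qed

lemma has_weak_deriv_unique:
  assumes "has_weak_deriv vs u w" "has_weak_deriv vs u w'"
  shows "AE z in lebesgue. w z = w' z"
proof (rule AE_eq_if_bump_integrals_eq)
  show "locally_integrable w" "locally_integrable w'"
    using assms by (auto simp: has_weak_deriv_def)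
  fix k :: real and a b :: 'a assume "k > 0"
  then have "(-1) ^ length vs * (LINT z|lebesgue. w z * bump k a b z)
      = (-1) ^ length vs * (LINT z|lebesgue. w' z * bump k a b z)"
    using assms bump_test_function unfolding has_weak_deriv_def by metis
  then show "(LINT z|lebesgue. w z * bump k a b z) = (LINT z|lebesgue. w' z * bump k a b z)"
    by simp
qed

text \<open>Applied to \<open>weak_deriv [] u\<close>, which is a choice: the derivative of order
  zero is determined by \<open>u\<close> only up to null sets.\<close>

lemma has_weak_deriv_Nil:
  assumes "has_weak_deriv [] u w"
  shows "AE z in lebesgue. w z = u z"
proof (rule AE_eq_if_bump_integrals_eq)
  show "locally_integrable w" "locally_integrable u"
    using assms by (auto simp: has_weak_deriv_def)
  fix k :: real and a b :: 'a assume "k > 0"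
  from bump_test_function[OF this, of a b] assms
  show "(LINT z|lebesgue. w z * bump k a b z) = (LINT z|lebesgue. u z * bump k a b z)"
    by (auto simp: has_weak_deriv_def)
qed

section \<open>Weak derivatives and difference quotients\<close>

lemma lborel_integral_translate:
  fixes f :: "'a::euclidean_space \<Rightarrow> real"
  assumes "f \<in> borel_measurable borel"
  shows "(LINT z|lborel. f (z + c)) = (LINT z|lborel. f z)"
    and "integrable lborel (\<lambda>z. f (z + c)) \<longleftrightarrow> integrable lborel f"
proof -
  have d: "distr lborel borel (\<lambda>z. z + c) = lborel"
  proof -
    have "(\<lambda>z. z + c) = (+) c" by (auto simp: add.commute)
    then show ?thesis by (simp add: lborel_distr_plus)
  qed
  show "(LINT z|lborel. f (z + c)) = (LINT z|lborel. f z)"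
    using integral_distr[of "\<lambda>z. z + c" lborel borel f] assms by (simp add: d)
  show "integrable lborel (\<lambda>z. f (z + c)) \<longleftrightarrow> integrable lborel f"
    using integrable_distr_eq[of "\<lambda>z. z + c" lborel borel f] assms by (simp add: d)
qed

text \<open>Averaging along \<open>v\<close> and averaging along \<open>-v\<close> are adjoint: once
  the integrals over \<open>s\<close> and \<open>z\<close> are exchanged, the slices at fixed
  \<open>s\<close> differ by a translation. Absolute integrability is available because
  \<open>\<eta>\<close> is bounded with bounded support and the shift is at most \<open>h\<close>
  times \<open>v\<close>.\<close>

lemma line_average_Fubini:
  fixes w \<eta> :: "'a::euclidean_space \<Rightarrow> real"
  assumes w: "\<And>a b. set_integrable lborel (cbox a b) w"
    and [measurable]: "w \<in> borel_measurable borel" "\<eta> \<in> borel_measurable borel"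
    and \<eta>: "\<And>z. \<bar>\<eta> z\<bar> \<le> 1" "\<And>z. z \<notin> box a c \<Longrightarrow> \<eta> z = 0"
    and h: "0 \<le> h"
  shows "integrable lborel (\<lambda>z. \<eta> z * (LINT s:{0..h}|lborel. w (z + s *\<^sub>R v)))"
    and "(LINT z|lborel. w z * (LINT s:{0..h}|lborel. \<eta> (z - s *\<^sub>R v)))
       = (LINT z|lborel. \<eta> z * (LINT s:{0..h}|lborel. w (z + s *\<^sub>R v)))"
proof -
  let ?i = "indicator {0..h} :: real \<Rightarrow> real"
  obtain R where R: "\<And>z. z \<in> box a c \<Longrightarrow> norm z \<le> R"
    using bounded_box[of a c] unfolding bounded_iff by blast
  \<comment> \<open>A cube that contains every translate of the support of \<open>\<eta>\<close> by
    at most \<open>h\<close> times \<open>v\<close>; outside it the integrand \<open>f1\<close>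
    vanishes.\<close>
  obtain d where d: "cball 0 (R + h * norm v) \<subseteq> cbox (-d) (d::'a)"
    using bounded_subset_cbox_symmetric[OF bounded_cball] by metis
  have sub: "z \<in> cbox (-d) d" if "z - s *\<^sub>R v \<in> box a c" "s \<in> {0..h}" for z s
  proof -
    have "norm z \<le> norm (z - s *\<^sub>R v) + norm (s *\<^sub>R v)"
      using norm_triangle_ineq[of "z - s *\<^sub>R v" "s *\<^sub>R v"] by simp
    also have "\<dots> \<le> R + h * norm v"
      using R[OF that(1)] that(2) by (auto intro!: add_mono mult_right_mono)
    finally show ?thesis using d by auto
  qed
  define f1 where "f1 = (\<lambda>s z. ?i s * (w z * \<eta> (z - s *\<^sub>R v)))"
  define f2 where "f2 = (\<lambda>s z. ?i s * (w (z + s *\<^sub>R v) * \<eta> z))"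
  have [measurable]: "case_prod f1 \<in> borel_measurable (lborel \<Otimes>\<^sub>M lborel)"
    "case_prod f2 \<in> borel_measurable (lborel \<Otimes>\<^sub>M lborel)"
    unfolding f1_def f2_def by measurable
  have W: "integrable lborel (\<lambda>z. indicator (cbox (-d) d) z * w z)"
    using w[of "-d" d] by (simp add: set_integrable_def)
  have I: "integrable lborel ?i" using h by (simp add: integrable_indicator_iff)
  have int0: "integrable (lborel \<Otimes>\<^sub>M lborel) (\<lambda>(s, z). ?i s * (indicator (cbox (-d) d) z * w z))"
  proof (rule lborel_pair.Fubini_integrable)
    show "integrable lborel (\<lambda>s. LINT z|lborel. norm (case (s, z) of (s, z) \<Rightarrow> ?i s * (indicator (cbox (-d) d) z * w z)))"
      using I by (simp add: abs_mult)
    show "AE s in lborel. integrable lborel (\<lambda>z. case (s, z) of (s, z) \<Rightarrow> ?i s * (indicator (cbox (-d) d) z * w z))"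
      using W by simp
  qed measurable
  have int1: "integrable (lborel \<Otimes>\<^sub>M lborel) (case_prod f1)"
  proof (rule Bochner_Integration.integrable_bound[OF int0])
    show "AE p in lborel \<Otimes>\<^sub>M lborel. norm (case_prod f1 p)
        \<le> norm (case p of (s, z) \<Rightarrow> ?i s * (indicator (cbox (-d) d) z * w z))"
    proof (intro always_eventually allI)
      fix p :: "real \<times> 'a"
      obtain s z where p: "p = (s, z)" by (cases p)
      have "\<bar>\<eta> (z - s *\<^sub>R v)\<bar> \<le> indicator (cbox (-d) d) z" if "s \<in> {0..h}"
        using \<eta>(1)[of "z - s *\<^sub>R v"] \<eta>(2)[of "z - s *\<^sub>R v"] sub[OF _ that, of z]
        by (cases "z - s *\<^sub>R v \<in> box a c") auto
      then have "?i s * (\<bar>w z\<bar> * \<bar>\<eta> (z - s *\<^sub>R v)\<bar>) \<le> ?i s * (\<bar>w z\<bar> * indicator (cbox (-d) d) z)"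
        by (auto simp: indicator_def[of "{0..h}"] intro!: mult_left_mono)
      then show "norm (case_prod f1 p) \<le> norm (case p of (s, z) \<Rightarrow> ?i s * (indicator (cbox (-d) d) z * w z))"
        by (simp add: p f1_def abs_mult mult_ac)
    qed
  qed auto
  have shift: "(LINT z|lborel. f2 s z) = (LINT z|lborel. f1 s z)"
    "(LINT z|lborel. norm (f2 s z)) = (LINT z|lborel. norm (f1 s z))"
    "integrable lborel (f2 s) \<longleftrightarrow> integrable lborel (f1 s)" for s
    using lborel_integral_translate[of "f1 s" "s *\<^sub>R v"]
      lborel_integral_translate(1)[of "\<lambda>z. norm (f1 s z)" "s *\<^sub>R v"]
    by (simp_all add: f1_def f2_def)
  \<comment> \<open>Here \<open>w\<close> is evaluated at the shifted point, so integrability is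
    transferred slice by slice from \<open>f1\<close>, whose slices have the same integrals of
    absolute values.\<close>
  have int2: "integrable (lborel \<Otimes>\<^sub>M lborel) (case_prod f2)"
  proof (rule lborel_pair.Fubini_integrable)
    show "integrable lborel (\<lambda>s. LINT z|lborel. norm (case_prod f2 (s, z)))"
      using lborel_pair.integrable_fst[of "\<lambda>s z. norm (f1 s z)"] integrable_norm[OF int1]
      by (simp add: shift(2)[unfolded real_norm_def] split_beta')
    show "AE s in lborel. integrable lborel (\<lambda>z. case_prod f2 (s, z))"
      using lborel_pair.AE_integrable_fst[OF int1] by (simp add: shift)
  qed measurable
  have L1: "(LINT s|lborel. f1 s z) = w z * (LINT s:{0..h}|lborel. \<eta> (z - s *\<^sub>R v))" for z
    by (simp add: f1_def set_lebesgue_integral_def mult.left_commute)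
  have L2: "(LINT s|lborel. f2 s z) = \<eta> z * (LINT s:{0..h}|lborel. w (z + s *\<^sub>R v))" for z
    by (simp add: f2_def set_lebesgue_integral_def mult.left_commute mult.commute)
  show "integrable lborel (\<lambda>z. \<eta> z * (LINT s:{0..h}|lborel. w (z + s *\<^sub>R v)))"
    using lborel_pair.integrable_snd[OF int2] by (simp add: L2)
  have "(LINT z|lborel. LINT s|lborel. f1 s z) = (LINT s|lborel. LINT z|lborel. f1 s z)"
    by (rule lborel_pair.Fubini_integral[OF int1])
  also have "\<dots> = (LINT s|lborel. LINT z|lborel. f2 s z)" by (simp add: shift)
  also have "\<dots> = (LINT z|lborel. LINT s|lborel. f2 s z)"
    by (rule lborel_pair.Fubini_integral[OF int2, symmetric])
  finally show "(LINT z|lborel. w z * (LINT s:{0..h}|lborel. \<eta> (z - s *\<^sub>R v)))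
       = (LINT z|lborel. \<eta> z * (LINT s:{0..h}|lborel. w (z + s *\<^sub>R v)))"
    by (simp only: L1 L2)
qed

lemma bump_split:
  assumes "b \<in> Basis"
  shows "bump k a c z = bump1 k (a \<bullet> b) (c \<bullet> b) (z \<bullet> b)
    * (\<Prod>i\<in>Basis - {b}. bump1 k (a \<bullet> i) (c \<bullet> i) (z \<bullet> i))"
  unfolding bump_def by (rule prod.remove) (use assms in auto)

text \<open>Testing a weak derivative against this average turns the derivative into a difference.\<close>

lemma bump_average_test_function:
  fixes a c b :: "'a::euclidean_space"
  assumes b: "b \<in> Basis" and k: "k > 0" and h: "h \<ge> 0"
  defines "\<psi> \<equiv> \<lambda>z. LINT s:{0..h}|lborel. bump k a c (z - s *\<^sub>R b)"
  shows "\<psi> \<in> test_functions"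
    and "iter_deriv [b] \<psi> = (\<lambda>z. bump k a c z - bump k a c (z - h *\<^sub>R b))"
proof -
  define g where "g = bump1 k (a \<bullet> b) (c \<bullet> b)"
  define P where "P = (\<lambda>z. \<Prod>i\<in>Basis - {b}. bump1 k (a \<bullet> i) (c \<bullet> i) (z \<bullet> i))"
  have split: "bump k a c z = g (z \<bullet> b) * P z" for z
    using bump_split[OF b] by (simp add: g_def P_def)
  have P_shift: "P (z + t *\<^sub>R b) = P z" for z t
    using b unfolding P_def by (intro prod.cong) (auto simp: inner_add_left inner_Basis)
  have P_shift': "P (z - t *\<^sub>R b) = P z" for z t
    using P_shift[of z "-t"] by simp
  have bb: "b \<bullet> b = 1" using b by simp
  have g_cont: "continuous_on UNIV g"
    using smooth_alg_continuous[OF bump1_alg[of k _ _ "1::real"], of UNIV]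
    by (simp add: g_def)
  have "\<exists>G. \<forall>x. (G has_vector_derivative g x) (at x)"
    using einterval_antiderivative[of "-\<infinity>" \<infinity> g] g_cont
    by (auto simp: continuous_on_eq_continuous_at)
  then obtain G where G: "(G has_vector_derivative g x) (at x)" for x by blast
  then have G': "(G has_real_derivative g x) (at x)" for x
    by (simp add: has_real_derivative_iff_has_vector_derivative)
  \<comment> \<open>Only the factor in direction \<open>b\<close> moves with \<open>s\<close>, so
    the average is an increment of the primitive \<open>G\<close> times the product \<open>P\<close>
    of the other factors.\<close>
  have \<psi>: "\<psi> z = (G (z \<bullet> b) - G (z \<bullet> b - h)) * P z" for z
  proof -
    have "(LINT s:{0..h}|lborel. g (z \<bullet> b - s)) = - G (z \<bullet> b - h) - - G (z \<bullet> b - 0)"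
      unfolding set_lebesgue_integral_def
    proof (rule integral_FTC_Icc[OF h])
      show "continuous_on {0..h} (\<lambda>s. g (z \<bullet> b - s))"
        by (intro continuous_on_compose2[OF g_cont] continuous_intros) auto
      fix s
      have "((\<lambda>s. - G (z \<bullet> b - s)) has_real_derivative g (z \<bullet> b - s)) (at s)"
        by (auto intro!: derivative_eq_intros DERIV_chain'[OF _ G'])
      then show "((\<lambda>s. - G (z \<bullet> b - s)) has_vector_derivative g (z \<bullet> b - s)) (at s within {0..h})"
        by (auto simp: has_real_derivative_iff_has_vector_derivative
            intro: has_vector_derivative_at_within)
    qed
    moreover have "\<psi> z = (LINT s:{0..h}|lborel. g (z \<bullet> b - s)) * P z"
      unfolding \<psi>_def split P_shift' by (simp add: inner_diff_left bb)
    ultimately show ?thesis by simp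
  qed
  \<comment> \<open>\<open>G\<close> is known only through its derivative, so it enters the algebra
    by the rule \<open>prim\<close>.\<close>
  have G_alg: "(\<lambda>z. G (z \<bullet> b - t)) \<in> smooth_alg" for t
  proof (rule smooth_alg.prim)
    show "((\<lambda>z. G (z \<bullet> b - t)) has_derivative (\<lambda>h. h \<bullet> b * g (z \<bullet> b - t))) (at z)" for z
      by (rule has_derivative_eq_rhs[OF has_derivative_compose[OF _ G'[unfolded has_field_derivative_def]]])
         (auto intro!: derivative_eq_intros)
    have "g (z \<bullet> b - t) = bump1 k (a \<bullet> b + t) (c \<bullet> b + t) (z \<bullet> b)" for z
      by (simp add: g_def bump1_def algebra_simps)
    then show "(\<lambda>z. g (z \<bullet> b - t)) \<in> smooth_alg" using bump1_alg by simp
  qed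
  have P_alg: "P \<in> smooth_alg"
    unfolding P_def by (intro smooth_alg_prod bump1_alg) auto
  have "(\<lambda>z. (G (z \<bullet> b - 0) + (- 1) * G (z \<bullet> b - h)) * P z) \<in> smooth_alg"
    by (intro smooth_alg_intros G_alg P_alg)
  then have \<psi>_alg: "\<psi> \<in> smooth_alg" by (simp add: \<psi>[abs_def])
  show "\<psi> \<in> test_functions"
  proof (rule smooth_alg_test_function[OF \<psi>_alg])
    fix z assume z: "z \<notin> cbox a (c + h *\<^sub>R b)"
    have "bump k a c (z - s *\<^sub>R b) = 0" if s: "s \<in> {0..h}" for s
    proof (rule bump_eq_0[OF k], rule notI)
      assume i: "z - s *\<^sub>R b \<in> box a c"
      have "a \<bullet> i \<le> z \<bullet> i \<and> z \<bullet> i \<le> (c + h *\<^sub>R b) \<bullet> i" if "i \<in> Basis" for i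
        using i s that b h by (cases "i = b") (auto simp: box_def inner_Basis inner_simps dest: bspec[of _ _ i])
      then show False using z by (auto simp: mem_box)
    qed
    then show "\<psi> z = 0" unfolding \<psi>_def set_lebesgue_integral_def
      by (intro integral_eq_zero_AE) (auto simp: indicator_def)
  qed
  \<comment> \<open>Restriction to the line through \<open>z\<close> in direction \<open>b\<close>
    leaves a function of one variable with an explicit derivative; uniqueness of derivatives
    identifies the two.\<close>
  have "frechet_derivative \<psi> (at z) b = bump k a c z - bump k a c (z - h *\<^sub>R b)" for z
  proof -
    have "(\<psi> has_derivative frechet_derivative \<psi> (at z)) (at (z + 0 *\<^sub>R b))"
      using smooth_alg_differentiable[OF \<psi>_alg, of z] frechet_derivative_works by auto
    then have "((\<lambda>t. \<psi> (z + t *\<^sub>R b)) has_derivative (\<lambda>t. frechet_derivative \<psi> (at z) (t *\<^sub>R b))) (at 0)"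
      by (rule has_derivative_compose[rotated]) (auto intro!: derivative_eq_intros)
    moreover have "frechet_derivative \<psi> (at z) (t *\<^sub>R b) = frechet_derivative \<psi> (at z) b * t" for t
      using linear_frechet_derivative[OF smooth_alg_differentiable[OF \<psi>_alg], of z]
      by (simp add: linear_cmul)
    ultimately have 1: "((\<lambda>t. \<psi> (z + t *\<^sub>R b)) has_real_derivative frechet_derivative \<psi> (at z) b) (at 0)"
      by (simp add: has_field_derivative_def)
    have "((\<lambda>t. (G (z \<bullet> b + t) - G (z \<bullet> b + t - h)) * P z) has_real_derivative
        (g (z \<bullet> b + 0) - g (z \<bullet> b + 0 - h)) * P z) (at 0)"
      by (auto intro!: derivative_eq_intros DERIV_chain'[OF _ G'])
    moreover have "(\<lambda>t. \<psi> (z + t *\<^sub>R b)) = (\<lambda>t. (G (z \<bullet> b + t) - G (z \<bullet> b + t - h)) * P z)"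
      by (simp add: \<psi> P_shift inner_add_left bb)
    ultimately have "frechet_derivative \<psi> (at z) b = (g (z \<bullet> b) - g (z \<bullet> b - h)) * P z"
      using 1 DERIV_unique by fastforce
    then show ?thesis
      by (simp add: split P_shift' inner_diff_left bb left_diff_distrib)
  qed
  then show "iter_deriv [b] \<psi> = (\<lambda>z. bump k a c z - bump k a c (z - h *\<^sub>R b))" by simp
qed

text \<open>Tested with the average \<open>\<psi>\<close> of a bump \<open>\<phi>\<close>, the weak
  identity pairs \<open>u\<close> with \<open>\<phi>\<close> minus its translate. Translation moves
  that shift onto \<open>u\<close>, and adjointness moves the averaging onto \<open>w\<close>; so
  the difference of the two sides has zero integral against every bump.\<close>

lemma weak_deriv_difference:
  fixes u w :: "'a::euclidean_space \<Rightarrow> real"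
  assumes wd: "has_weak_deriv [b] u w" and b: "b \<in> Basis" and h: "h \<ge> 0"
    and [measurable]: "u \<in> borel_measurable borel" "w \<in> borel_measurable borel"
  shows "AE z in lborel. u (z + h *\<^sub>R b) - u z = (LINT s:{0..h}|lborel. w (z + s *\<^sub>R b))"
proof -
  define I where "I = (\<lambda>z. LINT s:{0..h}|lborel. w (z + s *\<^sub>R b))"
  have [measurable]: "I \<in> borel_measurable borel"
    unfolding I_def set_lebesgue_integral_def by measurable
  have li: "locally_integrable u" "locally_integrable w"
    using wd by (auto simp: has_weak_deriv_def)
  have u_int: "set_integrable lborel (box a c) u" for a c
    using li(1) by (intro locally_integrable_box) auto
  have w_int: "set_integrable lborel (cbox a c) w" for a c
    using li(2) by (intro locally_integrable_box) auto
  have us_int: "set_integrable lborel (box a c) (\<lambda>z. u (z + h *\<^sub>R b))" for a c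
  proof -
    have "(\<lambda>z. indicator (box a c) z *\<^sub>R u (z + h *\<^sub>R b))
        = (\<lambda>z. indicator (box (a + h *\<^sub>R b) (c + h *\<^sub>R b)) (z + h *\<^sub>R b) *\<^sub>R u (z + h *\<^sub>R b))"
      by (auto simp: indicator_def mem_box inner_simps)
    then show ?thesis
      using u_int[of "a + h *\<^sub>R b" "c + h *\<^sub>R b"]
        lborel_integral_translate(2)[of "\<lambda>z. indicator (box (a + h *\<^sub>R b) (c + h *\<^sub>R b)) z *\<^sub>R u z" "h *\<^sub>R b"]
      by (simp add: set_integrable_def)
  qed
  have I_int: "set_integrable lborel (box a c) I" for a c
    using line_average_Fubini(1)[OF w_int, of "indicator (box a c)" a c h b] h
    by (simp add: set_integrable_def I_def)
  have "AE z in lborel. u (z + h *\<^sub>R b) - u z - I z = 0"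
  proof (rule AE_zero_if_bump_integrals_zero)
    show "set_integrable lborel (box a c) (\<lambda>z. u (z + h *\<^sub>R b) - u z - I z)" for a c
      by (intro set_integral_diff us_int u_int I_int)
    fix k :: real and a c :: 'a assume k: "k > 0"
    define \<phi> where "\<phi> = bump k a c"
    define \<psi> where "\<psi> = (\<lambda>z. LINT s:{0..h}|lborel. \<phi> (z - s *\<^sub>R b))"
    have [measurable]: "\<phi> \<in> borel_measurable borel" by (simp add: \<phi>_def)
    have [measurable]: "\<psi> \<in> borel_measurable borel"
      unfolding \<psi>_def set_lebesgue_integral_def by measurable
    note int = bump_mult_integrable[OF k u_int, of a c] bump_mult_integrable[OF k us_int, of a c]
      bump_mult_integrable[OF k I_int, of a c]
    have 1: "(LINT z|lborel. u z * (\<phi> z - \<phi> (z - h *\<^sub>R b))) = - (LINT z|lborel. w z * \<psi> z)"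
    proof -
      have "\<psi> \<in> test_functions" and d: "iter_deriv [b] \<psi> = (\<lambda>z. \<phi> z - \<phi> (z - h *\<^sub>R b))"
        unfolding \<psi>_def \<phi>_def by (rule bump_average_test_function[OF b k h])+
      then have "(LINT z|lebesgue. u z * iter_deriv [b] \<psi> z) = - (LINT z|lebesgue. w z * \<psi> z)"
        using wd unfolding has_weak_deriv_def by fastforce
      then show ?thesis unfolding d by (simp add: integral_completion)
    qed
    have 2: "(LINT z|lborel. u z * \<phi> (z - h *\<^sub>R b)) = (LINT z|lborel. u (z + h *\<^sub>R b) * \<phi> z)"
      and two: "integrable lborel (\<lambda>z. u z * \<phi> (z - h *\<^sub>R b))"
      using lborel_integral_translate[of "\<lambda>z. u z * \<phi> (z - h *\<^sub>R b)" "h *\<^sub>R b"] int(2)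
      by (auto simp: \<phi>_def)
    have 3: "(LINT z|lborel. w z * \<psi> z) = (LINT z|lborel. \<phi> z * I z)"
      unfolding \<psi>_def I_def using bump_bounds[of k a c] bump_eq_0[OF k, of _ a c] h
      by (intro line_average_Fubini(2)[OF w_int, of \<phi> a c]) (auto simp: \<phi>_def abs_le_iff intro: order_trans[of _ 0])
    have 4: "(LINT z|lborel. u z * (\<phi> z - \<phi> (z - h *\<^sub>R b)))
        = (LINT z|lborel. u z * \<phi> z) - (LINT z|lborel. u z * \<phi> (z - h *\<^sub>R b))"
      unfolding right_diff_distrib
      using int(1) two by (intro Bochner_Integration.integral_diff) (auto simp: \<phi>_def)
    have "(LINT z|lborel. (u (z + h *\<^sub>R b) - u z - I z) * \<phi> z)
        = (LINT z|lborel. u (z + h *\<^sub>R b) * \<phi> z) - (LINT z|lborel. u z * \<phi> z) - (LINT z|lborel. I z * \<phi> z)"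
      using int by (simp add: left_diff_distrib \<phi>_def)
    also have "\<dots> = - (LINT z|lborel. u z * (\<phi> z - \<phi> (z - h *\<^sub>R b))) - (LINT z|lborel. I z * \<phi> z)"
      unfolding 4 2 by simp
    also have "\<dots> = 0" unfolding 1 3 by (simp add: mult.commute)
    finally show "(LINT z|lborel. (u (z + h *\<^sub>R b) - u z - I z) * bump k a c z) = 0"
      by (simp add: \<phi>_def)
  next
    show "(\<lambda>z. u (z + h *\<^sub>R b) - u z - I z) \<in> borel_measurable borel" by measurable
  qed
  then show ?thesis by eventually_elim (simp add: I_def)
qed

section \<open>Squared \<open>L^2\<close> estimates for translations\<close>

abbreviation square_integral :: "('a::euclidean_space \<Rightarrow> ennreal) \<Rightarrow> ('a \<Rightarrow> real) \<Rightarrow> ennreal" where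
  "square_integral p u \<equiv> \<integral>\<^sup>+z. p z * ennreal ((u z)\<^sup>2) \<partial>lborel"

text \<open>Cauchy-Schwarz with the constant 1 on \<open>A\<close>. If \<open>f\<close> is not
  integrable on \<open>A\<close>, the integral on the left has the default value 0 and the bound is
  trivial.\<close>

lemma square_set_integral_le:
  fixes f :: "'a \<Rightarrow> real"
  assumes [measurable]: "f \<in> borel_measurable M" "A \<in> sets M"
  shows "ennreal ((LINT x:A|M. f x)\<^sup>2)
    \<le> emeasure M A * (\<integral>\<^sup>+x. indicator A x * ennreal ((f x)\<^sup>2) \<partial>M)"
proof (cases "set_integrable M A f")
  case True
  have "ennreal ((LINT x:A|M. f x)\<^sup>2) = (ennreal (norm (LINT x:A|M. f x)))\<^sup>2"
    by (simp add: ennreal_power)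
  also have "\<dots> \<le> (\<integral>\<^sup>+x. norm (indicator A x *\<^sub>R f x) \<partial>M)\<^sup>2"
    using True unfolding set_integrable_def set_lebesgue_integral_def
    by (intro power_mono integral_norm_bound_ennreal) auto
  also have "\<dots> = (\<integral>\<^sup>+x. indicator A x * ennreal (norm (indicator A x *\<^sub>R f x)) \<partial>M)\<^sup>2"
    by (intro arg_cong[where f = "\<lambda>x. x\<^sup>2"] nn_integral_cong) (auto simp: indicator_def)
  also have "\<dots> \<le> (\<integral>\<^sup>+x. (indicator A x)\<^sup>2 \<partial>M) * (\<integral>\<^sup>+x. (ennreal (norm (indicator A x *\<^sub>R f x)))\<^sup>2 \<partial>M)"
    by (rule Cauchy_Schwarz_nn_integral) auto
  also have "(\<integral>\<^sup>+x. (indicator A x)\<^sup>2 \<partial>M) = (\<integral>\<^sup>+x. indicator A x \<partial>M)"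
    by (intro nn_integral_cong) (auto simp: indicator_def)
  also have "\<dots> = emeasure M A" by simp
  also have "(\<integral>\<^sup>+x. (ennreal (norm (indicator A x *\<^sub>R f x)))\<^sup>2 \<partial>M)
      = (\<integral>\<^sup>+x. indicator A x * ennreal ((f x)\<^sup>2) \<partial>M)"
    by (intro nn_integral_cong) (auto simp: indicator_def ennreal_power)
  finally show ?thesis .
next
  case False
  then have "(LINT x:A|M. f x) = 0"
    by (simp add: set_lebesgue_integral_def set_integrable_def not_integrable_integral_eq)
  then show ?thesis by simp
qed

lemma square_add_le: "ennreal ((x + y)\<^sup>2) \<le> 2 * ennreal (x\<^sup>2) + 2 * ennreal (y\<^sup>2)"
proof -
  have "(x + y)\<^sup>2 \<le> 2 * x\<^sup>2 + 2 * y\<^sup>2"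
    using zero_le_power2[of "x - y"] by (simp add: power2_eq_square algebra_simps)
  then have "ennreal ((x + y)\<^sup>2) \<le> ennreal (2 * x\<^sup>2 + 2 * y\<^sup>2)" by (rule ennreal_leI)
  then show ?thesis by (simp add: ennreal_plus ennreal_mult)
qed

lemma square_diff_le: "ennreal ((x - y)\<^sup>2) \<le> 2 * ennreal (x\<^sup>2) + 2 * ennreal (y\<^sup>2)"
  using square_add_le[of x "-y"] by simp

lemma nn_integral_lborel_translate:
  fixes f :: "'a::euclidean_space \<Rightarrow> ennreal"
  assumes "f \<in> borel_measurable borel"
  shows "(\<integral>\<^sup>+z. f (z + c) \<partial>lborel) = (\<integral>\<^sup>+z. f z \<partial>lborel)"
proof -
  have "(\<lambda>z. z + c) = (+) c" by (auto simp: add.commute)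
  then have "distr lborel borel (\<lambda>z. z + c) = lborel" by (simp add: lborel_distr_plus)
  then show ?thesis
    using nn_integral_distr[of "\<lambda>z. z + c" lborel borel f] assms by simp
qed

lemma AE_lborel_translate:
  fixes P :: "'a::euclidean_space \<Rightarrow> bool"
  assumes "AE z in lborel. P z"
  shows "AE z in lborel. P (z + c)"
proof -
  have "(\<lambda>z. z + c) = (+) c" by (auto simp: add.commute)
  then have d: "distr lborel borel (\<lambda>z. z + c) = lborel" by (simp add: lborel_distr_plus)
  have "AE z in distr lborel borel (\<lambda>z. z + c). P z" unfolding d by (rule assms)
  then show ?thesis by (rule AE_distrD[rotated]) simp
qed

lemma nn_integral_reflect:
  fixes f :: "real \<Rightarrow> ennreal"
  assumes [measurable]: "f \<in> borel_measurable borel"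
  shows "(\<integral>\<^sup>+s. f (h - s) \<partial>lborel) = (\<integral>\<^sup>+s. f s \<partial>lborel)"
  using nn_integral_real_affine[of f "-1" h] by simp

lemma weak_deriv_square_difference:
  fixes u w :: "'a::euclidean_space \<Rightarrow> real"
  assumes wd: "has_weak_deriv [b] u w" and b: "b \<in> Basis" and h: "h \<ge> 0"
    and \<sigma>: "\<sigma> = 1 \<or> \<sigma> = -1"
    and [measurable]: "u \<in> borel_measurable borel" "w \<in> borel_measurable borel"
  shows "AE z in lborel. ennreal ((u (z + (\<sigma> * h) *\<^sub>R b) - u z)\<^sup>2)
    \<le> ennreal h * (\<integral>\<^sup>+s. indicator {0..h} s * ennreal ((w (z + (\<sigma> * s) *\<^sub>R b))\<^sup>2) \<partial>lborel)"
proof -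
  have *: "AE z in lborel. ennreal ((u (z + h *\<^sub>R b) - u z)\<^sup>2)
    \<le> ennreal h * (\<integral>\<^sup>+s. indicator {0..h} s * ennreal ((w (z + s *\<^sub>R b))\<^sup>2) \<partial>lborel)"
    using weak_deriv_difference[OF wd b h, simplified]
  proof eventually_elim
    case (elim z)
    show ?case
      unfolding elim using square_set_integral_le[of "\<lambda>s. w (z + s *\<^sub>R b)" lborel "{0..h}"] h
      by simp
  qed
  show ?thesis
  proof (cases "\<sigma> = 1")
    case True
    then show ?thesis using * by simp
  next
    case False
    then have s: "\<sigma> = -1" using \<sigma> by simp
    \<comment> \<open>The backward step from \<open>z\<close> is a forward step that ends at
      \<open>z\<close>; reflecting \<open>s\<close> to \<open>h - s\<close> parametrises the segment
      from \<open>z\<close> again.\<close>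
    show ?thesis using AE_lborel_translate[OF *, of "- h *\<^sub>R b"]
    proof eventually_elim
      case (elim z)
      have "(\<integral>\<^sup>+s. indicator {0..h} s * ennreal ((w (z + - h *\<^sub>R b + s *\<^sub>R b))\<^sup>2) \<partial>lborel)
        = (\<integral>\<^sup>+s. indicator {0..h} (h - s) * ennreal ((w (z + - h *\<^sub>R b + (h - s) *\<^sub>R b))\<^sup>2) \<partial>lborel)"
        by (rule nn_integral_reflect[symmetric]) auto
      also have "\<dots> = (\<integral>\<^sup>+s. indicator {0..h} s * ennreal ((w (z + (\<sigma> * s) *\<^sub>R b))\<^sup>2) \<partial>lborel)"
        by (intro nn_integral_cong) (auto simp: indicator_def s algebra_simps)
      finally show ?case
        using elim by (simp add: s power2_commute)
    qed
  qed
qed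

text \<open>The bound on \<open>p\<close> carries the weight to the point where \<open>w\<close> is
  evaluated, at the price \<open>\<beta> s\<close>; Fubini and translation invariance then remove
  the shift. Used with indicators and \<open>\<beta> = 1\<close> for local estimates, and with the
  density and an exponential \<open>\<beta>\<close> for tails.\<close>

lemma weighted_square_difference_le:
  fixes u w :: "'a::euclidean_space \<Rightarrow> real"
  assumes wd: "has_weak_deriv [b] u w" and b: "b \<in> Basis" and h: "h \<ge> 0"
    and \<sigma>: "\<sigma> = 1 \<or> \<sigma> = -1"
    and [measurable]: "u \<in> borel_measurable borel" "w \<in> borel_measurable borel"
      "p \<in> borel_measurable borel" "q \<in> borel_measurable borel" "\<beta> \<in> borel_measurable borel"
    and le: "\<And>z s. s \<in> {0..h} \<Longrightarrow> p z \<le> \<beta> s * q (z + (\<sigma> * s) *\<^sub>R b)"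
  shows "square_integral p (\<lambda>z. u (z + (\<sigma> * h) *\<^sub>R b) - u z)
    \<le> ennreal h * (\<integral>\<^sup>+s. indicator {0..h} s * \<beta> s \<partial>lborel) * square_integral q w"
proof -
  have "square_integral p (\<lambda>z. u (z + (\<sigma> * h) *\<^sub>R b) - u z)
    \<le> (\<integral>\<^sup>+z. p z * (ennreal h * (\<integral>\<^sup>+s. indicator {0..h} s * ennreal ((w (z + (\<sigma> * s) *\<^sub>R b))\<^sup>2) \<partial>lborel)) \<partial>lborel)"
    using weak_deriv_square_difference[OF wd b h \<sigma>, simplified]
    by (intro nn_integral_mono_AE) (elim eventually_mono, rule mult_left_mono, simp_all)
  also have "\<dots> = (\<integral>\<^sup>+z. ennreal h * (\<integral>\<^sup>+s. p z * (indicator {0..h} s * ennreal ((w (z + (\<sigma> * s) *\<^sub>R b))\<^sup>2)) \<partial>lborel) \<partial>lborel)"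
    by (intro nn_integral_cong) (simp add: nn_integral_cmult mult.left_commute)
  also have "\<dots> = ennreal h * (\<integral>\<^sup>+z. \<integral>\<^sup>+s. p z * (indicator {0..h} s * ennreal ((w (z + (\<sigma> * s) *\<^sub>R b))\<^sup>2)) \<partial>lborel \<partial>lborel)"
    by (rule nn_integral_cmult) measurable
  also have "(\<integral>\<^sup>+z. \<integral>\<^sup>+s. p z * (indicator {0..h} s * ennreal ((w (z + (\<sigma> * s) *\<^sub>R b))\<^sup>2)) \<partial>lborel \<partial>lborel)
     = (\<integral>\<^sup>+s. \<integral>\<^sup>+z. p z * (indicator {0..h} s * ennreal ((w (z + (\<sigma> * s) *\<^sub>R b))\<^sup>2)) \<partial>lborel \<partial>lborel)"
    by (rule lborel_pair.Fubini'[symmetric]) measurable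
  also have "\<dots> \<le> (\<integral>\<^sup>+s. indicator {0..h} s * \<beta> s * square_integral q w \<partial>lborel)"
  proof (intro nn_integral_mono)
    fix s
    have "(\<integral>\<^sup>+z. p z * (indicator {0..h} s * ennreal ((w (z + (\<sigma> * s) *\<^sub>R b))\<^sup>2)) \<partial>lborel)
      \<le> (\<integral>\<^sup>+z. indicator {0..h} s * \<beta> s * (q (z + (\<sigma> * s) *\<^sub>R b) * ennreal ((w (z + (\<sigma> * s) *\<^sub>R b))\<^sup>2)) \<partial>lborel)"
    proof (intro nn_integral_mono)
      fix z
      show "p z * (indicator {0..h} s * ennreal ((w (z + (\<sigma> * s) *\<^sub>R b))\<^sup>2))
        \<le> indicator {0..h} s * \<beta> s * (q (z + (\<sigma> * s) *\<^sub>R b) * ennreal ((w (z + (\<sigma> * s) *\<^sub>R b))\<^sup>2))"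
        using le[of s z] by (cases "s \<in> {0..h}") (auto simp: mult.assoc[symmetric] intro!: mult_right_mono)
    qed
    also have "\<dots> = indicator {0..h} s * \<beta> s * square_integral (\<lambda>z. q (z + (\<sigma> * s) *\<^sub>R b)) (\<lambda>z. w (z + (\<sigma> * s) *\<^sub>R b))"
      by (rule nn_integral_cmult) measurable
    also have "square_integral (\<lambda>z. q (z + (\<sigma> * s) *\<^sub>R b)) (\<lambda>z. w (z + (\<sigma> * s) *\<^sub>R b))
        = square_integral q w"
      by (rule nn_integral_lborel_translate) measurable
    finally show "(\<integral>\<^sup>+z. p z * (indicator {0..h} s * ennreal ((w (z + (\<sigma> * s) *\<^sub>R b))\<^sup>2)) \<partial>lborel)
      \<le> indicator {0..h} s * \<beta> s * square_integral q w" .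
  qed
  also have "\<dots> = (\<integral>\<^sup>+s. indicator {0..h} s * \<beta> s \<partial>lborel) * square_integral q w"
    by (rule nn_integral_multc) measurable
  finally show ?thesis by (simp add: mult.assoc mult_left_mono)
qed

text \<open>The shift by \<open>y\<close> is performed one coordinate at a time.\<close>

lemma square_translation_le:
  fixes u :: "'a::euclidean_space \<Rightarrow> real" and w :: "'a \<Rightarrow> 'a \<Rightarrow> real"
  assumes wd: "\<And>b. b \<in> Basis \<Longrightarrow> has_weak_deriv [b] u (w b)"
    and [measurable]: "u \<in> borel_measurable borel" "X \<in> sets borel" "Y \<in> sets borel"
    and w: "\<And>b. b \<in> Basis \<Longrightarrow> w b \<in> borel_measurable borel"
    and sub: "\<And>z v. z \<in> X \<Longrightarrow> (\<And>b. b \<in> Basis \<Longrightarrow> \<bar>v \<bullet> b\<bar> \<le> r) \<Longrightarrow> z + v \<in> Y"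
    and y: "\<And>b. b \<in> Basis \<Longrightarrow> \<bar>y \<bullet> b\<bar> \<le> r"
  shows "square_integral (indicator X) (\<lambda>z. u (z + y) - u z)
    \<le> ennreal (2 ^ DIM('a) * r\<^sup>2) * (\<Sum>b\<in>Basis. \<integral>\<^sup>+z. indicator Y z * ennreal ((w b z)\<^sup>2) \<partial>lborel)"
proof -
  have r: "r \<ge> 0" using y nonempty_Basis by fastforce
  define D where "D b = square_integral (indicator Y) (w b)" for b
  define yS where "yS S = (\<Sum>b\<in>S. (y \<bullet> b) *\<^sub>R b)" for S
  have "square_integral (indicator X) (\<lambda>z. u (z + yS S) - u z)
    \<le> ennreal (2 ^ card S * r\<^sup>2) * (\<Sum>b\<in>S. D b)" if "finite S" "S \<subseteq> Basis" for S
    using that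
  proof (induction S rule: finite_induct)
    case empty
    then show ?case by (simp add: yS_def)
  next
    case (insert c S)
    then have c: "c \<in> Basis" "S \<subseteq> Basis" by auto
    note [measurable] = w[OF c(1)]
    define h where "h = \<bar>y \<bullet> c\<bar>"
    define \<sigma> :: real where "\<sigma> = (if y \<bullet> c \<ge> 0 then 1 else -1)"
    have \<sigma>: "\<sigma> = 1 \<or> \<sigma> = -1" "\<sigma> * h = y \<bullet> c" by (auto simp: \<sigma>_def h_def)
    have h: "0 \<le> h" "h \<le> r" using y c by (auto simp: h_def)
    have y_ins: "yS (insert c S) = yS S + (\<sigma> * h) *\<^sub>R c"
      using insert by (simp add: yS_def \<sigma> add.commute)
    have coord: "yS S \<bullet> b = (if b \<in> S then y \<bullet> b else 0)" if "b \<in> Basis" for b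
    proof -
      have "yS S \<bullet> b = (\<Sum>i\<in>S. if i = b then y \<bullet> b else 0)"
        unfolding yS_def inner_sum_left using c that
        by (intro sum.cong) (auto simp: inner_Basis subset_iff)
      then show ?thesis using insert by simp
    qed
    \<comment> \<open>The step along \<open>c\<close> starts at the point already shifted by
      \<open>yS S\<close>, so the indicator is shifted back before the one-axis estimate is
      applied.\<close>
    have "square_integral (\<lambda>z. indicator X (z - yS S)) (\<lambda>z. u (z + (\<sigma> * h) *\<^sub>R c) - u z)
      \<le> ennreal h * (\<integral>\<^sup>+s. indicator {0..h} s * 1 \<partial>lborel) * square_integral (indicator Y) (w c)"
    proof (rule weighted_square_difference_le[OF wd[OF c(1)] c(1) h(1) \<sigma>(1)])
      fix z s assume s: "s \<in> {0..h}"
      have "z + (\<sigma> * s) *\<^sub>R c \<in> Y" if "z - yS S \<in> X"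
      proof -
        have "z - yS S + (yS S + (\<sigma> * s) *\<^sub>R c) \<in> Y"
        proof (rule sub[OF that])
          fix b :: 'a assume b: "b \<in> Basis"
          show "\<bar>(yS S + (\<sigma> * s) *\<^sub>R c) \<bullet> b\<bar> \<le> r"
            using b c s h y[OF b] insert \<sigma>(1)
            by (auto simp: inner_add_left coord inner_Basis abs_mult)
        qed
        then show ?thesis by (simp add: add.assoc[symmetric])
      qed
      then show "indicator X (z - yS S) \<le> 1 * (indicator Y (z + (\<sigma> * s) *\<^sub>R c) :: ennreal)"
        by (auto simp: indicator_def)
    qed auto
    also have "ennreal h * (\<integral>\<^sup>+s. indicator {0..h} s * 1 \<partial>lborel) = ennreal (h\<^sup>2)"
      using h by (simp add: power2_eq_square ennreal_mult)
    also have "ennreal (h\<^sup>2) * square_integral (indicator Y) (w c) \<le> ennreal (r\<^sup>2) * D c"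
      using h unfolding D_def by (intro mult_right_mono ennreal_leI power_mono) auto
    also have "square_integral (\<lambda>z. indicator X (z - yS S)) (\<lambda>z. u (z + (\<sigma> * h) *\<^sub>R c) - u z)
      = square_integral (indicator X) (\<lambda>z. u (z + yS S + (\<sigma> * h) *\<^sub>R c) - u (z + yS S))"
      by (subst nn_integral_lborel_translate[where c = "yS S", symmetric]) simp_all
    finally have step: "square_integral (indicator X) (\<lambda>z. u (z + yS S + (\<sigma> * h) *\<^sub>R c) - u (z + yS S))
      \<le> ennreal (r\<^sup>2) * D c" .
    have "square_integral (indicator X) (\<lambda>z. u (z + yS (insert c S)) - u z)
      \<le> (\<integral>\<^sup>+z. 2 * (indicator X z * ennreal ((u (z + yS S + (\<sigma> * h) *\<^sub>R c) - u (z + yS S))\<^sup>2))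
          + 2 * (indicator X z * ennreal ((u (z + yS S) - u z)\<^sup>2)) \<partial>lborel)"
    proof (intro nn_integral_mono)
      fix z
      show "indicator X z * ennreal ((u (z + yS (insert c S)) - u z)\<^sup>2)
        \<le> 2 * (indicator X z * ennreal ((u (z + yS S + (\<sigma> * h) *\<^sub>R c) - u (z + yS S))\<^sup>2))
          + 2 * (indicator X z * ennreal ((u (z + yS S) - u z)\<^sup>2))"
        using square_add_le[of "u (z + yS S + (\<sigma> * h) *\<^sub>R c) - u (z + yS S)" "u (z + yS S) - u z"]
        by (cases "z \<in> X") (auto simp: y_ins add.assoc)
    qed
    also have "\<dots> = 2 * square_integral (indicator X) (\<lambda>z. u (z + yS S + (\<sigma> * h) *\<^sub>R c) - u (z + yS S))
          + 2 * square_integral (indicator X) (\<lambda>z. u (z + yS S) - u z)"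
      by (subst nn_integral_add) (auto simp: nn_integral_cmult)
    \<comment> \<open>Each further axis doubles the previous constant; this is the source of the
      power of 2.\<close>
    also have "\<dots> \<le> 2 * (ennreal (r\<^sup>2) * D c) + 2 * (ennreal (2 ^ card S * r\<^sup>2) * (\<Sum>b\<in>S. D b))"
      using step insert.IH c by (intro add_mono mult_left_mono) auto
    also have "\<dots> \<le> ennreal (2 ^ card (insert c S) * r\<^sup>2) * D c + ennreal (2 ^ card (insert c S) * r\<^sup>2) * (\<Sum>b\<in>S. D b)"
    proof (intro add_mono)
      have "2 * ennreal (r\<^sup>2) = ennreal (2 * r\<^sup>2)" by (simp add: ennreal_mult)
      also have "\<dots> \<le> ennreal (2 ^ card (insert c S) * r\<^sup>2)"
        using insert mult_right_mono[of 1 "2 ^ card S" "r\<^sup>2"] by (intro ennreal_leI) simp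
      finally show "2 * (ennreal (r\<^sup>2) * D c) \<le> ennreal (2 ^ card (insert c S) * r\<^sup>2) * D c"
        by (simp add: mult.assoc[symmetric] mult_right_mono)
      have "2 * ennreal (2 ^ card S * r\<^sup>2) = ennreal (2 ^ card (insert c S) * r\<^sup>2)"
        using insert by (simp add: ennreal_mult mult.assoc)
      then show "2 * (ennreal (2 ^ card S * r\<^sup>2) * (\<Sum>b\<in>S. D b)) \<le> ennreal (2 ^ card (insert c S) * r\<^sup>2) * (\<Sum>b\<in>S. D b)"
        by (simp add: mult.assoc[symmetric])
    qed
    also have "\<dots> = ennreal (2 ^ card (insert c S) * r\<^sup>2) * (\<Sum>b\<in>insert c S. D b)"
      using insert by (simp add: distrib_left)
    finally show ?case .
  qed
  from this[of Basis] have "square_integral (indicator X) (\<lambda>z. u (z + yS Basis) - u z)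
    \<le> ennreal (2 ^ DIM('a) * r\<^sup>2) * (\<Sum>b\<in>Basis. D b)" by simp
  moreover have "yS Basis = y" unfolding yS_def by (rule euclidean_representation)
  ultimately show ?thesis by (simp add: D_def)
qed

section \<open>Compactness from averages over a grid\<close>

definition grid_corner :: "real \<Rightarrow> 'a::euclidean_space \<Rightarrow> 'a" where
  "grid_corner h z = (\<Sum>b\<in>Basis. (h * of_int \<lfloor>z \<bullet> b / h\<rfloor>) *\<^sub>R b)"

text \<open>Depends on \<open>z\<close> only through its grid corner, hence takes at most countably
  many values for each \<open>u\<close>; this lets one subsequence make all averages
  converge.\<close>

definition cell_average :: "real \<Rightarrow> ('a::euclidean_space \<Rightarrow> real) \<Rightarrow> 'a \<Rightarrow> real" where
  "cell_average h u z =
    (LINT x:cbox (grid_corner h z) (grid_corner h z + h *\<^sub>R One)|lborel. u x) / h ^ DIM('a)"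

lemma grid_corner_inner: "b \<in> Basis \<Longrightarrow> grid_corner h z \<bullet> b = h * of_int \<lfloor>z \<bullet> b / h\<rfloor>"
  by (simp add: grid_corner_def)

lemma grid_corner_bounds:
  assumes "h > 0" "b \<in> Basis"
  shows "grid_corner h z \<bullet> b \<le> z \<bullet> b" "z \<bullet> b \<le> grid_corner h z \<bullet> b + h"
proof -
  have *: "of_int \<lfloor>z \<bullet> b / h\<rfloor> \<le> z \<bullet> b / h" "z \<bullet> b / h \<le> of_int \<lfloor>z \<bullet> b / h\<rfloor> + 1" by linarith+
  have "h * of_int \<lfloor>z \<bullet> b / h\<rfloor> \<le> h * (z \<bullet> b / h)" "h * (z \<bullet> b / h) \<le> h * (of_int \<lfloor>z \<bullet> b / h\<rfloor> + 1)"
    by (rule mult_left_mono, rule *, use assms in simp)+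
  then show "grid_corner h z \<bullet> b \<le> z \<bullet> b" "z \<bullet> b \<le> grid_corner h z \<bullet> b + h"
    using assms by (simp_all add: grid_corner_inner distrib_left)
qed

lemma countable_range_grid_corner: "countable (range (grid_corner h :: 'a::euclidean_space \<Rightarrow> 'a))"
proof -
  have "range (grid_corner h) \<subseteq> (\<lambda>j. \<Sum>b\<in>Basis. (h * of_int (j b)) *\<^sub>R b) ` ((Basis::'a set) \<rightarrow>\<^sub>E (UNIV::int set))"
  proof
    fix p :: 'a assume "p \<in> range (grid_corner h)"
    then obtain z where p: "p = grid_corner h z" by auto
    show "p \<in> (\<lambda>j. \<Sum>b\<in>Basis. (h * of_int (j b)) *\<^sub>R b) ` ((Basis::'a set) \<rightarrow>\<^sub>E (UNIV::int set))"
      by (rule image_eqI[of _ _ "restrict (\<lambda>b. \<lfloor>z \<bullet> b / h\<rfloor>) Basis"])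
         (auto simp: p grid_corner_def intro!: sum.cong)
  qed
  moreover have "countable ((Basis::'a set) \<rightarrow>\<^sub>E (UNIV::int set))"
    by (intro countable_PiE) auto
  ultimately show ?thesis by (meson countable_image countable_subset)
qed

lemma measurable_grid_corner [measurable]: "grid_corner h \<in> borel_measurable borel"
  unfolding grid_corner_def by measurable

lemma measurable_cell_average [measurable]:
  assumes [measurable]: "u \<in> borel_measurable borel"
  shows "cell_average h u \<in> borel_measurable borel"
proof -
  \<comment> \<open>The moving cell is written as a slice of one measurable set of pairs, which
    makes the integral measurable in its parameter \<open>z\<close>.\<close>
  have "cell_average h u = (\<lambda>z. (LINT x|lborel. indicator {p. \<forall>b\<in>Basis. grid_corner h (fst p) \<bullet> b \<le> snd p \<bullet> b
      \<and> snd p \<bullet> b \<le> (grid_corner h (fst p) + h *\<^sub>R One) \<bullet> b} (z, x) * u x) / h ^ DIM('a))"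
    unfolding cell_average_def set_lebesgue_integral_def
    by (intro ext arg_cong2[where f = "(/)"] Bochner_Integration.integral_cong refl)
       (auto simp: indicator_def mem_box)
  also have "\<dots> \<in> borel_measurable borel" by measurable
  finally show ?thesis .
qed

lemma emeasure_grid_cell:
  "h > 0 \<Longrightarrow> emeasure lborel (cbox p (p + h *\<^sub>R One :: 'a::euclidean_space)) = ennreal (h ^ DIM('a))"
  by (subst emeasure_lborel_cbox) (auto simp: inner_simps)

lemma cell_average_square_le:
  fixes u :: "'a::euclidean_space \<Rightarrow> real"
  assumes h: "h > 0" and [measurable]: "u \<in> borel_measurable borel" "Y \<in> sets borel"
    and sub: "cbox (grid_corner h z) (grid_corner h z + h *\<^sub>R One) \<subseteq> Y"
  shows "ennreal ((cell_average h u z)\<^sup>2)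
    \<le> ennreal (1 / h ^ DIM('a)) * square_integral (indicator Y) u"
proof -
  let ?C = "cbox (grid_corner h z) (grid_corner h z + h *\<^sub>R One)"
  have "ennreal ((cell_average h u z)\<^sup>2) = ennreal ((1 / h ^ DIM('a))\<^sup>2) * ennreal ((LINT x:?C|lborel. u x)\<^sup>2)"
    by (simp add: cell_average_def power_divide ennreal_mult[symmetric])
  also have "\<dots> \<le> ennreal ((1 / h ^ DIM('a))\<^sup>2) * (emeasure lborel ?C * square_integral (indicator ?C) u)"
    by (intro mult_left_mono square_set_integral_le) auto
  also have "\<dots> = ennreal ((1 / h ^ DIM('a))\<^sup>2) * emeasure lborel ?C * square_integral (indicator ?C) u"
    by (simp add: mult.assoc)
  also have "ennreal ((1 / h ^ DIM('a))\<^sup>2) * emeasure lborel ?C = ennreal (1 / h ^ DIM('a))"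
    using h by (simp add: emeasure_grid_cell ennreal_mult[symmetric] power2_eq_square)
  also have "square_integral (indicator ?C) u \<le> square_integral (indicator Y) u"
    using sub by (intro nn_integral_mono) (auto simp: indicator_def)
  finally show ?thesis by (simp add: mult_left_mono)
qed

text \<open>The cell of \<open>z\<close> lies in \<open>z\<close> plus the cube of all
  \<open>v\<close> with coordinates at most \<open>h\<close> in absolute value, so Cauchy-Schwarz
  bounds the squared error at \<open>z\<close> by \<open>h^(-d)\<close> times the integral of the
  squared differences \<open>u (z + v) - u z\<close> over that cube. Integration in \<open>z\<close>
  and the translation estimate give \<open>h^(-d) (2 h)^d 2^d h^2\<close>, which is
  \<open>4^d h^2\<close>.\<close>

lemma cell_average_error_le:
  fixes u :: "'a::euclidean_space \<Rightarrow> real" and w :: "'a \<Rightarrow> 'a \<Rightarrow> real"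
  assumes wd: "\<And>b. b \<in> Basis \<Longrightarrow> has_weak_deriv [b] u (w b)"
    and [measurable]: "u \<in> borel_measurable borel" "X \<in> sets borel" "Y \<in> sets borel"
    and w: "\<And>b. b \<in> Basis \<Longrightarrow> w b \<in> borel_measurable borel"
    and h: "h > 0"
    and sub: "\<And>z v. z \<in> X \<Longrightarrow> (\<And>b. b \<in> Basis \<Longrightarrow> \<bar>v \<bullet> b\<bar> \<le> h) \<Longrightarrow> z + v \<in> Y"
  shows "square_integral (indicator X) (\<lambda>z. u z - cell_average h u z)
    \<le> ennreal (4 ^ DIM('a) * h\<^sup>2) * (\<Sum>b\<in>Basis. \<integral>\<^sup>+z. indicator Y z * ennreal ((w b z)\<^sup>2) \<partial>lborel)"
proof -
  let ?d = "DIM('a)"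
  let ?B = "cbox (- (h *\<^sub>R One)) (h *\<^sub>R One) :: 'a set"
  have "locally_integrable u"
    using wd[OF SOME_Basis] by (simp add: has_weak_deriv_def)
  then have u_int: "set_integrable lborel (cbox a c) u" for a c
    by (intro locally_integrable_box) auto
  have pt: "ennreal ((u z - cell_average h u z)\<^sup>2)
      \<le> ennreal (1 / h ^ ?d) * square_integral (indicator ?B) (\<lambda>v. u (z + v) - u z)" for z
  proof -
    let ?C = "cbox (grid_corner h z) (grid_corner h z + h *\<^sub>R One)"
    have mC: "measure lborel ?C = h ^ ?d"
      using h by (simp add: measure_def emeasure_grid_cell)
    have "(LINT x:?C|lborel. u z - u x) = h ^ ?d * u z - (LINT x:?C|lborel. u x)"
      using u_int emeasure_grid_cell[OF h, of "grid_corner h z"]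
      by (subst set_integral_diff)
         (auto simp: set_integrable_def integrable_indicator_iff set_lebesgue_integral_def mC)
    then have "u z - cell_average h u z = cell_average h (\<lambda>x. u z - u x) z"
      using h by (simp add: cell_average_def field_simps)
    then have "ennreal ((u z - cell_average h u z)\<^sup>2)
        \<le> ennreal (1 / h ^ ?d) * square_integral (indicator ?C) (\<lambda>x. u z - u x)"
      using cell_average_square_le[OF h, of "\<lambda>x. u z - u x" ?C z] by simp
    also have "square_integral (indicator ?C) (\<lambda>x. u z - u x)
        = square_integral (\<lambda>x. indicator ?C (x + z)) (\<lambda>x. u z - u (x + z))"
      by (rule nn_integral_lborel_translate[symmetric]) measurable
    also have "\<dots> \<le> square_integral (indicator ?B) (\<lambda>v. u (z + v) - u z)"
    proof (intro nn_integral_mono)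
      fix v
      have "v \<in> ?B" if "v + z \<in> ?C"
        unfolding mem_box
      proof
        fix b :: 'a assume b: "b \<in> Basis"
        show "- (h *\<^sub>R One) \<bullet> b \<le> v \<bullet> b \<and> v \<bullet> b \<le> h *\<^sub>R One \<bullet> b"
          using that b grid_corner_bounds[OF h b, of z]
          by (auto simp: mem_box inner_simps dest!: bspec[of _ _ b])
      qed
      then show "indicator ?C (v + z) * ennreal ((u z - u (v + z))\<^sup>2)
          \<le> indicator ?B v * ennreal ((u (z + v) - u z)\<^sup>2)"
        by (auto simp: indicator_def power2_commute add.commute)
    qed
    finally show ?thesis by (simp add: mult_left_mono)
  qed
  let ?S = "ennreal (2 ^ ?d * h\<^sup>2) * (\<Sum>b\<in>Basis. \<integral>\<^sup>+z. indicator Y z * ennreal ((w b z)\<^sup>2) \<partial>lborel)"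
  have "square_integral (indicator X) (\<lambda>z. u z - cell_average h u z)
    \<le> (\<integral>\<^sup>+z. ennreal (1 / h ^ ?d) * (\<integral>\<^sup>+v. indicator ?B v * (indicator X z * ennreal ((u (z + v) - u z)\<^sup>2)) \<partial>lborel) \<partial>lborel)"
  proof (intro nn_integral_mono)
    fix z
    show "indicator X z * ennreal ((u z - cell_average h u z)\<^sup>2)
      \<le> ennreal (1 / h ^ ?d) * (\<integral>\<^sup>+v. indicator ?B v * (indicator X z * ennreal ((u (z + v) - u z)\<^sup>2)) \<partial>lborel)"
      using pt[of z] by (cases "z \<in> X") auto
  qed
  also have "\<dots> = ennreal (1 / h ^ ?d) * (\<integral>\<^sup>+z. \<integral>\<^sup>+v. indicator ?B v * (indicator X z * ennreal ((u (z + v) - u z)\<^sup>2)) \<partial>lborel \<partial>lborel)"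
    by (rule nn_integral_cmult) measurable
  also have "(\<integral>\<^sup>+z. \<integral>\<^sup>+v. indicator ?B v * (indicator X z * ennreal ((u (z + v) - u z)\<^sup>2)) \<partial>lborel \<partial>lborel)
      = (\<integral>\<^sup>+v. \<integral>\<^sup>+z. indicator ?B v * (indicator X z * ennreal ((u (z + v) - u z)\<^sup>2)) \<partial>lborel \<partial>lborel)"
    by (rule lborel_pair.Fubini'[symmetric]) measurable
  also have "\<dots> = (\<integral>\<^sup>+v. indicator ?B v * square_integral (indicator X) (\<lambda>z. u (z + v) - u z) \<partial>lborel)"
    by (intro nn_integral_cong nn_integral_cmult) measurable
  also have "\<dots> \<le> (\<integral>\<^sup>+v. indicator ?B v * ?S \<partial>lborel)"
  proof (intro nn_integral_mono)
    fix v
    show "indicator ?B v * square_integral (indicator X) (\<lambda>z. u (z + v) - u z) \<le> indicator ?B v * ?S"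
    proof (cases "v \<in> ?B")
      case True
      then have "\<bar>v \<bullet> b\<bar> \<le> h" if "b \<in> Basis" for b
        using that by (auto simp: mem_box abs_le_iff dest!: bspec[of _ _ b])
      then have "square_integral (indicator X) (\<lambda>z. u (z + v) - u z) \<le> ?S"
        by (intro square_translation_le[OF wd]) (auto intro: w sub)
      then show ?thesis using True by simp
    qed simp
  qed
  also have "\<dots> = emeasure lborel ?B * ?S"
    by (simp add: nn_integral_multc)
  also have "emeasure lborel ?B = ennreal ((2 * h) ^ ?d)"
    using h by (subst emeasure_lborel_cbox) (auto simp: inner_simps)
  also have "ennreal (1 / h ^ ?d) * (ennreal ((2 * h) ^ ?d) * ?S) = ennreal (4 ^ ?d * h\<^sup>2) * (\<Sum>b\<in>Basis. \<integral>\<^sup>+z. indicator Y z * ennreal ((w b z)\<^sup>2) \<partial>lborel)"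
  proof -
    have "ennreal a * (ennreal b * ennreal c) = ennreal (a * (b * c))" if "a \<ge> 0" "b \<ge> 0" "c \<ge> 0" for a b c
      using that by (simp add: ennreal_mult)
    then have "ennreal (1 / h ^ ?d) * (ennreal ((2 * h) ^ ?d) * ennreal (2 ^ ?d * h\<^sup>2)) = ennreal (1 / h ^ ?d * ((2 * h) ^ ?d * (2 ^ ?d * h\<^sup>2)))"
      using h by simp
    also have "1 / h ^ ?d * ((2 * h) ^ ?d * (2 ^ ?d * h\<^sup>2)) = 4 ^ ?d * h\<^sup>2"
    proof -
      have "(2::real) ^ ?d * 2 ^ ?d = 4 ^ ?d" by (simp add: power_mult_distrib[symmetric])
      then show ?thesis using h by (simp add: power_mult_distrib)
    qed
    finally have eq: "ennreal (1 / h ^ ?d) * (ennreal ((2 * h) ^ ?d) * ennreal (2 ^ ?d * h\<^sup>2)) = ennreal (4 ^ ?d * h\<^sup>2)" .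
    show ?thesis by (simp only: mult.assoc[symmetric] eq[unfolded mult.assoc[symmetric]])
  qed
  finally show ?thesis by (simp add: mult_left_mono)
qed

section \<open>Extraction of convergent subsequences\<close>

lemma L2_Cauchy_imp_convergent_subsequence:
  fixes u :: "nat \<Rightarrow> 'a \<Rightarrow> real"
  assumes [measurable]: "\<And>n. u n \<in> borel_measurable M"
    and Cauchy: "\<And>\<epsilon>::real. \<epsilon> > 0 \<Longrightarrow> \<exists>N. \<forall>k\<ge>N. \<forall>l\<ge>N. (\<integral>\<^sup>+x. ennreal ((u k x - u l x)\<^sup>2) \<partial>M) \<le> ennreal \<epsilon>"
  obtains r where "strict_mono r"
    "(\<lambda>k. \<integral>\<^sup>+x. ennreal ((u (r k) x - lim (\<lambda>j. u (r j) x))\<^sup>2) \<partial>M) \<longlonglongrightarrow> 0"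
proof -
  \<comment> \<open>The rate 1/8 still leaves the summable rate 1/4 after multiplication by
    \<open>2 ^ i\<close>.\<close>
  have "\<exists>N. \<forall>i. \<forall>k\<ge>N i. \<forall>l\<ge>N i. (\<integral>\<^sup>+x. ennreal ((u k x - u l x)\<^sup>2) \<partial>M) \<le> ennreal ((1/8) ^ i)"
    by (intro choice allI Cauchy) simp
  then obtain N where N: "\<And>i k l. k \<ge> N i \<Longrightarrow> l \<ge> N i \<Longrightarrow> (\<integral>\<^sup>+x. ennreal ((u k x - u l x)\<^sup>2) \<partial>M) \<le> ennreal ((1/8) ^ i)"
    by blast
  define r where "r i = i + (\<Sum>j\<le>i. N j)" for i
  have r: "strict_mono r" by (rule strict_monoI_Suc) (simp add: r_def)
  have rN: "N i \<le> r i" for i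
    unfolding r_def by (rule trans_le_add2, rule member_le_sum) auto
  define d where "d i x = u (r (Suc i)) x - u (r i) x" for i x
  have [measurable]: "d i \<in> borel_measurable M" for i unfolding d_def by measurable
  have d: "(\<integral>\<^sup>+x. ennreal ((d i x)\<^sup>2) \<partial>M) \<le> ennreal ((1/8) ^ i)" for i
    unfolding d_def using rN[of i] strict_mono_less_eq[OF r, of i "Suc i"] by (intro N) auto
  have "(\<integral>\<^sup>+x. (\<Sum>i. ennreal (2 ^ i * (d i x)\<^sup>2)) \<partial>M) = (\<Sum>i. \<integral>\<^sup>+x. ennreal (2 ^ i * (d i x)\<^sup>2) \<partial>M)"
    by (rule nn_integral_suminf) measurable
  also have "\<dots> \<le> (\<Sum>i. ennreal ((1/4) ^ i))"
  proof (intro suminf_le)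
    fix i
    have "(\<integral>\<^sup>+x. ennreal (2 ^ i * (d i x)\<^sup>2) \<partial>M) = ennreal (2 ^ i) * (\<integral>\<^sup>+x. ennreal ((d i x)\<^sup>2) \<partial>M)"
      by (simp add: ennreal_mult nn_integral_cmult)
    also have "\<dots> \<le> ennreal (2 ^ i) * ennreal ((1/8) ^ i)" by (intro mult_left_mono d) auto
    also have "\<dots> = ennreal ((1/4) ^ i)"
      by (simp add: ennreal_mult[symmetric] power_mult_distrib[symmetric])
    finally show "(\<integral>\<^sup>+x. ennreal (2 ^ i * (d i x)\<^sup>2) \<partial>M) \<le> ennreal ((1/4) ^ i)" .
  qed auto
  also have "\<dots> = ennreal (\<Sum>i. (1/4) ^ i)"
    by (intro suminf_ennreal2 summable_geometric) auto
  also have "\<dots> < \<infinity>" by simp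
  finally have "AE x in M. (\<Sum>i. ennreal (2 ^ i * (d i x)\<^sup>2)) \<noteq> \<infinity>"
    by (intro nn_integral_PInf_AE) auto
  then have conv: "AE x in M. (\<lambda>j. u (r j) x) \<longlonglongrightarrow> lim (\<lambda>j. u (r j) x)"
  proof eventually_elim
    case (elim x)
    then have "summable (\<lambda>i. 2 ^ i * (d i x)\<^sup>2)"
      by (intro summable_suminf_not_top) auto
    then have s: "summable (\<lambda>i. (1/2) ^ i + 2 ^ i * (d i x)\<^sup>2)"
      by (intro summable_add summable_geometric) auto
    \<comment> \<open>Splitting at the threshold \<open>(1/2) ^ i\<close> turns weighted summability
      of the squares into absolute summability of the increments.\<close>
    have "\<bar>d i x\<bar> \<le> (1/2) ^ i + 2 ^ i * (d i x)\<^sup>2" for i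
    proof (cases "\<bar>d i x\<bar> \<le> (1/2) ^ i")
      case False
      then have "1 \<le> 2 ^ i * \<bar>d i x\<bar>" by (simp add: field_simps power_divide)
      then have "1 * \<bar>d i x\<bar> \<le> 2 ^ i * \<bar>d i x\<bar> * \<bar>d i x\<bar>" by (intro mult_right_mono) auto
      then have "\<bar>d i x\<bar> \<le> 2 ^ i * (d i x)\<^sup>2"
        by (simp add: mult.assoc power2_eq_square abs_mult[symmetric])
      then show ?thesis by (simp add: add_increasing)
    qed (simp add: add_increasing2)
    then have "summable (\<lambda>i. d i x)"
      by (intro summable_comparison_test'[OF s]) auto
    then have "convergent (\<lambda>n. \<Sum>i<n. d i x)"
      by (simp add: summable_iff_convergent)
    moreover have "(\<Sum>i<n. d i x) = u (r n) x - u (r 0) x" for n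
      unfolding d_def by (rule sum_lessThan_telescope)
    ultimately have "convergent (\<lambda>n. u (r n) x - u (r 0) x)" by simp
    then have "convergent (\<lambda>n. u (r n) x)"
      using convergent_add[OF _ convergent_const[of "u (r 0) x"]] by fastforce
    then show ?case by (simp add: convergent_LIMSEQ_iff)
  qed
  have "(\<lambda>k. \<integral>\<^sup>+x. ennreal ((u (r k) x - lim (\<lambda>j. u (r j) x))\<^sup>2) \<partial>M) \<longlonglongrightarrow> 0"
  proof (rule order_tendstoI)
    fix a :: ennreal assume "0 < a"
    then obtain \<epsilon>' where \<epsilon>': "0 < \<epsilon>'" "\<epsilon>' < a" using dense by blast
    then obtain \<epsilon> where \<epsilon>: "\<epsilon>' = ennreal \<epsilon>" "\<epsilon> > 0"
      by (metis ennreal_cases ennreal_less_zero_iff top.not_eq_extremum order_less_trans top_greatest leD)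
    obtain K where K: "\<And>k l. k \<ge> K \<Longrightarrow> l \<ge> K \<Longrightarrow> (\<integral>\<^sup>+x. ennreal ((u k x - u l x)\<^sup>2) \<partial>M) \<le> ennreal \<epsilon>"
      using Cauchy[OF \<epsilon>(2)] by blast
    have "(\<integral>\<^sup>+x. ennreal ((u (r k) x - lim (\<lambda>j. u (r j) x))\<^sup>2) \<partial>M) < a" if k: "k \<ge> K" for k
    proof -
      have rk: "r j \<ge> K" if "j \<ge> K" for j using seq_suble[OF r, of j] that by simp
      have "(\<integral>\<^sup>+x. ennreal ((u (r k) x - lim (\<lambda>j. u (r j) x))\<^sup>2) \<partial>M)
        = (\<integral>\<^sup>+x. liminf (\<lambda>j. ennreal ((u (r k) x - u (r j) x)\<^sup>2)) \<partial>M)"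
      proof (rule nn_integral_cong_AE, use conv in eventually_elim)
        case (elim x)
        have "(\<lambda>j. ennreal ((u (r k) x - u (r j) x)\<^sup>2)) \<longlonglongrightarrow> ennreal ((u (r k) x - lim (\<lambda>j. u (r j) x))\<^sup>2)"
          by (intro tendsto_intros tendsto_ennrealI elim)
        then show ?case by (rule lim_imp_Liminf[OF sequentially_bot, symmetric])
      qed
      \<comment> \<open>Fatou's lemma: the distance to the pointwise limit is at most the lower
        limit of the distances to later terms.\<close>
      also have "\<dots> \<le> liminf (\<lambda>j. \<integral>\<^sup>+x. ennreal ((u (r k) x - u (r j) x)\<^sup>2) \<partial>M)"
        by (rule nn_integral_liminf) measurable
      also have "\<dots> \<le> liminf (\<lambda>j. ennreal \<epsilon>)"
        using K rk k by (intro Liminf_mono) (auto simp: eventually_sequentially)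
      also have "\<dots> = ennreal \<epsilon>" by (simp add: Liminf_const)
      finally show ?thesis using \<epsilon>' \<epsilon> by simp
    qed
    then show "\<forall>\<^sub>F k in sequentially. (\<integral>\<^sup>+x. ennreal ((u (r k) x - lim (\<lambda>j. u (r j) x))\<^sup>2) \<partial>M) < a"
      by (auto simp: eventually_sequentially)
  qed auto
  with r show ?thesis by (rule that)
qed

lemma pointwise_bounded_convergent_subsequence:
  fixes f :: "nat \<Rightarrow> 'a \<Rightarrow> real"
  assumes "countable S" and bd: "\<And>x. x \<in> S \<Longrightarrow> \<exists>B. \<forall>n. \<bar>f n x\<bar> \<le> B"
  obtains k where "strict_mono (k :: nat \<Rightarrow> nat)" "\<And>x. x \<in> S \<Longrightarrow> convergent (\<lambda>n. f (k n) x)"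
proof -
  have "\<forall>x\<in>S. \<exists>B. \<forall>n. \<bar>f n x\<bar> \<le> B" using bd by blast
  then obtain B where B: "\<And>x n. x \<in> S \<Longrightarrow> \<bar>f n x\<bar> \<le> B x" by metis
  have B0: "B x \<ge> 0" if "x \<in> S" for x using B[OF that, of 0] by linarith
  \<comment> \<open>The diagonal argument is applied with one bound for all points, hence the
    normalisation; adding 1 keeps the divisor positive where \<open>B x\<close> is 0.\<close>
  have le1: "norm (f n x / (1 + B x)) \<le> 1" if "x \<in> S" for n x
    using B[OF that, of n] B0[OF that] by simp
  have "\<exists>k::nat \<Rightarrow> nat. strict_mono k \<and> (\<forall>x\<in>S. \<exists>l. (\<lambda>n. f (k n) x / (1 + B x)) \<longlonglongrightarrow> l)"
    by (rule function_convergent_subsequence[OF assms(1), of "\<lambda>n x. f n x / (1 + B x)", OF le1]) blast+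
  then obtain k :: "nat \<Rightarrow> nat" where k: "strict_mono k" "\<And>x. x \<in> S \<Longrightarrow> \<exists>l. (\<lambda>n. f (k n) x / (1 + B x)) \<longlonglongrightarrow> l"
    by blast
  have "convergent (\<lambda>n. f (k n) x)" if x: "x \<in> S" for x
  proof -
    obtain l where "(\<lambda>n. f (k n) x / (1 + B x)) \<longlonglongrightarrow> l" using k(2)[OF x] by blast
    then have "(\<lambda>n. f (k n) x / (1 + B x) * (1 + B x)) \<longlonglongrightarrow> l * (1 + B x)" by (intro tendsto_intros)
    then show ?thesis using B0[OF x] by (auto simp: convergent_def)
  qed
  with k(1) show ?thesis by (rule that)
qed

text \<open>Dominated convergence. By Cauchy-Schwarz the integrals over \<open>Y\<close> bound the
  averages at points of \<open>X\<close> uniformly in \<open>k\<close>, and \<open>X\<close> has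
  finite measure; the factor 4 comes from \<open>(a - b)^2 \<le> 2 a^2 + 2 b^2\<close>.\<close>

lemma cell_averages_converge_in_L2:
  fixes u :: "nat \<Rightarrow> 'a::euclidean_space \<Rightarrow> real"
  assumes [measurable]: "\<And>k. u k \<in> borel_measurable borel" "X \<in> sets borel" "Y \<in> sets borel"
    and h: "h > 0" and X: "emeasure lborel X < \<infinity>"
    and sub: "\<And>z. z \<in> X \<Longrightarrow> cbox (grid_corner h z) (grid_corner h z + h *\<^sub>R One) \<subseteq> Y"
    and bd: "\<And>k. square_integral (indicator Y) (u k) \<le> ennreal C"
    and conv: "\<And>z. convergent (\<lambda>k. cell_average h (u k) z)"
  shows "(\<lambda>k. \<integral>\<^sup>+z. indicator X z * ennreal ((cell_average h (u k) z - lim (\<lambda>j. cell_average h (u j) z))\<^sup>2) \<partial>lborel)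
    \<longlonglongrightarrow> 0"
proof -
  define B where "B = 1 / h ^ DIM('a) * max C 0"
  have B: "(cell_average h (u k) z)\<^sup>2 \<le> B" if "z \<in> X" for k z
  proof -
    have "ennreal ((cell_average h (u k) z)\<^sup>2) \<le> ennreal (1 / h ^ DIM('a)) * ennreal (max C 0)"
      using cell_average_square_le[OF h _ _ sub[OF that], of "u k"] bd[of k]
      by (auto elim!: order_trans intro!: mult_left_mono simp: max_def ennreal_neg)
    also have "\<dots> = ennreal B"
      unfolding B_def by (rule ennreal_mult[symmetric]) (use h in auto)
    finally show ?thesis
      by (rule ennreal_le_iff[THEN iffD1, rotated]) (use h in \<open>auto simp: B_def\<close>)
  qed
  have L: "(\<lambda>k. cell_average h (u k) z) \<longlonglongrightarrow> lim (\<lambda>j. cell_average h (u j) z)" for z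
    using conv[of z] by (simp add: convergent_LIMSEQ_iff)
  have lim_B: "(lim (\<lambda>j. cell_average h (u j) z))\<^sup>2 \<le> B" if "z \<in> X" for z
    by (rule LIMSEQ_le_const2[OF tendsto_power[OF L]]) (use B[OF that] in auto)
  have "(\<lambda>k. \<integral>\<^sup>+z. indicator X z * ennreal ((cell_average h (u k) z - lim (\<lambda>j. cell_average h (u j) z))\<^sup>2) \<partial>lborel)
    \<longlonglongrightarrow> (\<integral>\<^sup>+z. 0 \<partial>(lborel :: 'a measure))"
  proof (rule nn_integral_dominated_convergence[where w = "\<lambda>z. ennreal (4 * B) * indicator X z"])
    show "(\<integral>\<^sup>+z. ennreal (4 * B) * indicator X z \<partial>lborel) < \<infinity>"
      using X by (simp add: nn_integral_cmult ennreal_mult_less_top)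
    show "AE z in lborel. indicator X z * ennreal ((cell_average h (u k) z - lim (\<lambda>j. cell_average h (u j) z))\<^sup>2)
        \<le> ennreal (4 * B) * indicator X z" for k
    proof (intro always_eventually allI)
      fix z
      have "(cell_average h (u k) z - lim (\<lambda>j. cell_average h (u j) z))\<^sup>2 \<le> 4 * B" if z: "z \<in> X"
      proof -
        let ?a = "cell_average h (u k) z" and ?b = "lim (\<lambda>j. cell_average h (u j) z)"
        have "(?a - ?b)\<^sup>2 \<le> 2 * ?a\<^sup>2 + 2 * ?b\<^sup>2"
          using zero_le_power2[of "?a + ?b"] by (simp add: power2_eq_square algebra_simps)
        then show ?thesis using B[OF z, of k] lim_B[OF z] by linarith
      qed
      then show "indicator X z * ennreal ((cell_average h (u k) z - lim (\<lambda>j. cell_average h (u j) z))\<^sup>2)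
        \<le> ennreal (4 * B) * indicator X z"
        by (cases "z \<in> X") (auto intro: ennreal_leI)
    qed
    show "AE z in lborel. (\<lambda>k. indicator X z * ennreal ((cell_average h (u k) z - lim (\<lambda>j. cell_average h (u j) z))\<^sup>2)) \<longlonglongrightarrow> 0"
    proof (intro always_eventually allI)
      fix z
      have "(\<lambda>k. (cell_average h (u k) z - lim (\<lambda>j. cell_average h (u j) z))\<^sup>2) \<longlonglongrightarrow> 0\<^sup>2"
        by (intro tendsto_power) (use L[of z] in \<open>simp add: LIM_zero_iff\<close>)
      then have "(\<lambda>k. ennreal ((cell_average h (u k) z - lim (\<lambda>j. cell_average h (u j) z))\<^sup>2)) \<longlonglongrightarrow> ennreal 0"
        by (intro tendsto_ennrealI) simp
      then show "(\<lambda>k. indicator X z * ennreal ((cell_average h (u k) z - lim (\<lambda>j. cell_average h (u j) z))\<^sup>2)) \<longlonglongrightarrow> 0"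
        by (cases "z \<in> X") auto
    qed
  qed measurable
  then show ?thesis by simp
qed

text \<open>The pairs of a width \<open>1 / (m + 1)\<close> and a grid corner form one countable
  set, so a single diagonal extraction serves all widths and precedes any choice of a
  tolerance.\<close>

lemma grid_averages_convergent_subsequence:
  fixes u :: "nat \<Rightarrow> 'a::euclidean_space \<Rightarrow> real"
  assumes [measurable]: "\<And>k. u k \<in> borel_measurable borel"
    and loc: "\<And>a c. \<exists>C::real. \<forall>k. square_integral (indicator (cbox a c)) (u k) \<le> ennreal C"
  obtains r where "strict_mono (r :: nat \<Rightarrow> nat)"
    "\<And>m z. convergent (\<lambda>k. cell_average (1 / real (Suc m)) (u (r k)) z)"
proof -
  define S where "S = (\<Union>m. (\<lambda>p. (1 / real (Suc m), p)) ` range (grid_corner (1 / real (Suc m)) :: 'a \<Rightarrow> 'a))"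
  define F where "F k = (\<lambda>(h, p). LINT x:cbox p (p + h *\<^sub>R One)|lborel. u k x)" for k
  have "countable S"
    unfolding S_def by (intro countable_UN countable_image countable_range_grid_corner) auto
  moreover have "\<exists>B. \<forall>k. \<bar>F k hp\<bar> \<le> B" for hp
  proof -
    obtain h p where hp: "hp = (h, p)" by (cases hp)
    let ?C = "cbox p (p + h *\<^sub>R One)"
    obtain C where C: "\<And>k. square_integral (indicator ?C) (u k) \<le> ennreal C"
      using loc by blast
    have "\<bar>F k hp\<bar> \<le> sqrt (measure lborel ?C * max C 0)" for k
    proof -
      have "ennreal ((F k hp)\<^sup>2) \<le> emeasure lborel ?C * ennreal (max C 0)"
        using square_set_integral_le[of "u k" lborel ?C] C[of k]
        by (auto simp: F_def hp max_def ennreal_neg elim!: order_trans intro!: mult_left_mono)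
      also have "\<dots> = ennreal (measure lborel ?C * max C 0)"
        using emeasure_lborel_cbox_finite[of p "p + h *\<^sub>R One"]
        by (simp add: emeasure_eq_ennreal_measure ennreal_mult)
      finally have "(F k hp)\<^sup>2 \<le> measure lborel ?C * max C 0"
        by (subst (asm) ennreal_le_iff) auto
      then have "sqrt ((F k hp)\<^sup>2) \<le> sqrt (measure lborel ?C * max C 0)" by (rule real_sqrt_le_mono)
      then show ?thesis by simp
    qed
    then show ?thesis by blast
  qed
  ultimately obtain r :: "nat \<Rightarrow> nat" where r: "strict_mono r" "\<And>x. x \<in> S \<Longrightarrow> convergent (\<lambda>n. F (r n) x)"
    using pointwise_bounded_convergent_subsequence[of S F] by blast
  have "convergent (\<lambda>k. cell_average (1 / real (Suc m)) (u (r k)) z)" for m z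
  proof -
    let ?h = "1 / real (Suc m)"
    have "convergent (\<lambda>n. F (r n) (?h, grid_corner ?h z))"
      by (rule r(2)) (auto simp: S_def)
    then have "convergent (\<lambda>n. F (r n) (?h, grid_corner ?h z) * (1 / ?h ^ DIM('a)))"
      by (intro convergent_mult convergent_const)
    then show ?thesis by (simp add: F_def cell_average_def)
  qed
  with r(1) show ?thesis by (rule that)
qed

lemma nn_integral_square_diff_le:
  assumes [measurable]: "f \<in> borel_measurable M" "g \<in> borel_measurable M" "k \<in> borel_measurable M" "P \<in> borel_measurable M"
  shows "(\<integral>\<^sup>+z. P z * ennreal ((f z - g z)\<^sup>2) \<partial>M)
    \<le> 2 * (\<integral>\<^sup>+z. P z * ennreal ((f z - k z)\<^sup>2) \<partial>M) + 2 * (\<integral>\<^sup>+z. P z * ennreal ((k z - g z)\<^sup>2) \<partial>M)"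
proof -
  have "(\<integral>\<^sup>+z. P z * ennreal ((f z - g z)\<^sup>2) \<partial>M)
    \<le> (\<integral>\<^sup>+z. 2 * (P z * ennreal ((f z - k z)\<^sup>2)) + 2 * (P z * ennreal ((k z - g z)\<^sup>2)) \<partial>M)"
  proof (intro nn_integral_mono)
    fix z
    have "P z * ennreal ((f z - g z)\<^sup>2) \<le> P z * (2 * ennreal ((f z - k z)\<^sup>2) + 2 * ennreal ((k z - g z)\<^sup>2))"
      using square_add_le[of "f z - k z" "k z - g z"] by (intro mult_left_mono) auto
    then show "P z * ennreal ((f z - g z)\<^sup>2) \<le> 2 * (P z * ennreal ((f z - k z)\<^sup>2)) + 2 * (P z * ennreal ((k z - g z)\<^sup>2))"
      by (simp add: distrib_left mult.left_commute)
  qed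
  also have "\<dots> = 2 * (\<integral>\<^sup>+z. P z * ennreal ((f z - k z)\<^sup>2) \<partial>M) + 2 * (\<integral>\<^sup>+z. P z * ennreal ((k z - g z)\<^sup>2) \<partial>M)"
    by (subst nn_integral_add) (auto simp: nn_integral_cmult)
  finally show ?thesis .
qed

text \<open>The approximant \<open>q\<close> is the limit of the averages at one fine width, set to
  0 off the box. The error has three parts, each at most \<open>\<epsilon>\<close>: the mass of
  \<open>u k\<close> off the box, the distance to its averages, and the distance of late averages
  from their limit.\<close>

lemma weighted_L2_approximation:
  fixes u :: "nat \<Rightarrow> 'a::euclidean_space \<Rightarrow> real" and w :: "nat \<Rightarrow> 'a \<Rightarrow> 'a \<Rightarrow> real"
  assumes wd: "\<And>k b. b \<in> Basis \<Longrightarrow> has_weak_deriv [b] (u k) (w k b)"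
    and [measurable]: "\<And>k. u k \<in> borel_measurable borel" "P \<in> borel_measurable borel"
    and w: "\<And>k b. b \<in> Basis \<Longrightarrow> w k b \<in> borel_measurable borel"
    and loc: "\<And>a c. \<exists>C::real. \<forall>k. square_integral (indicator (cbox a c)) (u k) \<le> ennreal C"
    and locw: "\<And>a c. \<exists>C::real. \<forall>k. \<forall>b\<in>Basis. square_integral (indicator (cbox a c)) (w k b) \<le> ennreal C"
    and P: "\<And>z. z \<in> cbox a c \<Longrightarrow> P z \<le> ennreal CX"
    and tight: "\<And>k. square_integral (\<lambda>z. P z * indicator (- cbox a c) z) (u k) \<le> ennreal \<epsilon>"
    and conv: "\<And>m z. convergent (\<lambda>k. cell_average (1 / real (Suc m)) (u k) z)"
    and \<epsilon>: "\<epsilon> > 0"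
  shows "\<exists>q \<in> borel_measurable borel. \<exists>K. \<forall>k\<ge>K. square_integral P (\<lambda>z. u k z - q z) \<le> ennreal (3 * \<epsilon>)"
proof -
  let ?X = "cbox a c" and ?Y = "cbox (a - One) (c + One)" and ?d = "DIM('a)"
  obtain C1 where C1: "\<And>k. square_integral (indicator ?Y) (u k) \<le> ennreal C1"
    using loc by blast
  obtain C2 where C2': "\<And>k b. b \<in> Basis \<Longrightarrow> square_integral (indicator ?Y) (w k b) \<le> ennreal C2"
    using locw by blast
  have C2: "square_integral (indicator ?Y) (w k b) \<le> ennreal (max C2 0)" if "b \<in> Basis" for k b
    by (rule order_trans[OF C2' ennreal_leI]) (use that in auto)
  \<comment> \<open>Collects the factor 2 of splitting a square, the bound on \<open>P\<close>, the
    constant \<open>4 ^ d\<close> of the averaging error and the sum over the \<open>d\<close> axes;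
    the averaging part of the error is then at most \<open>D\<close> times the squared
    width.\<close>
  define D where "D = 2 * (max CX 0) * (4 ^ ?d * (real ?d * max C2 0))"
  have "D \<ge> 0" by (simp add: D_def)
  obtain m :: nat where m: "D / \<epsilon> < real m" using reals_Archimedean2 by blast
  define h where "h = 1 / real (Suc m)"
  have h: "h > 0" "h \<le> 1" by (auto simp: h_def)
  have Dh: "D * h\<^sup>2 \<le> \<epsilon>"
  proof -
    have "D \<le> \<epsilon> * real (Suc m)" using m \<epsilon> by (simp add: field_simps)
    then have "D * h \<le> \<epsilon>" by (simp add: h_def field_simps)
    moreover have "D * h * h \<le> D * h * 1" using h \<open>D \<ge> 0\<close> by (intro mult_left_mono) auto
    ultimately show ?thesis by (simp add: power2_eq_square mult.assoc)
  qed
  have sub: "z + v \<in> ?Y" if "z \<in> ?X" "\<And>b. b \<in> Basis \<Longrightarrow> \<bar>v \<bullet> b\<bar> \<le> h" for z v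
    unfolding mem_box
  proof
    fix b :: 'a assume b: "b \<in> Basis"
    have "a \<bullet> b \<le> z \<bullet> b" "z \<bullet> b \<le> c \<bullet> b" using that(1) b by (auto simp: mem_box)
    then show "(a - One) \<bullet> b \<le> (z + v) \<bullet> b \<and> (z + v) \<bullet> b \<le> (c + One) \<bullet> b"
      using that(2)[OF b, unfolded abs_le_iff] h b by (auto simp: inner_simps)
  qed
  have sub': "cbox (grid_corner h z) (grid_corner h z + h *\<^sub>R One) \<subseteq> ?Y" if "z \<in> ?X" for z
  proof
    fix x assume x: "x \<in> cbox (grid_corner h z) (grid_corner h z + h *\<^sub>R One)"
    have "\<bar>(x - z) \<bullet> b\<bar> \<le> h" if b: "b \<in> Basis" for b
    proof -
      have "grid_corner h z \<bullet> b \<le> x \<bullet> b" "x \<bullet> b \<le> grid_corner h z \<bullet> b + h"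
        using x b by (auto simp: mem_box inner_simps dest!: bspec[of _ _ b])
      then show ?thesis using grid_corner_bounds[OF h(1) b, of z] by (simp add: inner_simps)
    qed
    from sub[OF that this] show "x \<in> ?Y" by simp
  qed
  define p where "p z = lim (\<lambda>k. cell_average h (u k) z)" for z
  have [measurable]: "p \<in> borel_measurable borel" unfolding p_def by measurable
  have avg: "square_integral (indicator ?X) (\<lambda>z. u k z - cell_average h (u k) z)
      \<le> ennreal (4 ^ ?d * (real ?d * max C2 0) * h\<^sup>2)" for k
  proof -
    have "square_integral (indicator ?X) (\<lambda>z. u k z - cell_average h (u k) z)
      \<le> ennreal (4 ^ ?d * h\<^sup>2) * (\<Sum>b\<in>Basis. \<integral>\<^sup>+z. indicator ?Y z * ennreal ((w k b z)\<^sup>2) \<partial>lborel)"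
      using h sub by (intro cell_average_error_le[OF wd]) (auto intro: w)
    also have "\<dots> \<le> ennreal (4 ^ ?d * h\<^sup>2) * (\<Sum>b\<in>(Basis::'a set). ennreal (max C2 0))"
      by (intro mult_left_mono sum_mono C2) auto
    also have "\<dots> = ennreal (4 ^ ?d * h\<^sup>2) * ennreal (real ?d * max C2 0)"
      by (simp add: ennreal_mult ennreal_of_nat_eq_real_of_nat)
    also have "\<dots> = ennreal (4 ^ ?d * h\<^sup>2 * (real ?d * max C2 0))"
      by (rule ennreal_mult[symmetric]) auto
    finally show ?thesis by (simp add: mult_ac)
  qed
  have "(\<lambda>k. \<integral>\<^sup>+z. indicator ?X z * ennreal ((cell_average h (u k) z - p z)\<^sup>2) \<partial>lborel) \<longlonglongrightarrow> 0"
    unfolding p_def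
  proof (rule cell_averages_converge_in_L2[OF _ _ _ h(1) emeasure_lborel_cbox_finite sub' C1])
    show "convergent (\<lambda>k. cell_average h (u k) z)" for z
      unfolding h_def by (rule conv)
  qed auto
  \<comment> \<open>Multiplied by 2 and by the bound on \<open>P\<close> this tolerance stays below
    \<open>\<epsilon>\<close>; the added 1 avoids a zero divisor.\<close>
  then have "\<forall>\<^sub>F k in sequentially. square_integral (indicator ?X) (\<lambda>z. cell_average h (u k) z - p z)
      < ennreal (\<epsilon> / (2 * (max CX 0 + 1)))"
    using \<epsilon> by (intro order_tendstoD(2)) (auto simp: ennreal_less_zero_iff add_nonneg_pos)
  then obtain K where K: "\<And>k. k \<ge> K \<Longrightarrow> square_integral (indicator ?X) (\<lambda>z. cell_average h (u k) z - p z)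
      < ennreal (\<epsilon> / (2 * (max CX 0 + 1)))"
    by (auto simp: eventually_sequentially)
  have "square_integral P (\<lambda>z. u k z - indicator ?X z * p z) \<le> ennreal (3 * \<epsilon>)" if k: "k \<ge> K" for k
  proof -
    have "square_integral P (\<lambda>z. u k z - indicator ?X z * p z)
      \<le> (\<integral>\<^sup>+z. P z * indicator (- ?X) z * ennreal ((u k z)\<^sup>2) + ennreal (max CX 0) * (indicator ?X z * ennreal ((u k z - p z)\<^sup>2)) \<partial>lborel)"
    proof (intro nn_integral_mono)
      fix z
      have "P z \<le> ennreal (max CX 0)" if "z \<in> ?X"
        using P[OF that] by (auto elim!: order_trans intro!: ennreal_leI)
      then show "P z * ennreal ((u k z - indicator ?X z * p z)\<^sup>2)
        \<le> P z * indicator (- ?X) z * ennreal ((u k z)\<^sup>2) + ennreal (max CX 0) * (indicator ?X z * ennreal ((u k z - p z)\<^sup>2))"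
        by (cases "z \<in> ?X") (auto intro!: mult_right_mono)
    qed
    also have "\<dots> = square_integral (\<lambda>z. P z * indicator (- ?X) z) (u k)
        + ennreal (max CX 0) * square_integral (indicator ?X) (\<lambda>z. u k z - p z)"
      by (subst nn_integral_add) (auto simp: nn_integral_cmult)
    also have "\<dots> \<le> ennreal \<epsilon> + ennreal (max CX 0) * (2 * ennreal (4 ^ ?d * (real ?d * max C2 0) * h\<^sup>2)
        + 2 * ennreal (\<epsilon> / (2 * (max CX 0 + 1))))"
    proof (intro add_mono mult_left_mono tight)
      have "square_integral (indicator ?X) (\<lambda>z. u k z - p z)
        \<le> 2 * square_integral (indicator ?X) (\<lambda>z. u k z - cell_average h (u k) z)
          + 2 * square_integral (indicator ?X) (\<lambda>z. cell_average h (u k) z - p z)"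
        by (rule nn_integral_square_diff_le) auto
      also have "\<dots> \<le> 2 * ennreal (4 ^ ?d * (real ?d * max C2 0) * h\<^sup>2) + 2 * ennreal (\<epsilon> / (2 * (max CX 0 + 1)))"
        using K[OF k] by (intro add_mono mult_left_mono avg) auto
      finally show "square_integral (indicator ?X) (\<lambda>z. u k z - p z)
        \<le> 2 * ennreal (4 ^ ?d * (real ?d * max C2 0) * h\<^sup>2) + 2 * ennreal (\<epsilon> / (2 * (max CX 0 + 1)))" .
    qed auto
    also have "\<dots> = ennreal (\<epsilon> + max CX 0 * (2 * (4 ^ ?d * (real ?d * max C2 0) * h\<^sup>2) + 2 * (\<epsilon> / (2 * (max CX 0 + 1)))))"
    proof -
      have *: "ennreal e + ennreal x * (2 * ennreal y + 2 * ennreal t) = ennreal (e + x * (2 * y + 2 * t))"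
        if "e \<ge> 0" "x \<ge> 0" "y \<ge> 0" "t \<ge> 0" for e x y t
        using that by (simp add: ennreal_mult ennreal_plus)
      show ?thesis by (rule *) (use \<epsilon> in auto)
    qed
    also have "\<epsilon> + max CX 0 * (2 * (4 ^ ?d * (real ?d * max C2 0) * h\<^sup>2) + 2 * (\<epsilon> / (2 * (max CX 0 + 1))))
        = \<epsilon> + D * h\<^sup>2 + max CX 0 / (max CX 0 + 1) * \<epsilon>"
      by (simp add: D_def field_simps)
    also have "ennreal \<dots> \<le> ennreal (3 * \<epsilon>)"
    proof (rule ennreal_leI)
      have "max CX 0 / (max CX 0 + 1) * \<epsilon> \<le> 1 * \<epsilon>" using \<epsilon> by (intro mult_right_mono) auto
      then show "\<epsilon> + D * h\<^sup>2 + max CX 0 / (max CX 0 + 1) * \<epsilon> \<le> 3 * \<epsilon>" using Dh by linarith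
    qed
    finally show ?thesis .
  qed
  then show ?thesis
    by (intro bexI[of _ "\<lambda>z. indicator ?X z * p z"] exI[of _ K]) auto
qed

text \<open>A weighted Rellich theorem. For each tolerance all late terms lie near one function
  \<open>q\<close>, so the subsequence along which the averages converge is Cauchy for the weight;
  completeness then gives a limit along a further subsequence.\<close>

theorem weighted_L2_compactness:
  fixes u :: "nat \<Rightarrow> 'a::euclidean_space \<Rightarrow> real" and w :: "nat \<Rightarrow> 'a \<Rightarrow> 'a \<Rightarrow> real"
  assumes wd: "\<And>k b. b \<in> Basis \<Longrightarrow> has_weak_deriv [b] (u k) (w k b)"
    and u [measurable]: "\<And>k. u k \<in> borel_measurable borel" and P [measurable]: "P \<in> borel_measurable borel"
    and w: "\<And>k b. b \<in> Basis \<Longrightarrow> w k b \<in> borel_measurable borel"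
    and loc: "\<And>a c. \<exists>C::real. \<forall>k. square_integral (indicator (cbox a c)) (u k) \<le> ennreal C"
    and locw: "\<And>a c. \<exists>C::real. \<forall>k. \<forall>b\<in>Basis. square_integral (indicator (cbox a c)) (w k b) \<le> ennreal C"
    and tight: "\<And>\<epsilon>::real. \<epsilon> > 0 \<Longrightarrow> \<exists>a c C. (\<forall>z\<in>cbox a c. P z \<le> ennreal C) \<and>
      (\<forall>k. square_integral (\<lambda>z. P z * indicator (- cbox a c) z) (u k) \<le> ennreal \<epsilon>)"
  obtains r where "strict_mono (r :: nat \<Rightarrow> nat)"
    "(\<lambda>k. \<integral>\<^sup>+z. P z * ennreal ((u (r k) z - lim (\<lambda>j. u (r j) z))\<^sup>2) \<partial>lborel) \<longlonglongrightarrow> 0"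
proof -
  obtain r0 :: "nat \<Rightarrow> nat" where r0: "strict_mono r0"
    "\<And>m z. convergent (\<lambda>k. cell_average (1 / real (Suc m)) (u (r0 k)) z)"
    using grid_averages_convergent_subsequence[OF u loc] by blast
  define U where "U k = u (r0 k)" for k
  have [measurable]: "U k \<in> borel_measurable borel" for k by (simp add: U_def)
  let ?M = "density lborel P"
  have M: "(\<integral>\<^sup>+x. ennreal (f x) \<partial>?M) = (\<integral>\<^sup>+x. P x * ennreal (f x) \<partial>lborel)"
    if [measurable]: "f \<in> borel_measurable borel" for f
    by (subst nn_integral_density) auto
  have Cauchy: "\<exists>N. \<forall>k\<ge>N. \<forall>l\<ge>N. (\<integral>\<^sup>+x. ennreal ((U k x - U l x)\<^sup>2) \<partial>?M) \<le> ennreal \<epsilon>" if "\<epsilon> > 0" for \<epsilon> :: real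
  proof -
    \<comment> \<open>The approximation triples the tolerance to a quarter of
      \<open>\<epsilon>\<close>, and comparing two terms through \<open>q\<close> doubles each of
      two such quarters.\<close>
    have "\<epsilon> / 12 > 0" using that by simp
    from tight[OF this] obtain a c C where "\<And>z. z \<in> cbox a c \<Longrightarrow> P z \<le> ennreal C"
      "\<And>k. square_integral (\<lambda>z. P z * indicator (- cbox a c) z) (u k) \<le> ennreal (\<epsilon> / 12)"
      by blast
    then have "\<exists>q \<in> borel_measurable borel. \<exists>K. \<forall>k\<ge>K. square_integral P (\<lambda>z. U k z - q z) \<le> ennreal (3 * (\<epsilon> / 12))"
      unfolding U_def
      using that w loc locw r0(2)
      by (intro weighted_L2_approximation[where w = "\<lambda>k. w (r0 k)" and a = a and c = c and CX = C])
         (auto intro: wd, meson+)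
    then obtain q K where [measurable]: "q \<in> borel_measurable borel"
      and K: "\<And>k. k \<ge> K \<Longrightarrow> square_integral P (\<lambda>z. U k z - q z) \<le> ennreal (\<epsilon> / 4)"
      by auto
    have "(\<integral>\<^sup>+x. ennreal ((U k x - U l x)\<^sup>2) \<partial>?M) \<le> ennreal \<epsilon>" if "k \<ge> K" "l \<ge> K" for k l
    proof -
      have "(\<integral>\<^sup>+x. ennreal ((U k x - U l x)\<^sup>2) \<partial>?M) = square_integral P (\<lambda>x. U k x - U l x)"
        by (rule M) measurable
      also have "\<dots> \<le> 2 * square_integral P (\<lambda>z. U k z - q z) + 2 * square_integral P (\<lambda>z. q z - U l z)"
        by (rule nn_integral_square_diff_le) auto
      also have "\<dots> \<le> 2 * ennreal (\<epsilon> / 4) + 2 * ennreal (\<epsilon> / 4)"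
        using K[OF that(1)] K[OF that(2)] by (intro add_mono mult_left_mono) (auto simp: power2_commute)
      also have "\<dots> = ennreal (2 * (\<epsilon> / 4) + 2 * (\<epsilon> / 4))"
      proof -
        have *: "2 * ennreal x + 2 * ennreal y = ennreal (2 * x + 2 * y)" if "x \<ge> 0" "y \<ge> 0" for x y
          using that by (simp add: ennreal_mult ennreal_plus)
        show ?thesis by (rule *) (use \<open>\<epsilon> > 0\<close> in auto)
      qed
      finally show ?thesis by simp
    qed
    then show ?thesis by blast
  qed
  have "\<exists>r1. strict_mono r1 \<and>
    (\<lambda>k. \<integral>\<^sup>+x. ennreal ((U (r1 k) x - lim (\<lambda>j. U (r1 j) x))\<^sup>2) \<partial>?M) \<longlonglongrightarrow> 0"
  proof (rule L2_Cauchy_imp_convergent_subsequence[of U ?M])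
    show "U n \<in> borel_measurable ?M" for n by simp
  qed (rule Cauchy, assumption, blast)
  then obtain r1 where r1: "strict_mono r1"
    "(\<lambda>k. \<integral>\<^sup>+x. ennreal ((U (r1 k) x - lim (\<lambda>j. U (r1 j) x))\<^sup>2) \<partial>?M) \<longlonglongrightarrow> 0"
    by blast
  show ?thesis
  proof (rule that[of "r0 \<circ> r1"])
    show "strict_mono (r0 \<circ> r1)" using r0(1) r1(1) by (rule strict_mono_o)
    have "(\<integral>\<^sup>+x. ennreal ((U (r1 k) x - lim (\<lambda>j. U (r1 j) x))\<^sup>2) \<partial>?M)
        = square_integral P (\<lambda>z. u ((r0 \<circ> r1) k) z - lim (\<lambda>j. u ((r0 \<circ> r1) j) z))" for k
      by (subst M) (auto simp: U_def)
    then show "(\<lambda>k. \<integral>\<^sup>+z. P z * ennreal ((u ((r0 \<circ> r1) k) z - lim (\<lambda>j. u ((r0 \<circ> r1) j) z))\<^sup>2) \<partial>lborel) \<longlonglongrightarrow> 0"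
      using r1(2) by simp
  qed
qed

section \<open>Weights on a period with a rapidly decaying tail\<close>

lemma AE_periodic_int:
  fixes f :: "real \<times> 'a::euclidean_space \<Rightarrow> 'b"
  assumes per: "AE z in lborel. f (z + (T, 0)) = f z"
  shows "AE z in lborel. f (z + (of_int k * T, 0)) = f z"
proof -
  have nat: "AE z in lborel. f (z + (of_nat n * T, 0)) = f z" for n
  proof (induction n)
    case (Suc n)
    show ?case using AE_lborel_translate[OF Suc, of "(T, 0)"] per
    proof eventually_elim
      case (elim z)
      then show ?case by (simp add: algebra_simps)
    qed
  qed (simp add: zero_prod_def[symmetric])
  show ?thesis
  proof (cases "k \<ge> 0")
    case True
    then obtain n where "k = int n" using nonneg_int_cases by blast
    then show ?thesis using nat[of n] by simp
  next
    case False
    then obtain n where n: "k = - int n" by (metis int_cases2 of_nat_0_le_iff)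
    show ?thesis using AE_lborel_translate[OF nat[of n], of "(of_int k * T, 0)"]
    proof eventually_elim
      case (elim z)
      have "z + (of_int k * T, 0) + (of_nat n * T, 0) = z" by (cases z) (simp add: n)
      then show ?case using elim by metis
    qed
  qed
qed

lemma AE_fst_neq: "AE z in (lborel :: (real \<times> 'a::euclidean_space) measure). fst z \<noteq> c"
proof -
  have "emeasure lborel ({c} \<times> (UNIV :: 'a set)) = 0"
    unfolding lborel_prod[symmetric]
    by (subst lborel.emeasure_pair_measure_Times) auto
  then have "{c} \<times> (UNIV :: 'a set) \<in> null_sets lborel"
    by (auto simp: null_sets_def intro!: borel_closed closed_Times)
  from AE_not_in[OF this] show ?thesis by eventually_elim auto
qed

text \<open>What compactness needs to know of the Gaussian density. In \<open>tail\<close> the slack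
  \<open>M\<close> is fixed before \<open>L\<close>: a step of length \<open>s\<close> gains the
  factor \<open>exp (s * L - M)\<close>, so a large \<open>L\<close> outweighs \<open>M\<close>. The
  time is fixed during a step, which therefore stays in the strip.\<close>

locale periodic_weight =
  fixes \<rho> :: "real \<times> (real ^ 'n) \<Rightarrow> real" and T M :: real
  assumes T_pos: "T > 0"
    and cont: "continuous_on UNIV \<rho>"
    and pos: "\<And>z. \<rho> z > 0"
    and tail: "\<And>L. L > 0 \<Longrightarrow> \<exists>R. \<forall>t\<in>{0<..<T}. \<forall>x. norm x > R \<longrightarrow>
      (\<exists>i. \<exists>\<sigma>\<in>{1, -1}. \<forall>s\<in>{0..1}. \<rho> (t, x) \<le> exp (M - s * L) * \<rho> (t, x + (\<sigma> * s) *\<^sub>R axis i 1))"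
begin

definition period_weight :: "real \<times> (real ^ 'n) \<Rightarrow> ennreal" where
  "period_weight z = indicator ({0<..<T} \<times> UNIV) z * ennreal (\<rho> z)"

lemma measurable_density [measurable]: "\<rho> \<in> borel_measurable borel"
  using cont by (rule borel_measurable_continuous_onI)

lemma strip_borel [measurable]: "{0<..<T} \<times> (UNIV :: (real ^ 'n) set) \<in> sets borel"
  by (intro borel_open open_Times) auto

lemma measurable_period_weight [measurable]: "period_weight \<in> borel_measurable borel"
  unfolding period_weight_def by measurable

text \<open>Relates unweighted integrals over an arbitrary box to weighted integrals over one
  period. Off the null set of times in \<open>T\<close> times the integers, finitely many shifted
  strips cover the box; periodicity moves each back to the strip, where the density is at least
  \<open>m\<close> on the bounded part that occurs.\<close>

lemma local_integral_le:
  fixes a c :: "real \<times> (real ^ 'n)"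
  shows "\<exists>C\<ge>0. \<forall>f \<in> borel_measurable borel. (AE z in lborel. f (z + (T, 0)) = f z) \<longrightarrow>
    (\<integral>\<^sup>+z. indicator (cbox a c) z * f z \<partial>lborel) \<le> ennreal C * (\<integral>\<^sup>+z. period_weight z * f z \<partial>lborel)"
proof -
  obtain R where R: "\<And>z. z \<in> cbox a c \<Longrightarrow> norm z \<le> R" "R > 0"
    using bounded_cbox[of a c] unfolding bounded_pos by blast
  define N where "N = \<lceil>R / T\<rceil> + 1"
  \<comment> \<open>Closed in time, so that the positive continuous density attains its
    minimum.\<close>
  let ?K = "{0..T} \<times> cball (0 :: real ^ 'n) R"
  have "compact ?K" by (intro compact_Times) auto
  moreover have "?K \<noteq> {}" using T_pos R(2) by auto
  ultimately obtain z0 where z0: "z0 \<in> ?K" "\<And>z. z \<in> ?K \<Longrightarrow> \<rho> z0 \<le> \<rho> z"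
    using continuous_attains_inf[of ?K \<rho>] cont continuous_on_subset by blast
  define m where "m = \<rho> z0"
  have m: "m > 0" using pos by (simp add: m_def)
  define C where "C = real (card {-N..N}) / m"
  have "(\<integral>\<^sup>+z. indicator (cbox a c) z * f z \<partial>lborel) \<le> ennreal C * (\<integral>\<^sup>+z. period_weight z * f z \<partial>lborel)"
    if [measurable]: "f \<in> borel_measurable borel" and per: "AE z in lborel. f (z + (T, 0)) = f z" for f :: "_ \<Rightarrow> ennreal"
  proof -
    let ?S = "{0<..<T} \<times> (UNIV :: (real ^ 'n) set)"
    let ?e = "\<lambda>k. (of_int k * T, 0) :: real \<times> (real ^ 'n)"
    have nz: "AE z in (lborel :: (real \<times> (real ^ 'n)) measure). \<forall>k::int. fst z \<noteq> of_int k * T"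
      by (subst AE_all_countable) (auto intro: AE_fst_neq)
    have pt: "indicator (cbox a c) z * f z \<le> (\<Sum>k\<in>{-N..N}. indicator (cbox a c) z * indicator ?S (z - ?e k) * f z)"
      if nz: "\<forall>k::int. fst z \<noteq> of_int k * T" for z
      proof (cases "z \<in> cbox a c")
        case True
        define k where "k = \<lfloor>fst z / T\<rfloor>"
        have "of_int k \<le> fst z / T" "fst z / T < of_int k + 1" unfolding k_def by linarith+
        then have "of_int k * T \<le> fst z" "fst z < of_int k * T + T"
          using T_pos by (simp_all add: field_simps)
        then have S: "z - ?e k \<in> ?S"
          using nz[rule_format, of k] by (auto simp: mem_Times_iff)
        have "\<bar>fst z\<bar> \<le> norm z" using norm_fst_le[of "fst z" "snd z"] by simp
        then have "\<bar>fst z\<bar> \<le> R" using R(1)[OF True] by linarith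
        then have "- (R / T) \<le> fst z / T" "fst z / T \<le> R / T"
          using T_pos by (simp_all add: field_simps abs_le_iff)
        then have "- N \<le> k" "k \<le> N" unfolding k_def N_def by linarith+
        then have k: "k \<in> {-N..N}" by simp
        have "indicator (cbox a c) z * f z = indicator (cbox a c) z * indicator ?S (z - ?e k) * f z"
          using S by simp
        also have "\<dots> \<le> (\<Sum>k\<in>{-N..N}. indicator (cbox a c) z * indicator ?S (z - ?e k) * f z)"
          using k by (intro member_le_sum) auto
        finally show ?thesis .
      qed simp
    have "(\<integral>\<^sup>+z. indicator (cbox a c) z * f z \<partial>lborel)
      \<le> (\<integral>\<^sup>+z. (\<Sum>k\<in>{-N..N}. indicator (cbox a c) z * indicator ?S (z - ?e k) * f z) \<partial>lborel)"
      by (rule nn_integral_mono_AE) (use nz pt in \<open>auto elim!: eventually_mono\<close>)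
    also have "\<dots> = (\<Sum>k\<in>{-N..N}. \<integral>\<^sup>+z. indicator (cbox a c) z * indicator ?S (z - ?e k) * f z \<partial>lborel)"
      by (rule nn_integral_sum) measurable
    also have "\<dots> \<le> (\<Sum>k\<in>{-N..N}. ennreal (1 / m) * (\<integral>\<^sup>+z. period_weight z * f z \<partial>lborel))"
    proof (intro sum_mono)
      fix k
      have "(\<integral>\<^sup>+z. indicator (cbox a c) z * indicator ?S (z - ?e k) * f z \<partial>lborel)
        = (\<integral>\<^sup>+z. indicator (cbox a c) (z + ?e k) * indicator ?S z * f (z + ?e k) \<partial>lborel)"
        by (subst nn_integral_lborel_translate[where c = "?e k", symmetric]) simp_all
      also have "\<dots> = (\<integral>\<^sup>+z. indicator (cbox a c) (z + ?e k) * indicator ?S z * f z \<partial>lborel)"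
        by (rule nn_integral_cong_AE) (use AE_periodic_int[OF per, of k] in \<open>auto elim!: eventually_mono\<close>)
      also have "\<dots> \<le> (\<integral>\<^sup>+z. ennreal (1 / m) * (period_weight z * f z) \<partial>lborel)"
      proof (intro nn_integral_mono)
        fix z :: "real \<times> (real ^ 'n)"
        have "indicator (cbox a c) (z + ?e k) * indicator ?S z \<le> ennreal (1 / m) * period_weight z"
        proof (cases "z + ?e k \<in> cbox a c \<and> z \<in> ?S")
          case True
          have "norm (snd z) \<le> R"
            using R(1)[of "z + ?e k"] norm_snd_le[of "snd z" "fst (z + ?e k)"] True
            by (simp add: plus_prod_def)
          then have "m \<le> \<rho> z" unfolding m_def using True by (intro z0) (auto simp: mem_Times_iff)
          then have "ennreal 1 \<le> ennreal (1 / m * \<rho> z)" using m by (intro ennreal_leI) simp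
          also have "\<dots> = ennreal (1 / m) * ennreal (\<rho> z)"
            using m by (intro ennreal_mult') simp
          finally show ?thesis unfolding period_weight_def using True by (simp only: indicator_simps(1)) simp
        qed auto
        then show "indicator (cbox a c) (z + ?e k) * indicator ?S z * f z \<le> ennreal (1 / m) * (period_weight z * f z)"
          by (simp add: mult.assoc[symmetric] mult_right_mono)
      qed
      also have "\<dots> = ennreal (1 / m) * (\<integral>\<^sup>+z. period_weight z * f z \<partial>lborel)"
        by (rule nn_integral_cmult) measurable
      finally show "(\<integral>\<^sup>+z. indicator (cbox a c) z * indicator ?S (z - ?e k) * f z \<partial>lborel)
        \<le> ennreal (1 / m) * (\<integral>\<^sup>+z. period_weight z * f z \<partial>lborel)" .
    qed
    also have "\<dots> = ennreal C * (\<integral>\<^sup>+z. period_weight z * f z \<partial>lborel)"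
    proof -
      have "of_nat (card {-N..N}) * ennreal (1 / m) = ennreal C"
        unfolding C_def ennreal_of_nat_eq_real_of_nat using m
        by (subst ennreal_mult[symmetric]) auto
      then show ?thesis by (simp add: mult.assoc[symmetric])
    qed
    finally show ?thesis .
  qed
  moreover have "C \<ge> 0" using m by (simp add: C_def)
  ultimately show ?thesis by blast
qed

text \<open>The square of \<open>u z\<close> is at most twice that of the value one step along the
  axis plus twice that of the difference. The first term carries the ratio
  \<open>exp (M - L)\<close>, the second the integral of \<open>exp (M - s * L)\<close> over the
  unit interval; both are at most \<open>exp M / L\<close>. Membership in \<open>S\<close> is asked
  of the starting point only.\<close>

lemma one_sided_tail_le:
  fixes u w :: "real \<times> (real ^ 'n) \<Rightarrow> real"
  assumes wd: "has_weak_deriv [(0, axis i 1)] u w"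
    and [measurable]: "u \<in> borel_measurable borel" "w \<in> borel_measurable borel" "S \<in> sets borel"
    and \<sigma>: "\<sigma> = 1 \<or> \<sigma> = -1" and L: "L > 0"
    and S: "\<And>z s. z \<in> S \<Longrightarrow> s \<in> {0..1} \<Longrightarrow>
      \<rho> z \<le> exp (M - s * L) * \<rho> (z + (\<sigma> * s) *\<^sub>R (0, axis i 1))"
    and u: "square_integral period_weight u \<le> ennreal B"
    and w: "square_integral period_weight w \<le> ennreal B"
    and B: "B \<ge> 0"
  shows "square_integral (\<lambda>z. period_weight z * indicator S z) u \<le> ennreal (4 * exp M * B / L)"
proof -
  let ?e = "(0, axis i 1) :: real \<times> (real ^ 'n)"
  define p where "p z = period_weight z * indicator S z" for z
  have [measurable]: "p \<in> borel_measurable borel" unfolding p_def by measurable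
  have p_le: "p z \<le> ennreal (exp (M - s * L)) * period_weight (z + (\<sigma> * s) *\<^sub>R ?e)" if "s \<in> {0..1}" for z s
  proof (cases "z \<in> S \<and> fst z \<in> {0<..<T}")
    case True
    then have "ennreal (\<rho> z) \<le> ennreal (exp (M - s * L) * \<rho> (z + (\<sigma> * s) *\<^sub>R ?e))"
      using S that by (intro ennreal_leI) auto
    then show ?thesis using True
      by (simp add: p_def period_weight_def mem_Times_iff ennreal_mult' indicator_def)
  qed (auto simp: p_def period_weight_def mem_Times_iff indicator_def)
  have "square_integral p u
    \<le> (\<integral>\<^sup>+z. 2 * (p z * ennreal ((u (z + (\<sigma> * 1) *\<^sub>R ?e))\<^sup>2)) + 2 * (p z * ennreal ((u (z + (\<sigma> * 1) *\<^sub>R ?e) - u z)\<^sup>2)) \<partial>lborel)"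
  proof (intro nn_integral_mono)
    fix z
    let ?a = "u (z + (\<sigma> * 1) *\<^sub>R ?e)"
    have "p z * ennreal ((u z)\<^sup>2) \<le> p z * (2 * ennreal (?a\<^sup>2) + 2 * ennreal ((?a - u z)\<^sup>2))"
      using square_diff_le[of ?a "?a - u z"] by (intro mult_left_mono) auto
    then show "p z * ennreal ((u z)\<^sup>2) \<le> 2 * (p z * ennreal (?a\<^sup>2)) + 2 * (p z * ennreal ((?a - u z)\<^sup>2))"
      by (simp add: distrib_left mult.left_commute)
  qed
  also have "\<dots> = 2 * square_integral p (\<lambda>z. u (z + (\<sigma> * 1) *\<^sub>R ?e))
    + 2 * square_integral p (\<lambda>z. u (z + (\<sigma> * 1) *\<^sub>R ?e) - u z)"
    by (subst nn_integral_add) (auto simp: nn_integral_cmult)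
  also have "\<dots> \<le> 2 * ennreal (exp M / L * B) + 2 * ennreal (exp M / L * B)"
  proof (intro add_mono mult_left_mono)
    have "square_integral p (\<lambda>z. u (z + (\<sigma> * 1) *\<^sub>R ?e))
      \<le> (\<integral>\<^sup>+z. ennreal (exp (M - 1 * L)) * (period_weight (z + (\<sigma> * 1) *\<^sub>R ?e) * ennreal ((u (z + (\<sigma> * 1) *\<^sub>R ?e))\<^sup>2)) \<partial>lborel)"
    proof (intro nn_integral_mono)
      fix z
      show "p z * ennreal ((u (z + (\<sigma> * 1) *\<^sub>R ?e))\<^sup>2)
        \<le> ennreal (exp (M - 1 * L)) * (period_weight (z + (\<sigma> * 1) *\<^sub>R ?e) * ennreal ((u (z + (\<sigma> * 1) *\<^sub>R ?e))\<^sup>2))"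
        unfolding mult.assoc[symmetric] by (intro mult_right_mono p_le) auto
    qed
    also have "\<dots> = ennreal (exp (M - 1 * L)) * square_integral (\<lambda>z. period_weight (z + (\<sigma> * 1) *\<^sub>R ?e)) (\<lambda>z. u (z + (\<sigma> * 1) *\<^sub>R ?e))"
      by (rule nn_integral_cmult) measurable
    also have "square_integral (\<lambda>z. period_weight (z + (\<sigma> * 1) *\<^sub>R ?e)) (\<lambda>z. u (z + (\<sigma> * 1) *\<^sub>R ?e))
      = square_integral period_weight u"
      by (rule nn_integral_lborel_translate) measurable
    also have "ennreal (exp (M - 1 * L)) * \<dots> \<le> ennreal (exp (M - 1 * L)) * ennreal B"
      by (intro mult_left_mono u) auto
    also have "\<dots> = ennreal (exp (M - 1 * L) * B)" using B by (simp add: ennreal_mult)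
    also have "\<dots> \<le> ennreal (exp M / L * B)"
    proof (intro ennreal_leI mult_right_mono B)
      have "L \<le> exp L" using exp_ge_add_one_self[of L] by linarith
      then show "exp (M - 1 * L) \<le> exp M / L" using L by (simp add: exp_diff frac_le)
    qed
    finally show "square_integral p (\<lambda>z. u (z + (\<sigma> * 1) *\<^sub>R ?e)) \<le> ennreal (exp M / L * B)" .
  next
    have "square_integral p (\<lambda>z. u (z + (\<sigma> * 1) *\<^sub>R ?e) - u z)
      \<le> ennreal 1 * (\<integral>\<^sup>+s. indicator {0..1} s * ennreal (exp (M - s * L)) \<partial>lborel)
        * square_integral period_weight w"
    proof (rule weighted_square_difference_le[OF wd _ _ \<sigma>])
      show "p z \<le> ennreal (exp (M - s * L)) * period_weight (z + (\<sigma> * s) *\<^sub>R ?e)" if "s \<in> {0..1}" for z s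
        using that by (rule p_le)
    qed (auto simp: Basis_prod_def axis_in_Basis_iff)
    also have "(\<integral>\<^sup>+s. indicator {0..1} s * ennreal (exp (M - s * L)) \<partial>lborel)
        = ennreal ((- exp (M - 1 * L) / L) - (- exp (M - 0 * L) / L))"
    proof -
      have "(\<integral>\<^sup>+s. ennreal (exp (M - s * L)) * indicator {0..1} s \<partial>lborel)
        = ennreal ((- exp (M - 1 * L) / L) - (- exp (M - 0 * L) / L))"
        by (rule nn_integral_FTC_Icc) (use L in \<open>auto intro!: derivative_eq_intros\<close>)
      then show ?thesis by (simp add: mult.commute)
    qed
    also have "ennreal 1 * \<dots> * square_integral period_weight w \<le> ennreal 1 * ennreal (exp M / L) * ennreal B"
      using L by (intro mult_mono w ennreal_leI order_refl) auto
    also have "\<dots> = ennreal (exp M / L * B)" using B L by (simp add: ennreal_mult[symmetric])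
    finally show "square_integral p (\<lambda>z. u (z + (\<sigma> * 1) *\<^sub>R ?e) - u z) \<le> ennreal (exp M / L * B)" .
  qed auto
  also have "\<dots> = ennreal (2 * (exp M / L * B) + 2 * (exp M / L * B))"
  proof -
    have *: "2 * ennreal x + 2 * ennreal y = ennreal (2 * x + 2 * y)" if "x \<ge> 0" "y \<ge> 0" for x y
      using that by (simp add: ennreal_mult ennreal_plus)
    show ?thesis by (rule *) (use L B in auto)
  qed
  also have "2 * (exp M / L * B) + 2 * (exp M / L * B) = 4 * exp M * B / L" by simp
  finally show ?thesis by (simp add: p_def)
qed

text \<open>The radius depends on \<open>\<epsilon>\<close> and \<open>B\<close> but not on
  \<open>u\<close>. Beyond it the strip is covered by one set \<open>S (i, \<sigma>)\<close> for
  each axis and sign, and the one-sided bound applies to each of them.\<close>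

lemma tail_le:
  assumes \<epsilon>: "\<epsilon> > 0" and B: "B \<ge> 0"
  shows "\<exists>R\<ge>0. \<forall>u w. u \<in> borel_measurable borel \<longrightarrow>
    square_integral period_weight u \<le> ennreal B \<longrightarrow>
    (\<forall>i. has_weak_deriv [(0, axis i 1)] u (w i) \<and> w i \<in> borel_measurable borel \<and>
      square_integral period_weight (w i) \<le> ennreal B) \<longrightarrow>
    square_integral (\<lambda>z. period_weight z * indicator {z. norm (snd z) > R} z) u \<le> ennreal \<epsilon>"
proof -
  define I where "I = (UNIV :: 'n set) \<times> {1, -1 :: real}"
  \<comment> \<open>Chosen so that the one-sided bounds of all axes and signs add up to at most
    \<open>\<epsilon>\<close>; the added 1 keeps \<open>L\<close> positive when \<open>B\<close> is
    0.\<close>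
  define L where "L = real (card I) * (4 * exp M * B) / \<epsilon> + 1"
  have L: "L > 0" using \<epsilon> B by (simp add: L_def add_nonneg_pos)
  from tail[OF L] obtain R where R: "\<And>t x. t \<in> {0<..<T} \<Longrightarrow> norm x > R \<Longrightarrow>
      \<exists>i. \<exists>\<sigma>\<in>{1, -1}. \<forall>s\<in>{0..1}. \<rho> (t, x) \<le> exp (M - s * L) * \<rho> (t, x + (\<sigma> * s) *\<^sub>R axis i 1)"
    by blast
  define S where "S = (\<lambda>(i, \<sigma>). {z. \<forall>s\<in>{0..1}. \<rho> z \<le> exp (M - s * L) * \<rho> (z + (\<sigma> * s) *\<^sub>R (0, axis i 1))})"
  have [measurable]: "S j \<in> sets borel" for j
  proof -
    obtain i \<sigma> where j: "j = (i, \<sigma>)" by (cases j)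
    \<comment> \<open>An uncountable intersection over \<open>s\<close>; it is measurable because
      each member is closed, by continuity of \<open>\<rho>\<close>.\<close>
    have "S j = (\<Inter>s\<in>{0..1}. {z. \<rho> z \<le> exp (M - s * L) * \<rho> (z + (\<sigma> * s) *\<^sub>R (0, axis i 1))})"
      by (auto simp: S_def j)
    also have "closed \<dots>"
      by (intro closed_INT ballI closed_Collect_le continuous_intros continuous_on_compose2[OF cont]) auto
    finally show ?thesis by (rule borel_closed)
  qed
  have "square_integral (\<lambda>z. period_weight z * indicator {z. norm (snd z) > max R 0} z) u \<le> ennreal \<epsilon>"
    if [measurable]: "u \<in> borel_measurable borel"
    and u: "square_integral period_weight u \<le> ennreal B"
    and w: "\<And>i. has_weak_deriv [(0, axis i 1)] u (w i)" "\<And>i. w i \<in> borel_measurable borel"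
      "\<And>i. square_integral period_weight (w i) \<le> ennreal B" for u w
  proof -
    have "square_integral (\<lambda>z. period_weight z * indicator {z. norm (snd z) > max R 0} z) u
      \<le> (\<integral>\<^sup>+z. (\<Sum>j\<in>I. period_weight z * indicator (S j) z * ennreal ((u z)\<^sup>2)) \<partial>lborel)"
    proof (intro nn_integral_mono)
      fix z :: "real \<times> (real ^ 'n)"
      show "period_weight z * indicator {z. norm (snd z) > max R 0} z * ennreal ((u z)\<^sup>2)
        \<le> (\<Sum>j\<in>I. period_weight z * indicator (S j) z * ennreal ((u z)\<^sup>2))"
      proof (cases "fst z \<in> {0<..<T} \<and> norm (snd z) > max R 0")
        case True
        then have "fst z \<in> {0<..<T}" "norm (snd z) > R" by auto
        from R[OF this] obtain i \<sigma> where "\<sigma> \<in> {1, -1}" "\<forall>s\<in>{0..1}. \<rho> (fst z, snd z) \<le> exp (M - s * L) * \<rho> (fst z, snd z + (\<sigma> * s) *\<^sub>R axis i 1)"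
          by blast
        then have i: "z \<in> S (i, \<sigma>)" "(i, \<sigma>) \<in> I" by (cases z; auto simp: S_def I_def)+
        have "period_weight z * indicator {z. norm (snd z) > max R 0} z * ennreal ((u z)\<^sup>2)
          \<le> period_weight z * indicator (S (i, \<sigma>)) z * ennreal ((u z)\<^sup>2)"
          using i by (auto simp: indicator_def)
        also have "\<dots> \<le> (\<Sum>j\<in>I. period_weight z * indicator (S j) z * ennreal ((u z)\<^sup>2))"
          using i(2) by (intro member_le_sum) (auto simp: I_def)
        finally show ?thesis .
      qed (auto simp: period_weight_def indicator_def mem_Times_iff)
    qed
    also have "\<dots> = (\<Sum>j\<in>I. \<integral>\<^sup>+z. period_weight z * indicator (S j) z * ennreal ((u z)\<^sup>2) \<partial>lborel)"
      by (rule nn_integral_sum) measurable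
    also have "\<dots> \<le> (\<Sum>j\<in>I. ennreal (4 * exp M * B / L))"
    proof (intro sum_mono)
      fix j assume "j \<in> I"
      then obtain i \<sigma> where j: "j = (i, \<sigma>)" "\<sigma> = 1 \<or> \<sigma> = -1" by (auto simp: I_def)
      show "square_integral (\<lambda>z. period_weight z * indicator (S j) z) u \<le> ennreal (4 * exp M * B / L)"
      proof (rule one_sided_tail_le[OF w(1)[of i] _ w(2) _ j(2) L _ u w(3) B])
        show "\<rho> z \<le> exp (M - s * L) * \<rho> (z + (\<sigma> * s) *\<^sub>R (0, axis i 1))" if "z \<in> S j" "s \<in> {0..1}" for z s
          using that by (auto simp: S_def j)
      qed measurable
    qed
    also have "\<dots> = ennreal (real (card I) * (4 * exp M * B / L))"
      using L B by (simp add: ennreal_of_nat_eq_real_of_nat ennreal_mult'[symmetric])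
    also have "\<dots> \<le> ennreal \<epsilon>"
    proof (rule ennreal_leI)
      have "real (card I) * (4 * exp M * B) \<le> \<epsilon> * L" using \<epsilon> by (simp add: L_def field_simps)
      then show "real (card I) * (4 * exp M * B / L) \<le> \<epsilon>" using L by (simp add: field_simps)
    qed
    finally show ?thesis .
  qed
  then show ?thesis by (intro exI[of _ "max R 0"]) auto
qed

text \<open>The limit is taken pointwise, so that it inherits the periodicity of the sequence.\<close>

lemma compactness:
  fixes u :: "nat \<Rightarrow> real \<times> (real ^ 'n) \<Rightarrow> real" and w :: "nat \<Rightarrow> real \<times> (real ^ 'n) \<Rightarrow> real \<times> (real ^ 'n) \<Rightarrow> real"
  assumes wd: "\<And>k b. b \<in> Basis \<Longrightarrow> has_weak_deriv [b] (u k) (w k b)"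
    and u [measurable]: "\<And>k. u k \<in> borel_measurable borel"
    and w: "\<And>k b. b \<in> Basis \<Longrightarrow> w k b \<in> borel_measurable borel"
    and per: "\<And>k. AE z in lborel. u k (z + (T, 0)) = u k z"
      "\<And>k b. b \<in> Basis \<Longrightarrow> AE z in lborel. w k b (z + (T, 0)) = w k b z"
    and bd: "\<And>k. square_integral period_weight (u k) \<le> ennreal B"
      "\<And>k b. b \<in> Basis \<Longrightarrow> square_integral period_weight (w k b) \<le> ennreal B"
    and B: "B \<ge> 0"
  obtains r where "strict_mono (r :: nat \<Rightarrow> nat)"
    "(\<lambda>k. \<integral>\<^sup>+z. period_weight z * ennreal ((u (r k) z - lim (\<lambda>j. u (r j) z))\<^sup>2) \<partial>lborel) \<longlonglongrightarrow> 0"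
proof (rule weighted_L2_compactness[of u w period_weight])
  \<comment> \<open>Stated for all periodic functions at once, so that the constant is the same for
    all \<open>k\<close> and all first derivatives.\<close>
  have loc: "\<exists>C::real. \<forall>f\<in>borel_measurable borel. (AE z in lborel. f (z + (T, 0)) = f z) \<longrightarrow>
      square_integral period_weight f \<le> ennreal B \<longrightarrow>
      square_integral (indicator (cbox a c)) f \<le> ennreal C" for a c
  proof -
    obtain C where C: "C \<ge> 0" "\<And>f. f \<in> borel_measurable borel \<Longrightarrow> (AE z in lborel. f (z + (T, 0)) = f z) \<Longrightarrow>
      (\<integral>\<^sup>+z. indicator (cbox a c) z * f z \<partial>lborel) \<le> ennreal C * (\<integral>\<^sup>+z. period_weight z * f z \<partial>lborel)"
      using local_integral_le[of a c] by blast
    have "square_integral (indicator (cbox a c)) f \<le> ennreal (C * B)"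
      if [measurable]: "f \<in> borel_measurable borel" and f: "AE z in lborel. f (z + (T, 0)) = f z"
        "square_integral period_weight f \<le> ennreal B" for f :: "_ \<Rightarrow> real"
    proof -
      have "square_integral (indicator (cbox a c)) f \<le> ennreal C * square_integral period_weight f"
        by (rule C(2)) (use f(1) in \<open>auto elim!: eventually_mono\<close>)
      also have "\<dots> \<le> ennreal C * ennreal B" by (intro mult_left_mono f) auto
      finally show ?thesis using C(1) B by (simp add: ennreal_mult)
    qed
    then show ?thesis by blast
  qed
  show "\<exists>C::real. \<forall>k. square_integral (indicator (cbox a c)) (u k) \<le> ennreal C" for a c
    using loc[of a c] u per(1) bd(1) by meson
  show "\<exists>C::real. \<forall>k. \<forall>b\<in>Basis. square_integral (indicator (cbox a c)) (w k b) \<le> ennreal C" for a c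
    using loc[of a c] w per(2) bd(2) by meson
  fix \<epsilon> :: real assume \<epsilon>: "\<epsilon> > 0"
  from tail_le[OF this B] obtain R where R: "R \<ge> 0" "\<And>u w. u \<in> borel_measurable borel \<Longrightarrow>
    square_integral period_weight u \<le> ennreal B \<Longrightarrow>
    (\<And>i. has_weak_deriv [(0, axis i 1)] u (w i) \<and> w i \<in> borel_measurable borel \<and>
      square_integral period_weight (w i) \<le> ennreal B) \<Longrightarrow>
    square_integral (\<lambda>z. period_weight z * indicator {z. norm (snd z) > R} z) u \<le> ennreal \<epsilon>"
    by blast
  \<comment> \<open>The time side is \<open>[0, T]\<close>, so a point of the strip outside this box
    has some space coordinate larger than \<open>R\<close> in absolute value.\<close>
  let ?a = "(0, \<chi> i. - R) :: real \<times> (real ^ 'n)" and ?c = "(T, \<chi> i. R) :: real \<times> (real ^ 'n)"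
  obtain C where C: "\<And>z. z \<in> cbox ?a ?c \<Longrightarrow> \<rho> z \<le> C"
  proof -
    have "bounded (\<rho> ` cbox ?a ?c)"
      using cont continuous_on_subset by (intro compact_imp_bounded compact_continuous_image) auto
    then show ?thesis using that unfolding bounded_iff by (metis abs_le_D1 imageI real_norm_def)
  qed
  show "\<exists>a c C. (\<forall>z\<in>cbox a c. period_weight z \<le> ennreal C) \<and>
      (\<forall>k. square_integral (\<lambda>z. period_weight z * indicator (- cbox a c) z) (u k) \<le> ennreal \<epsilon>)"
  proof (intro exI conjI ballI allI)
    show "period_weight z \<le> ennreal C" if "z \<in> cbox ?a ?c" for z
      using C[OF that] by (auto simp: period_weight_def indicator_def intro: ennreal_leI)
    fix k
    have "square_integral (\<lambda>z. period_weight z * indicator (- cbox ?a ?c) z) (u k)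
      \<le> square_integral (\<lambda>z. period_weight z * indicator {z. norm (snd z) > R} z) (u k)"
    proof (intro nn_integral_mono)
      fix z :: "real \<times> (real ^ 'n)"
      have "norm (snd z) > R" if "fst z \<in> {0<..<T}" "z \<notin> cbox ?a ?c"
      proof -
        have "snd z \<notin> cbox (\<chi> i. - R) (\<chi> i. R)"
          using that by (cases z) (auto simp: cbox_Pair_eq)
        then obtain i where "snd z $ i < - R \<or> snd z $ i > R"
          by (auto simp: mem_box_cart not_le)
        then show ?thesis using component_le_norm_cart[of "snd z" i] by linarith
      qed
      then show "period_weight z * indicator (- cbox ?a ?c) z * ennreal ((u k z)\<^sup>2)
        \<le> period_weight z * indicator {z. norm (snd z) > R} z * ennreal ((u k z)\<^sup>2)"
        by (auto simp: period_weight_def indicator_def mem_Times_iff)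
    qed
    also have "\<dots> \<le> ennreal \<epsilon>"
    proof (rule R(2)[OF u bd(1)])
      fix i
      have "(0, axis i 1) \<in> (Basis :: (real \<times> (real ^ 'n)) set)"
        by (auto simp: Basis_prod_def axis_in_Basis_iff)
      then show "has_weak_deriv [(0, axis i 1)] (u k) (w k (0, axis i 1)) \<and> w k (0, axis i 1) \<in> borel_measurable borel \<and>
        square_integral period_weight (w k (0, axis i 1)) \<le> ennreal B"
        using wd w bd(2) by blast
    qed
    finally show "square_integral (\<lambda>z. period_weight z * indicator (- cbox ?a ?c) z) (u k) \<le> ennreal \<epsilon>" .
  qed
qed (use wd w in auto)

end

section \<open>Matrices and linear differential equations\<close>

lemma bounded_bilinear_matrix_mult:
  "bounded_bilinear ((**) :: real ^ 'n ^ 'm \<Rightarrow> real ^ 'k ^ 'n \<Rightarrow> real ^ 'k ^ 'm)"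
  unfolding bilinear_conv_bounded_bilinear[symmetric] bilinear_def
  by (auto intro!: linearI simp: matrix_matrix_mult_def vec_eq_iff sum.distrib[symmetric]
      sum_distrib_left algebra_simps)

lemma bounded_bilinear_matrix_vector_mult:
  "bounded_bilinear ((*v) :: real ^ 'n ^ 'm \<Rightarrow> real ^ 'n \<Rightarrow> real ^ 'm)"
  unfolding bilinear_conv_bounded_bilinear[symmetric] bilinear_def
  by (auto intro!: linearI simp: matrix_vector_mult_def vec_eq_iff sum.distrib[symmetric]
      sum_distrib_left algebra_simps)

lemma bounded_linear_transpose: "bounded_linear (transpose :: real ^ 'n ^ 'm \<Rightarrow> real ^ 'm ^ 'n)"
  unfolding linear_conv_bounded_linear[symmetric]
  by (auto intro!: linearI simp: transpose_def vec_eq_iff)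

lemmas continuous_on_matrix_mult = bounded_bilinear.continuous_on[OF bounded_bilinear_matrix_mult]
lemmas continuous_on_matrix_vector_mult = bounded_bilinear.continuous_on[OF bounded_bilinear_matrix_vector_mult]
lemmas continuous_on_transpose = bounded_linear.continuous_on[OF bounded_linear_transpose]

lemma continuous_on_det:
  fixes F :: "'a::topological_space \<Rightarrow> real ^ 'n ^ 'n"
  assumes "continuous_on S F"
  shows "continuous_on S (\<lambda>x. det (F x))"
  unfolding det_def by (intro continuous_intros assms)

lemma matrix_inv_mult:
  fixes Q :: "real ^ 'n ^ 'n"
  assumes "det Q \<noteq> 0"
  shows "matrix_inv Q ** Q = mat 1" "Q ** matrix_inv Q = mat 1"
proof -
  have "invertible Q" using assms invertible_det_nz by blast
  then have "\<exists>A'. Q ** A' = mat 1 \<and> A' ** Q = mat 1" by (simp add: invertible_def)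
  from someI_ex[OF this] show "matrix_inv Q ** Q = mat 1" "Q ** matrix_inv Q = mat 1"
    by (auto simp: matrix_inv_def)
qed

text \<open>Continuity is read off Cramer's rule.\<close>

lemma continuous_on_matrix_inv:
  fixes F :: "'a::topological_space \<Rightarrow> real ^ 'n ^ 'n"
  assumes F: "continuous_on S F" and nz: "\<And>x. x \<in> S \<Longrightarrow> det (F x) \<noteq> 0"
  shows "continuous_on S (\<lambda>x. matrix_inv (F x))"
proof -
  have eq: "matrix_inv (F x) = (\<chi> k j. det (\<chi> i l. if l = k then axis j 1 $ i else F x $ i $ l) / det (F x))"
    if x: "x \<in> S" for x
  proof -
    have "matrix_inv (F x) *v axis j 1 = (\<chi> k. det (\<chi> i l. if l = k then axis j 1 $ i else F x $ i $ l) / det (F x))" for j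
    proof -
      have "F x *v (matrix_inv (F x) *v axis j 1) = axis j 1"
        using nz[OF x] by (simp add: matrix_vector_mul_assoc matrix_inv_mult)
      then show ?thesis by (simp only: cramer[OF nz[OF x]])
    qed
    then show ?thesis
      by (simp add: vec_eq_iff matrix_vector_mult_basis column_def)
  qed
  have "continuous_on S (\<lambda>x. if l = k then axis j 1 $ i else F x $ i $ l)" for i j k l
    by (cases "l = k") (auto intro!: continuous_intros F)
  then have "continuous_on S (\<lambda>x. \<chi> k j. det (\<chi> i l. if l = k then axis j 1 $ i else F x $ i $ l) / det (F x))"
    using nz by (intro continuous_intros continuous_on_det F continuous_on_vec_lambda) auto
  then show ?thesis by (subst continuous_on_cong[OF refl eq]) auto
qed

text \<open>On the segment from the identity to \<open>Q\<close> every quadratic form is positive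
  definite, hence every matrix invertible; the determinant, continuous and equal to 1 at the start,
  cannot pass through 0.\<close>

lemma det_pos_if_positive_definite:
  fixes Q :: "real ^ 'n ^ 'n"
  assumes Q: "\<And>x. x \<noteq> 0 \<Longrightarrow> x \<bullet> (Q *v x) > 0"
  shows "det Q > 0"
proof (rule ccontr)
  assume neg: "\<not> det Q > 0"
  define F where "F s = (1 - s) *\<^sub>R mat 1 + s *\<^sub>R Q" for s :: real
  have nz: "det (F s) \<noteq> 0" if s: "s \<in> {0..1}" for s
  proof -
    have "x = 0" if "F s *v x = 0" for x
    proof (rule ccontr)
      assume x: "x \<noteq> 0"
      have "x \<bullet> (F s *v x) = (1 - s) * (x \<bullet> x) + s * (x \<bullet> (Q *v x))"
        by (simp add: F_def matrix_vector_mult_add_rdistrib scaleR_matrix_vector_assoc[symmetric] inner_add_right)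
      moreover have "\<dots> > 0"
      proof (cases "s = 0")
        case False
        then show ?thesis using s Q[OF x] by (intro add_nonneg_pos) auto
      qed (use x in auto)
      ultimately show False using that by simp
    qed
    then have "invertible (F s)"
      by (auto simp: invertible_left_inverse matrix_left_invertible_ker)
    then show ?thesis by (simp add: invertible_det_nz)
  qed
  have "continuous_on {0..1} (\<lambda>s. det (F s))"
    unfolding F_def by (intro continuous_on_det continuous_intros)
  moreover have "det (F 0) = 1" "det (F 1) = det Q" by (simp_all add: F_def)
  ultimately obtain s where "s \<in> {0..1}" "det (F s) = 0"
    using IVT2'[of "\<lambda>s. det (F s)" 1 0 0] neg by auto
  then show False using nz by blast
qed

text \<open>Dominated convergence: the indicators of the half-lines converge except at the end point
  itself, and a half-line beyond all \<open>X n\<close> provides the majorant.\<close>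

lemma continuous_on_integral_lessThan:
  fixes h :: "real \<Rightarrow> 'b::euclidean_space"
  assumes int: "\<And>t. set_integrable lborel {..<t} h"
  shows "continuous_on UNIV (\<lambda>t. LINT r:{..<t}|lborel. h r)"
  unfolding continuous_on_sequentially
proof (safe, unfold comp_def)
  fix X :: "nat \<Rightarrow> real" and t assume X: "X \<longlonglongrightarrow> t"
  then obtain b where b: "\<And>n. X n \<le> b"
    using convergent_imp_Bseq[of X] unfolding convergent_def Bseq_def by (metis abs_le_D1 real_norm_def)
  have [measurable]: "(\<lambda>r. indicator {..<s} r *\<^sub>R h r) \<in> borel_measurable lborel" for s
    using int[of s] by (auto simp: set_integrable_def)
  show "(\<lambda>n. LINT r:{..<X n}|lborel. h r) \<longlonglongrightarrow> (LINT r:{..<t}|lborel. h r)"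
    unfolding set_lebesgue_integral_def
  proof (rule integral_dominated_convergence[where w = "\<lambda>r. norm (indicator {..<b} r *\<^sub>R h r)"])
    show "integrable lborel (\<lambda>r. norm (indicator {..<b} r *\<^sub>R h r))"
      using int[of b] unfolding set_integrable_def by (rule integrable_norm)
    show "AE r in lborel. norm (indicator {..<X n} r *\<^sub>R h r) \<le> norm (indicator {..<b} r *\<^sub>R h r)" for n
      using b[of n] by (auto simp: indicator_def)
    have "AE r in lborel. r \<noteq> t" by (rule AE_lborel_singleton)
    then show "AE r in lborel. (\<lambda>n. indicator {..<X n} r *\<^sub>R h r) \<longlonglongrightarrow> indicator {..<t} r *\<^sub>R h r"
    proof eventually_elim
      case (elim r)
      have "\<forall>\<^sub>F n in sequentially. indicator {..<t} r *\<^sub>R h r = indicator {..<X n} r *\<^sub>R h r"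
      proof (cases "r < t")
        case True
        show ?thesis
          by (rule eventually_mono[OF order_tendstoD(1)[OF X True]]) (use True in auto)
      next
        case False
        then have "t < r" using elim by simp
        show ?thesis
          by (rule eventually_mono[OF order_tendstoD(2)[OF X \<open>t < r\<close>]]) (use \<open>t < r\<close> in auto)
      qed
      then show ?case by (rule Lim_transform_eventually[OF tendsto_const])
    qed
  qed auto
qed

lemma set_integrable_exponential_bound:
  fixes h :: "real \<Rightarrow> 'b::euclidean_space"
  assumes h: "continuous_on UNIV h" and \<omega>: "\<omega> < 0"
    and bd: "\<And>r. r \<le> t \<Longrightarrow> norm (h r) \<le> C * exp (\<omega> * (t - r))"
  shows "set_integrable lborel {..<t} h"
  unfolding set_integrable_def
proof (rule integrableI_bounded)
  have [measurable]: "h \<in> borel_measurable borel" using h by (rule borel_measurable_continuous_onI)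
  show "(\<lambda>r. indicator {..<t} r *\<^sub>R h r) \<in> borel_measurable lborel" by measurable
  have C: "C \<ge> 0" using order_trans[OF norm_ge_zero bd[of t]] by simp
  have "(\<integral>\<^sup>+r. ennreal (norm (indicator {..<t} r *\<^sub>R h r)) \<partial>lborel)
    \<le> (\<integral>\<^sup>+r. ennreal (C * exp (\<omega> * (t - r))) * indicator {0..} (t - r) \<partial>lborel)"
    by (intro nn_integral_mono) (auto simp: indicator_def intro!: ennreal_leI bd)
  also have "\<dots> = (\<integral>\<^sup>+x. ennreal (C * exp (\<omega> * x)) * indicator {0..} x \<partial>lborel)"
    by (rule nn_integral_reflect) measurable
  also have "\<dots> = ennreal (0 - C * exp (\<omega> * 0) / \<omega>)"
  proof (rule nn_integral_FTC_atLeast)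
    show "((\<lambda>x. C * exp (\<omega> * x) / \<omega>) \<longlongrightarrow> 0) at_top"
    proof -
      have "LIM x at_top. \<omega> * x :> at_bot"
        using \<omega> by (intro filterlim_tendsto_neg_mult_at_bot[OF tendsto_const]) (auto simp: filterlim_ident)
      then have "((\<lambda>x. exp (\<omega> * x)) \<longlongrightarrow> 0) at_top" by (rule filterlim_compose[OF exp_at_bot])
      from tendsto_mult[OF tendsto_const[of "C / \<omega>"] this] show ?thesis by simp
    qed
    show "((\<lambda>x. C * exp (\<omega> * x) / \<omega>) has_real_derivative C * exp (\<omega> * x)) (at x)" for x
      using \<omega> by (auto intro!: derivative_eq_intros)
  qed (use C in auto)
  also have "\<dots> < \<infinity>" by simp
  finally show "(\<integral>\<^sup>+r. ennreal (norm (indicator {..<t} r *\<^sub>R h r)) \<partial>lborel) < \<infinity>" .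
qed

text \<open>A Gronwall estimate for the squared norm, whose derivative is at most
  \<open>2 * c\<close> times itself in absolute value: multiplied by
  \<open>exp (- 2 * c * \<tau>)\<close> it does not increase, by \<open>exp (2 * c * \<tau>)\<close>
  it does not decrease. As it covers both orders of \<open>s\<close> and \<open>t\<close>, it
  contains uniqueness.\<close>

lemma linear_ode_growth:
  fixes A :: "real \<Rightarrow> real ^ 'n ^ 'n"
  assumes "bounded (range A)"
  obtains c where "c \<ge> 0"
    "\<And>(X :: real \<Rightarrow> real ^ 'n ^ 'n) s t. (\<And>\<tau>. (X has_vector_derivative A \<tau> ** X \<tau>) (at \<tau>)) \<Longrightarrow> norm (X t) \<le> exp (c * \<bar>t - s\<bar>) * norm (X s)"
proof -
  obtain a where a: "a > 0" "\<And>t. norm (A t) \<le> a"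
    using assms unfolding bounded_pos by blast
  obtain K where K: "K > 0" "\<And>(M :: real ^ 'n ^ 'n) (N :: real ^ 'n ^ 'n). norm (M ** N) \<le> norm M * norm N * K"
    using bounded_bilinear.pos_bounded[OF bounded_bilinear_matrix_mult] by blast
  define c where "c = a * K"
  have c: "c > 0" using a K by (simp add: c_def)
  have AX: "norm (A t ** X) \<le> c * norm X" for t and X :: "real ^ 'n ^ 'n"
  proof -
    have "norm (A t ** X) \<le> norm (A t) * norm X * K" by (rule K)
    also have "\<dots> \<le> a * norm X * K" using a K by (intro mult_right_mono) auto
    finally show ?thesis by (simp add: c_def mult_ac)
  qed
  have "norm (X t) \<le> exp (c * \<bar>t - s\<bar>) * norm (X s)"
    if X: "\<And>\<tau>. (X has_vector_derivative A \<tau> ** X \<tau>) (at \<tau>)" for X :: "real \<Rightarrow> real ^ 'n ^ 'n" and s t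
  proof -
    have bd: "\<bar>X \<tau> \<bullet> (A \<tau> ** X \<tau>)\<bar> \<le> c * (X \<tau> \<bullet> X \<tau>)" for \<tau>
    proof -
      have "\<bar>X \<tau> \<bullet> (A \<tau> ** X \<tau>)\<bar> \<le> norm (X \<tau>) * norm (A \<tau> ** X \<tau>)" by (rule Cauchy_Schwarz_ineq2)
      also have "\<dots> \<le> norm (X \<tau>) * (c * norm (X \<tau>))" by (intro mult_left_mono AX) auto
      finally show ?thesis by (simp add: dot_square_norm power2_eq_square mult_ac)
    qed
    have sq: "((\<lambda>\<tau>. X \<tau> \<bullet> X \<tau>) has_real_derivative 2 * (X \<tau> \<bullet> (A \<tau> ** X \<tau>))) (at \<tau>)" for \<tau>
      unfolding has_field_derivative_def
      by (rule has_derivative_eq_rhs[OF has_derivative_inner[OF X[unfolded has_vector_derivative_def] X[unfolded has_vector_derivative_def]]])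
         (auto simp: inner_commute)
    have d: "((\<lambda>\<tau>. X \<tau> \<bullet> X \<tau> * exp (k * \<tau>)) has_real_derivative
        (2 * (X \<tau> \<bullet> (A \<tau> ** X \<tau>)) + k * (X \<tau> \<bullet> X \<tau>)) * exp (k * \<tau>)) (at \<tau>)" for \<tau> k
      by (rule derivative_eq_intros sq refl)+ (simp add: algebra_simps)
    have aux: "p \<le> E * q" if le: "p * e1 \<le> q * e2" and e: "e1 * e3 = 1" "e2 * e3 = E" "e3 \<ge> 0" for p q e1 e2 e3 E :: real
    proof -
      have "p * (e1 * e3) \<le> q * (e2 * e3)"
        using mult_right_mono[OF le e(3)] by (simp only: mult.assoc)
      then show ?thesis unfolding e by (simp add: mult.commute)
    qed
    have sqle: "X t \<bullet> X t \<le> exp (2 * c * \<bar>t - s\<bar>) * (X s \<bullet> X s)"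
    proof (cases "s \<le> t")
      case True
      have "X t \<bullet> X t * exp (- 2 * c * t) \<le> X s \<bullet> X s * exp (- 2 * c * s)"
      proof (rule DERIV_nonpos_imp_nonincreasing[OF True])
        fix \<tau>
        have "2 * (X \<tau> \<bullet> (A \<tau> ** X \<tau>)) + - 2 * c * (X \<tau> \<bullet> X \<tau>) \<le> 0" using bd[of \<tau>] by (simp add: abs_le_iff)
        then have "(2 * (X \<tau> \<bullet> (A \<tau> ** X \<tau>)) + - 2 * c * (X \<tau> \<bullet> X \<tau>)) * exp (- 2 * c * \<tau>) \<le> 0"
          by (intro mult_nonpos_nonneg) auto
        then show "\<exists>y. ((\<lambda>\<tau>. X \<tau> \<bullet> X \<tau> * exp (- 2 * c * \<tau>)) has_real_derivative y) (at \<tau>) \<and> y \<le> 0"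
          using d[where k = "- 2 * c"] by blast
      qed
      moreover have "exp (- 2 * c * t) * exp (2 * c * t) = 1" by (simp add: exp_add[symmetric])
      moreover have "exp (- 2 * c * s) * exp (2 * c * t) = exp (2 * c * \<bar>t - s\<bar>)"
        using True by (simp add: exp_add[symmetric] algebra_simps)
      ultimately show ?thesis by (rule aux) simp
    next
      case False
      then have le: "t \<le> s" by simp
      have "X t \<bullet> X t * exp (2 * c * t) \<le> X s \<bullet> X s * exp (2 * c * s)"
      proof (rule DERIV_nonneg_imp_nondecreasing[OF le])
        fix \<tau>
        have "2 * (X \<tau> \<bullet> (A \<tau> ** X \<tau>)) + 2 * c * (X \<tau> \<bullet> X \<tau>) \<ge> 0" using bd[of \<tau>] by (simp add: abs_le_iff)
        then have "(2 * (X \<tau> \<bullet> (A \<tau> ** X \<tau>)) + 2 * c * (X \<tau> \<bullet> X \<tau>)) * exp (2 * c * \<tau>) \<ge> 0"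
          by (intro mult_nonneg_nonneg) auto
        then show "\<exists>y. ((\<lambda>\<tau>. X \<tau> \<bullet> X \<tau> * exp (2 * c * \<tau>)) has_real_derivative y) (at \<tau>) \<and> y \<ge> 0"
          using d[where k = "2 * c"] by blast
      qed
      moreover have "exp (2 * c * t) * exp (- 2 * c * t) = 1" by (simp add: exp_add[symmetric])
      moreover have "exp (2 * c * s) * exp (- 2 * c * t) = exp (2 * c * \<bar>t - s\<bar>)"
        using le by (simp add: exp_add[symmetric] algebra_simps)
      ultimately show ?thesis by (rule aux) simp
    qed
    have "(norm (X t))\<^sup>2 \<le> (exp (c * \<bar>t - s\<bar>) * norm (X s))\<^sup>2"
      using sqle by (simp add: power_mult_distrib exp_double[symmetric] dot_square_norm mult.assoc)
    then show ?thesis by (rule power2_le_imp_le) simp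
  qed
  with c show ?thesis by (intro that[of c]) auto
qed

lemma set_integral_bounded_linear:
  fixes h :: "real \<Rightarrow> 'b::euclidean_space" and F :: "'b \<Rightarrow> 'c::euclidean_space"
  assumes F: "bounded_linear F" and h: "set_integrable lborel S h"
  shows "(LINT r:S|lborel. F (h r)) = F (LINT r:S|lborel. h r)"
proof -
  have "(LINT r:S|lborel. F (h r)) = (LINT r|lborel. F (indicator S r *\<^sub>R h r))"
    using F by (simp add: set_lebesgue_integral_def linear_cmul bounded_linear.linear)
  also have "\<dots> = F (LINT r:S|lborel. h r)"
    using h unfolding set_lebesgue_integral_def set_integrable_def
    by (rule integral_bounded_linear[OF F])
  finally show ?thesis .
qed

lemma inner_matrix_vector_mult: "x \<bullet> (C *v y) = (transpose C *v x) \<bullet> y" for C :: "real ^ 'n ^ 'n"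
  by (simp add: dot_lmul_matrix)

lemma det_nz_imp_mult_nz: "det C \<noteq> 0 \<Longrightarrow> x \<noteq> 0 \<Longrightarrow> C *v x \<noteq> 0" for C :: "real ^ 'n ^ 'n"
  by (metis invertible_det_nz invertible_left_inverse matrix_left_invertible_ker)

section \<open>The evolution system of Gaussian measures\<close>

locale stable_evolution =
  fixes A B :: "real \<Rightarrow> real ^ 'n ^ 'n"
    and f :: "real \<Rightarrow> real ^ 'n"
    and U :: "real \<Rightarrow> real \<Rightarrow> real ^ 'n ^ 'n"
    and \<mu>0 :: real
  assumes A_bounded: "bounded (range A)"
    and B_cont: "continuous_on UNIV B" and B_bounded: "bounded (range B)"
    and f_cont: "continuous_on UNIV f" and f_bounded: "bounded (range f)"
    and \<mu>0: "\<mu>0 > 0" and B_below: "\<And>t x. norm (B t *v x) \<ge> \<mu>0 * norm x"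
    and evolution: "evolution_family A U"
    and stable: "growth_bound U < 0"
begin

lemma U_refl: "U s s = mat 1"
  and U_deriv: "((\<lambda>\<tau>. U \<tau> s) has_vector_derivative A t ** U t s) (at t)"
  using evolution by (auto simp: evolution_family_def)

text \<open>Uniqueness: as functions of \<open>t\<close> both sides solve the equation and agree at
  \<open>t = r\<close>, so their difference is bounded by a multiple of 0.\<close>

lemma U_cocycle: "U t s = U t r ** U r s"
proof -
  obtain c where c: "c \<ge> 0"
    "\<And>(X :: real \<Rightarrow> real ^ 'n ^ 'n) s t. (\<And>\<tau>. (X has_vector_derivative A \<tau> ** X \<tau>) (at \<tau>)) \<Longrightarrow> norm (X t) \<le> exp (c * \<bar>t - s\<bar>) * norm (X s)"
    using linear_ode_growth[OF A_bounded] by blast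
  define X where "X \<tau> = U \<tau> s - U \<tau> r ** U r s" for \<tau>
  have "(X has_vector_derivative A \<tau> ** X \<tau>) (at \<tau>)" for \<tau>
  proof -
    have "((\<lambda>\<tau>. U \<tau> r ** U r s) has_vector_derivative (A \<tau> ** U \<tau> r) ** U r s) (at \<tau>)"
      by (rule bounded_linear.has_vector_derivative[OF bounded_bilinear.bounded_linear_left[OF bounded_bilinear_matrix_mult] U_deriv])
    from has_vector_derivative_diff[OF U_deriv this]
    show ?thesis
      unfolding X_def by (simp add: bounded_bilinear.diff_right[OF bounded_bilinear_matrix_mult] matrix_mul_assoc)
  qed
  from c(2)[OF this, of t r] have "X t = 0" by (simp add: X_def U_refl)
  then show ?thesis by (simp add: X_def)
qed

lemma U_inverse: "U s t ** U t s = mat 1"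
  using U_cocycle[of s s t] by (simp add: U_refl)

lemma det_U_nz: "det (U t s) \<noteq> 0"
proof -
  have "\<exists>V. V ** U t s = mat 1" using U_inverse by blast
  then show ?thesis by (simp add: invertible_left_inverse[symmetric] invertible_det_nz)
qed

lemma U_eq_matrix_inv: "U s t = matrix_inv (U t s)"
proof -
  have "U s t = U s t ** (U t s ** matrix_inv (U t s))"
    using matrix_inv_mult(2)[OF det_U_nz] by simp
  also have "\<dots> = matrix_inv (U t s)" by (simp add: matrix_mul_assoc U_inverse)
  finally show ?thesis .
qed

lemma continuous_on_U_left: "continuous_on S (\<lambda>t. U t s)"
  by (intro continuous_at_imp_continuous_on ballI has_vector_derivative_continuous[OF U_deriv])

text \<open>The equation gives regularity in the first argument only; the cocycle law makes
  \<open>U t s\<close> the inverse of \<open>U s t\<close>, and inversion is continuous.\<close>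

lemma continuous_on_U_right: "continuous_on S (\<lambda>s. U t s)"
  unfolding U_eq_matrix_inv[of t] by (intro continuous_on_matrix_inv continuous_on_U_left det_U_nz)

text \<open>A negative infimum leaves room for a negative admissible rate. The growth bound speaks
  of the operator norm, \<open>norm\<close> is the Frobenius norm; the operator norm bounds every
  entry, hence the factor counting the entries.\<close>

lemma U_decay: "\<exists>\<omega> M. \<omega> < 0 \<and> (\<forall>t s. s \<le> t \<longrightarrow> norm (U t s) \<le> M * exp (\<omega> * (t - s)))"
proof -
  from stable[unfolded growth_bound_def Inf_less_iff] obtain e where e: "e < 0"
    "e \<in> {ereal \<omega> |\<omega>. \<exists>M. \<forall>t s. s \<le> t \<longrightarrow> onorm (\<lambda>x. U t s *v x) \<le> M * exp (\<omega> * (t - s))}"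
    by blast
  then obtain \<omega> M where "e = ereal \<omega>" and M: "\<forall>t s. s \<le> t \<longrightarrow> onorm (\<lambda>x. U t s *v x) \<le> M * exp (\<omega> * (t - s))"
    by blast
  then have \<omega>: "\<omega> < 0" using e(1) by simp
  have "norm (U t s) \<le> real CARD('n) * real CARD('n) * M * exp (\<omega> * (t - s))" if "s \<le> t" for t s
  proof -
    have "norm (U t s) \<le> (\<Sum>i\<in>UNIV. norm (U t s $ i))"
      unfolding norm_vec_def by (rule L2_set_le_sum) auto
    also have "\<dots> \<le> (\<Sum>i\<in>(UNIV::'n set). \<Sum>j\<in>(UNIV::'n set). \<bar>U t s $ i $ j\<bar>)"
      by (intro sum_mono norm_le_l1_cart)
    also have "\<dots> \<le> (\<Sum>i\<in>(UNIV::'n set). \<Sum>j\<in>(UNIV::'n set). M * exp (\<omega> * (t - s)))"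
      by (intro sum_mono order_trans[OF matrix_component_le_onorm M[rule_format, OF that]])
    finally show ?thesis by (simp add: mult.assoc)
  qed
  with \<omega> show ?thesis by blast
qed

text \<open>The integrand of the covariance transported to time 0. Since
  \<open>U t r = U t 0 ** U 0 r\<close>, the variable \<open>t\<close> then occurs only in the outer
  factors and in the end point of the integral, which makes continuity in \<open>t\<close>
  accessible.\<close>

definition cov_integrand :: "real \<Rightarrow> real ^ 'n ^ 'n" where
  "cov_integrand r = (U 0 r ** B r) ** transpose (U 0 r ** B r)"

lemma continuous_on_cov_integrand: "continuous_on S cov_integrand"
  unfolding cov_integrand_def
  by (intro continuous_on_matrix_mult continuous_on_transpose continuous_on_U_right
      continuous_on_subset[OF B_cont]) auto

lemma continuous_on_mean_integrand: "continuous_on S (\<lambda>r. U 0 r *v f r)"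
  by (intro continuous_on_matrix_vector_mult continuous_on_U_right continuous_on_subset[OF f_cont]) auto

text \<open>The decay is recovered from \<open>U 0 r = U 0 t ** U t r\<close>, with a constant that
  depends on \<open>t\<close>. The bound for the covariance integrand contains the exponential
  twice; one of the two factors is estimated by 1.\<close>

lemma integrands_integrable:
  "set_integrable lborel {..<t} (\<lambda>r. U 0 r *v f r)" "set_integrable lborel {..<t} cov_integrand"
proof -
  from U_decay obtain \<omega> M where \<omega>: "\<omega> < 0" "\<forall>t s. s \<le> t \<longrightarrow> norm (U t s) \<le> M * exp (\<omega> * (t - s))"
    by blast
  obtain K where K: "K > 0" "\<And>(M :: real ^ 'n ^ 'n) (N :: real ^ 'n ^ 'n). norm (M ** N) \<le> norm M * norm N * K"
    using bounded_bilinear.pos_bounded[OF bounded_bilinear_matrix_mult] by blast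
  obtain L where L: "L > 0" "\<And>(M :: real ^ 'n ^ 'n) (x :: real ^ 'n). norm (M *v x) \<le> norm M * norm x * L"
    using bounded_bilinear.pos_bounded[OF bounded_bilinear_matrix_vector_mult] by blast
  obtain k where k: "k > 0" "\<And>M :: real ^ 'n ^ 'n. norm (transpose M) \<le> norm M * k"
    using bounded_linear.pos_bounded[OF bounded_linear_transpose] by blast
  obtain b where b: "b > 0" "\<And>r. norm (B r) \<le> b" using B_bounded unfolding bounded_pos by blast
  obtain \<phi> where \<phi>: "\<phi> > 0" "\<And>r. norm (f r) \<le> \<phi>" using f_bounded unfolding bounded_pos by blast
  define D where "D = norm (U 0 t) * M * K"
  have D: "norm (U 0 r) \<le> D * exp (\<omega> * (t - r))" if "r \<le> t" for r
  proof -
    have "norm (U 0 r) \<le> norm (U 0 t) * norm (U t r) * K"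
      unfolding U_cocycle[of 0 r t] by (rule K)
    also have "\<dots> \<le> norm (U 0 t) * (M * exp (\<omega> * (t - r))) * K"
      using K by (intro mult_right_mono mult_left_mono \<omega>(2)[rule_format] that) auto
    finally show ?thesis by (simp add: D_def mult_ac)
  qed
  show "set_integrable lborel {..<t} (\<lambda>r. U 0 r *v f r)"
  proof (rule set_integrable_exponential_bound[OF continuous_on_mean_integrand \<omega>(1)])
    fix r assume r: "r \<le> t"
    have "norm (U 0 r *v f r) \<le> norm (U 0 r) * norm (f r) * L" by (rule L)
    also have "\<dots> \<le> D * exp (\<omega> * (t - r)) * \<phi> * L"
      using L by (intro mult_right_mono mult_mono D \<phi> r order_trans[OF norm_ge_zero D[OF r]]) auto
    finally show "norm (U 0 r *v f r) \<le> (D * \<phi> * L) * exp (\<omega> * (t - r))" by (simp add: mult_ac)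
  qed
  show "set_integrable lborel {..<t} cov_integrand"
  proof (rule set_integrable_exponential_bound[OF continuous_on_cov_integrand \<omega>(1)])
    fix r assume r: "r \<le> t"
    let ?e = "exp (\<omega> * (t - r))"
    have e: "?e \<le> 1" using \<omega>(1) r by (simp add: mult_nonpos_nonneg)
    have "norm (U 0 r ** B r) \<le> norm (U 0 r) * norm (B r) * K" by (rule K)
    also have "\<dots> \<le> D * ?e * b * K"
      using K by (intro mult_right_mono mult_mono D b r order_trans[OF norm_ge_zero D[OF r]]) auto
    finally have C: "norm (U 0 r ** B r) \<le> D * ?e * b * K" .
    have D0: "0 \<le> D * ?e * b * K" using order_trans[OF norm_ge_zero C] .
    have "norm (cov_integrand r) \<le> norm (U 0 r ** B r) * norm (transpose (U 0 r ** B r)) * K"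
      unfolding cov_integrand_def by (rule K)
    also have "\<dots> \<le> norm (U 0 r ** B r) * (norm (U 0 r ** B r) * k) * K"
      using K by (intro mult_right_mono mult_left_mono k) auto
    also have "\<dots> \<le> (D * ?e * b * K) * ((D * ?e * b * K) * k) * K"
      using K k C D0 by (intro mult_right_mono mult_mono) auto
    also have "\<dots> = ((D * b * K)\<^sup>2 * k * K) * (?e * ?e)" by (simp add: power2_eq_square mult_ac)
    also have "\<dots> \<le> ((D * b * K)\<^sup>2 * k * K) * (?e * 1)"
      using K k e by (intro mult_left_mono) auto
    finally show "norm (cov_integrand r) \<le> ((D * b * K)\<^sup>2 * k * K) * ?e" by simp
  qed
qed

definition mean :: "real \<Rightarrow> real ^ 'n" where
  "mean t = mean_g U f t (-\<infinity>)"

definition cov :: "real \<Rightarrow> real ^ 'n ^ 'n" where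
  "cov t = cov_Q U B t (-\<infinity>)"

lemma mean_eq: "mean t = U t 0 *v (LINT r:{..<t}|lborel. U 0 r *v f r)"
proof -
  have "mean t = (LINT r:{..<t}|lborel. U t 0 *v (U 0 r *v f r))"
    unfolding mean_def mean_g_def interval_lebesgue_integral_def
    by (simp add: matrix_vector_mul_assoc U_cocycle[of t _ 0, symmetric])
  also have "\<dots> = U t 0 *v (LINT r:{..<t}|lborel. U 0 r *v f r)"
    by (intro set_integral_bounded_linear integrands_integrable) simp
  finally show ?thesis .
qed

lemma cov_eq: "cov t = U t 0 ** (LINT r:{..<t}|lborel. cov_integrand r) ** transpose (U t 0)"
proof -
  have *: "U t r ** B r ** transpose (B r) ** transpose (U t r) = U t 0 ** cov_integrand r ** transpose (U t 0)" for r
    unfolding cov_integrand_def U_cocycle[of t r 0]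
    by (simp add: matrix_transpose_mul matrix_mul_assoc)
  have bl: "bounded_linear (\<lambda>M. U t 0 ** M ** transpose (U t 0))"
    by (rule bounded_linear_compose[OF bounded_bilinear.bounded_linear_left[OF bounded_bilinear_matrix_mult]
        bounded_bilinear.bounded_linear_right[OF bounded_bilinear_matrix_mult]])
  have "cov t = (LINT r:{..<t}|lborel. U t 0 ** cov_integrand r ** transpose (U t 0))"
    unfolding cov_def cov_Q_def interval_lebesgue_integral_def by (simp add: *)
  also have "\<dots> = U t 0 ** (LINT r:{..<t}|lborel. cov_integrand r) ** transpose (U t 0)"
    by (intro set_integral_bounded_linear[OF bl] integrands_integrable)
  finally show ?thesis .
qed

lemma continuous_on_mean: "continuous_on UNIV mean"
  unfolding mean_eq[abs_def]
  by (intro continuous_on_matrix_vector_mult continuous_on_U_left continuous_on_integral_lessThan integrands_integrable)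

lemma continuous_on_cov: "continuous_on UNIV cov"
  unfolding cov_eq[abs_def]
  by (intro continuous_on_matrix_mult continuous_on_transpose continuous_on_U_left
      continuous_on_integral_lessThan integrands_integrable)

lemma transpose_cov: "transpose (cov t) = cov t"
proof -
  have "transpose (LINT r:{..<t}|lborel. cov_integrand r) = (LINT r:{..<t}|lborel. transpose (cov_integrand r))"
    by (rule set_integral_bounded_linear[OF bounded_linear_transpose, symmetric]) (rule integrands_integrable)
  also have "\<dots> = (LINT r:{..<t}|lborel. cov_integrand r)"
    by (simp add: cov_integrand_def matrix_transpose_mul)
  finally show ?thesis by (simp add: cov_eq matrix_transpose_mul matrix_mul_assoc)
qed

text \<open>The form is the integral over \<open>r < t\<close> of the squared length of the
  transpose of \<open>U 0 r ** B r\<close> applied to \<open>y\<close>. The lower bound on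
  \<open>B\<close> and invertibility of \<open>U\<close> make the integrand positive at every
  \<open>r\<close>, so a zero integral would make a half-line null.\<close>

lemma cov_positive_definite:
  assumes x: "x \<noteq> 0"
  shows "x \<bullet> (cov t *v x) > 0"
proof -
  define y where "y = transpose (U t 0) *v x"
  have y: "y \<noteq> 0" unfolding y_def by (rule det_nz_imp_mult_nz[OF _ x]) (simp add: det_U_nz)
  define q where "q r = y \<bullet> (cov_integrand r *v y)" for r
  have q_pos: "q r > 0" for r
  proof -
    have "B r *v z = 0 \<Longrightarrow> z = 0" for z
      using B_below[of z r] \<mu>0 by (simp add: mult_le_0_iff)
    then have "det (B r) \<noteq> 0"
      by (metis invertible_det_nz invertible_left_inverse matrix_left_invertible_ker)
    then have "det (transpose (U 0 r ** B r)) \<noteq> 0" by (simp add: det_mul det_U_nz)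
    then have "transpose (U 0 r ** B r) *v y \<noteq> 0" using y by (rule det_nz_imp_mult_nz)
    moreover have "y \<bullet> ((C ** transpose C) *v y) = (transpose C *v y) \<bullet> (transpose C *v y)" for C :: "real ^ 'n ^ 'n"
      by (simp only: matrix_vector_mul_assoc[symmetric] inner_matrix_vector_mult[of y])
    ultimately show ?thesis
      unfolding q_def cov_integrand_def by (simp only: inner_gt_zero_iff not_False_eq_True)
  qed
  have q_nz: "q r \<noteq> 0" for r using q_pos[of r] by simp
  have bl: "bounded_linear (\<lambda>M :: real ^ 'n ^ 'n. y \<bullet> (M *v y))"
    by (intro bounded_linear_inner_right_comp bounded_bilinear.bounded_linear_left[OF bounded_bilinear_matrix_vector_mult])
  have int: "set_integrable lborel {..<t} q"
    using integrable_bounded_linear[OF bl] integrands_integrable(2)[of t]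
    unfolding set_integrable_def q_def
    by (force simp: scaleR_matrix_vector_assoc[symmetric])
  have "x \<bullet> (cov t *v x) = y \<bullet> ((LINT r:{..<t}|lborel. cov_integrand r) *v y)"
    unfolding cov_eq matrix_vector_mul_assoc[symmetric] inner_matrix_vector_mult[of x] y_def ..
  also have "\<dots> = (LINT r:{..<t}|lborel. q r)"
    unfolding q_def by (rule set_integral_bounded_linear[OF bl, symmetric]) (rule integrands_integrable)
  also have "\<dots> > 0"
  proof -
    have "(LINT r|lborel. indicator {..<t} r *\<^sub>R q r) \<ge> 0"
      using q_pos by (intro integral_nonneg_AE) (auto simp: indicator_def less_imp_le)
    moreover have "(LINT r|lborel. indicator {..<t} r *\<^sub>R q r) \<noteq> 0"
    proof
      assume "(LINT r|lborel. indicator {..<t} r *\<^sub>R q r) = 0"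
      then have "AE r in lborel. indicator {..<t} r *\<^sub>R q r = 0"
        using int q_pos unfolding set_integrable_def
        by (subst (asm) integral_nonneg_eq_0_iff_AE) (auto simp: indicator_def less_imp_le)
      then have "AE r in lborel. r \<notin> {..<t}"
        by eventually_elim (use q_nz in \<open>auto simp: indicator_def split: if_splits\<close>)
      then have "{..<t} \<in> null_sets lborel" by (subst AE_iff_null_sets) auto
      moreover have "emeasure lborel {t-1<..<t} \<le> emeasure lborel {..<t}" by (rule emeasure_mono) auto
      ultimately show False by (simp add: null_sets_def)
    qed
    ultimately show ?thesis by (simp add: set_lebesgue_integral_def)
  qed
  finally show ?thesis .
qed

lemma det_cov_pos: "det (cov t) > 0"
  by (rule det_pos_if_positive_definite) (rule cov_positive_definite)

end

section \<open>The density of the space-time measure\<close>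

context stable_evolution
begin

definition precision :: "real \<Rightarrow> real ^ 'n ^ 'n" where
  "precision t = matrix_inv (cov t)"

definition \<rho> :: "real \<times> (real ^ 'n) \<Rightarrow> real" where
  "\<rho> z = exp (- ((snd z - mean (fst z)) \<bullet> (precision (fst z) *v (snd z - mean (fst z)))) / 2)
    / sqrt ((2 * pi) ^ CARD('n) * det (cov (fst z)))"

lemma nu_t_eq: "nu_t U B f t = density lborel (\<lambda>x. ennreal (\<rho> (t, x)))"
  by (simp add: nu_t_def gaussian_def \<rho>_def precision_def mean_def cov_def)

lemma \<rho>_pos: "\<rho> z > 0"
  unfolding \<rho>_def by (intro divide_pos_pos) (auto intro!: mult_pos_pos det_cov_pos)

lemma det_cov_nz: "det (cov t) \<noteq> 0"
  using det_cov_pos[of t] by simp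

lemma continuous_on_precision: "continuous_on UNIV precision"
  unfolding precision_def
  by (intro continuous_on_matrix_inv continuous_on_cov det_cov_nz)

lemma continuous_on_\<rho>: "continuous_on UNIV \<rho>"
proof -
  have 1: "continuous_on UNIV (\<lambda>z :: real \<times> (real ^ 'n). mean (fst z))"
    "continuous_on UNIV (\<lambda>z :: real \<times> (real ^ 'n). cov (fst z))"
    "continuous_on UNIV (\<lambda>z :: real \<times> (real ^ 'n). precision (fst z))"
    by (auto intro!: continuous_on_compose2[OF continuous_on_mean] continuous_on_compose2[OF continuous_on_cov]
        continuous_on_compose2[OF continuous_on_precision] continuous_intros)
  show ?thesis
    unfolding \<rho>_def
    by (intro continuous_intros continuous_on_det continuous_on_matrix_vector_mult 1)
       (simp_all add: det_cov_nz)
qed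

lemma measurable_\<rho> [measurable]: "\<rho> \<in> borel_measurable borel"
  by (rule borel_measurable_continuous_onI[OF continuous_on_\<rho>])

lemma transpose_precision: "transpose (precision t) = precision t"
proof -
  have "transpose (precision t) = transpose (precision t) ** (transpose (cov t) ** precision t)"
    using matrix_inv_mult(2)[OF det_cov_nz] by (simp add: transpose_cov precision_def)
  also have "\<dots> = transpose (cov t ** precision t) ** precision t"
    by (simp add: matrix_transpose_mul matrix_mul_assoc)
  also have "\<dots> = precision t"
    using matrix_inv_mult(2)[OF det_cov_nz] by (simp add: precision_def)
  finally show ?thesis .
qed

text \<open>An exact expansion, in which symmetry of the precision matrix merges the two cross
  terms; the vector \<open>precision t\<close> applied to \<open>v\<close> is half the gradient of
  the form.\<close>

lemma quadratic_form_shift: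
  fixes v :: "real ^ 'n" and a :: real
  shows "(v + a *\<^sub>R axis i 1) \<bullet> (precision t *v (v + a *\<^sub>R axis i 1))
    = v \<bullet> (precision t *v v) + 2 * a * (precision t *v v) $ i + a\<^sup>2 * precision t $ i $ i"
proof -
  have "v \<bullet> (precision t *v axis i 1) = (transpose (precision t) *v v) \<bullet> axis i 1"
    by (rule inner_matrix_vector_mult)
  also have "\<dots> = (precision t *v v) $ i"
    unfolding transpose_precision by (simp add: inner_axis)
  finally have 1: "v \<bullet> (precision t *v axis i 1) = (precision t *v v) $ i" .
  have 2: "axis i 1 \<bullet> (precision t *v y) = (precision t *v y) $ i" for y
    by (simp add: inner_axis')
  have 3: "(precision t *v axis i 1) $ i = precision t $ i $ i"
    by (simp add: matrix_vector_mult_basis column_def)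
  show ?thesis
    by (simp add: matrix_vector_right_distrib matrix_vector_mult_scaleR inner_add_left inner_add_right
        1 2 3 power2_eq_square algebra_simps)
qed

text \<open>Where the \<open>i\<close>-th component of the gradient of the exponent is large, moving along the
  \<open>i\<close>-th axis towards the mean increases the density by a large factor.\<close>

lemma \<rho>_tail:
  assumes T: "T > 0"
  shows "\<exists>M. \<forall>L>0. \<exists>R. \<forall>t\<in>{0<..<T}. \<forall>x. norm x > R \<longrightarrow>
    (\<exists>i. \<exists>\<sigma>\<in>{1, -1}. \<forall>s\<in>{0..1}. \<rho> (t, x) \<le> exp (M - s * L) * \<rho> (t, x + (\<sigma> * s) *\<^sub>R axis i 1))"
proof -
  have bd: "\<exists>b>0. \<forall>t\<in>{0..T}. norm (h t) \<le> b" if "continuous_on UNIV h" for h :: "real \<Rightarrow> 'b::real_normed_vector"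
  proof -
    have "bounded (h ` {0..T})"
      using that by (intro compact_imp_bounded compact_continuous_image continuous_on_subset[OF that]) auto
    then show ?thesis unfolding bounded_pos by auto
  qed
  obtain m where m: "m > 0" "\<And>t. t \<in> {0..T} \<Longrightarrow> norm (mean t) \<le> m" using bd[OF continuous_on_mean] by blast
  obtain q where q: "q > 0" "\<And>t. t \<in> {0..T} \<Longrightarrow> norm (cov t) \<le> q" using bd[OF continuous_on_cov] by blast
  obtain p where p: "p > 0" "\<And>t. t \<in> {0..T} \<Longrightarrow> norm (precision t) \<le> p" using bd[OF continuous_on_precision] by blast
  obtain K where K: "K > 0" "\<And>(M :: real ^ 'n ^ 'n) (x :: real ^ 'n). norm (M *v x) \<le> norm M * norm x * K"
    using bounded_bilinear.pos_bounded[OF bounded_bilinear_matrix_vector_mult] by blast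
  have "\<exists>i. \<exists>\<sigma>\<in>{1, -1}. \<forall>s\<in>{0..1}. \<rho> (t, x) \<le> exp (p - s * L) * \<rho> (t, x + (\<sigma> * s) *\<^sub>R axis i 1)"
    if L: "L > 0" and t: "t \<in> {0<..<T}" and x: "norm x > m + q * (real CARD('n) * L) * K" for L t x
  proof -
    have t': "t \<in> {0..T}" using t by simp
    define v where "v = x - mean t"
    define y where "y = precision t *v v"
    \<comment> \<open>If all components were at most \<open>L\<close>, then \<open>v\<close>, the
      covariance applied to \<open>y\<close>, would be too short for \<open>x\<close> to lie beyond
      the radius; this dictates the radius.\<close>
    have "\<exists>i. \<bar>y $ i\<bar> > L"
    proof (rule ccontr)
      assume "\<not> (\<exists>i. \<bar>y $ i\<bar> > L)"
      then have "(\<Sum>i\<in>UNIV. \<bar>y $ i\<bar>) \<le> (\<Sum>i\<in>(UNIV::'n set). L)" by (intro sum_mono) (auto simp: not_less)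
      then have y: "norm y \<le> real CARD('n) * L" using norm_le_l1_cart[of y] by simp
      have "v = cov t *v y"
        using det_cov_pos[of t] by (simp add: y_def matrix_vector_mul_assoc precision_def matrix_inv_mult)
      then have "norm v \<le> norm (cov t) * norm y * K" using K by simp
      also have "\<dots> \<le> q * (real CARD('n) * L) * K"
        using K q(1) by (intro mult_right_mono mult_mono q(2)[OF t'] y) auto
      finally have "norm x \<le> m + q * (real CARD('n) * L) * K"
        using m(2)[OF t'] norm_triangle_ineq[of v "mean t"] by (simp add: v_def)
      then show False using x by simp
    qed
    then obtain i where i: "\<bar>y $ i\<bar> > L" by blast
    \<comment> \<open>The step goes against the sign of \<open>y $ i\<close>, that is, initially
      down the quadratic form.\<close>
    define \<sigma> :: real where "\<sigma> = (if y $ i > 0 then -1 else 1)"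
    have \<sigma>: "\<sigma> \<in> {1, -1}" "\<sigma> * y $ i = - \<bar>y $ i\<bar>" "\<sigma>\<^sup>2 = 1" by (auto simp: \<sigma>_def)
    have "\<rho> (t, x) \<le> exp (p - s * L) * \<rho> (t, x + (\<sigma> * s) *\<^sub>R axis i 1)" if s: "s \<in> {0..1}" for s
    proof -
      define N where "N = sqrt ((2 * pi) ^ CARD('n) * det (cov t))"
      have N: "N > 0" using det_cov_pos[of t] by (simp add: N_def)
      define Q where "Q = v \<bullet> (precision t *v v)"
      have "\<bar>precision t $ i $ i\<bar> \<le> norm (precision t $ i)" by (rule component_le_norm_cart)
      also have "\<dots> \<le> norm (precision t)" by (rule Finite_Cartesian_Product.norm_nth_le)
      finally have pii: "\<bar>precision t $ i $ i\<bar> \<le> p" using p(2)[OF t'] by simp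
      have "s\<^sup>2 * precision t $ i $ i \<le> s\<^sup>2 * p"
        using pii by (intro mult_left_mono) auto
      also have "s\<^sup>2 * p \<le> 1 * p"
        using s p(1) by (intro mult_right_mono) (auto simp: power_le_one)
      finally have 1: "s\<^sup>2 * precision t $ i $ i \<le> p" by simp
      have 2: "s * L \<le> s * \<bar>y $ i\<bar>" using s i by (intro mult_left_mono) auto
      have "2 * (\<sigma> * s) * y $ i = 2 * (s * (\<sigma> * y $ i))" by simp
      then have 3: "2 * (\<sigma> * s) * y $ i = - (2 * (s * \<bar>y $ i\<bar>))" unfolding \<sigma>(2) by simp
      have 4: "(\<sigma> * s)\<^sup>2 = s\<^sup>2" by (simp add: power_mult_distrib \<sigma>)
      \<comment> \<open>The exponent gains \<open>s\<close> times the size of \<open>y $ i\<close>,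
        at least \<open>s * L\<close>, and loses half of the second-order term, which is at most
        \<open>p\<close>; so \<open>p\<close> serves as the slack \<open>M\<close>.\<close>
      have "- Q / 2 \<le> (p - s * L) + - (Q + 2 * (\<sigma> * s) * y $ i + (\<sigma> * s)\<^sup>2 * precision t $ i $ i) / 2"
      proof -
        have "- Q / 2 \<le> (p - c) + - (Q + - (2 * d) + e) / 2" if "e \<le> p" "c \<le> d" for c d e
          using that p(1) by (simp add: field_simps)
        from this[OF 1 2] show ?thesis unfolding 3 4 .
      qed
      then have "exp (- Q / 2) / N \<le> exp (p - s * L) * exp (- (Q + 2 * (\<sigma> * s) * y $ i + (\<sigma> * s)\<^sup>2 * precision t $ i $ i) / 2) / N"
        using N by (intro divide_right_mono) (auto simp: exp_add[symmetric])
      moreover have "\<rho> (t, x) = exp (- Q / 2) / N" by (simp add: \<rho>_def Q_def v_def N_def)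
      moreover have "\<rho> (t, x + (\<sigma> * s) *\<^sub>R axis i 1) = exp (- (Q + 2 * (\<sigma> * s) * y $ i + (\<sigma> * s)\<^sup>2 * precision t $ i $ i) / 2) / N"
      proof -
        have "x + (\<sigma> * s) *\<^sub>R axis i 1 - mean t = v + (\<sigma> * s) *\<^sub>R axis i 1" by (simp add: v_def)
        then show ?thesis by (simp only: \<rho>_def fst_conv snd_conv quadratic_form_shift Q_def y_def N_def)
      qed
      ultimately show ?thesis by simp
    qed
    then show ?thesis using \<sigma>(1) by blast
  qed
  then show ?thesis by blast
qed

lemma periodic_weight_\<rho>:
  assumes "T > 0"
  obtains M where "periodic_weight \<rho> T M"
proof -
  from \<rho>_tail[OF assms] obtain M where "\<forall>L>0. \<exists>R. \<forall>t\<in>{0<..<T}. \<forall>x. norm x > R \<longrightarrow>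
    (\<exists>i. \<exists>\<sigma>\<in>{1, -1}. \<forall>s\<in>{0..1}. \<rho> (t, x) \<le> exp (M - s * L) * \<rho> (t, x + (\<sigma> * s) *\<^sub>R axis i 1))"
    by blast
  then have "periodic_weight \<rho> T M"
    using assms continuous_on_\<rho> \<rho>_pos by unfold_locales blast+
  then show ?thesis by (rule that)
qed

text \<open>The defining property of \<open>\<nu>\<close> fixes its values on products only.
  Products form an intersection-stable generator, Fubini computes the same values for the density,
  and compact products of finite measure exhaust the space.\<close>

lemma space_time_measure_eq:
  assumes \<nu>: "is_space_time_measure (nu_t U B f) \<nu>"
  shows "\<nu> = density lborel (\<lambda>z. ennreal (\<rho> z))"
proof -
  let ?E = "{I \<times> K |I K. I \<in> sets (borel :: real measure) \<and> K \<in> sets (borel :: (real ^ 'n) measure)}"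
  let ?D = "density lborel (\<lambda>z. ennreal (\<rho> z))"
  let ?A = "\<lambda>i::nat. {- real i..real i} \<times> cball (0 :: real ^ 'n) (real i)"
  have eq: "emeasure \<nu> (I \<times> K) = emeasure ?D (I \<times> K)"
    if [measurable]: "I \<in> sets borel" "K \<in> sets borel" for I K
  proof -
    have [measurable]: "I \<times> K \<in> sets borel"
      unfolding borel_prod[symmetric] by measurable
    have "emeasure ?D (I \<times> K) = (\<integral>\<^sup>+z. ennreal (\<rho> z) * indicator (I \<times> K) z \<partial>(lborel \<Otimes>\<^sub>M lborel))"
      by (subst emeasure_density) (auto simp: lborel_prod)
    also have "\<dots> = (\<integral>\<^sup>+t. \<integral>\<^sup>+x. ennreal (\<rho> (t, x)) * indicator (I \<times> K) (t, x) \<partial>lborel \<partial>lborel)"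
      by (rule lborel.nn_integral_fst[symmetric]) (simp add: lborel_prod)
    also have "\<dots> = (\<integral>\<^sup>+t\<in>I. emeasure (nu_t U B f t) K \<partial>lborel)"
    proof (rule nn_integral_cong)
      fix t
      have "(\<integral>\<^sup>+x. ennreal (\<rho> (t, x)) * indicator (I \<times> K) (t, x) \<partial>lborel)
        = (\<integral>\<^sup>+x. ennreal (\<rho> (t, x)) * indicator K x * indicator I t \<partial>lborel)"
        by (intro nn_integral_cong) (auto simp: indicator_def)
      also have "\<dots> = (\<integral>\<^sup>+x. ennreal (\<rho> (t, x)) * indicator K x \<partial>lborel) * indicator I t"
        by (rule nn_integral_multc) measurable
      finally show "(\<integral>\<^sup>+x. ennreal (\<rho> (t, x)) * indicator (I \<times> K) (t, x) \<partial>lborel)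
        = emeasure (nu_t U B f t) K * indicator I t"
        by (simp add: nu_t_eq emeasure_density)
    qed
    finally show ?thesis
      using \<nu> that by (simp add: is_space_time_measure_def)
  qed
  show ?thesis
  proof (rule measure_eqI_generator_eq[where E = ?E and \<Omega> = UNIV and A = ?A])
    show "Int_stable ?E"
      by (rule Int_stable_pair_measure_generator)
    have "sets (borel :: (real \<times> (real ^ 'n)) measure) = sigma_sets UNIV ?E"
      unfolding borel_prod[symmetric] by (simp add: sets_pair_measure)
    then show "sets \<nu> = sigma_sets UNIV ?E" "sets ?D = sigma_sets UNIV ?E"
      using \<nu> by (auto simp: is_space_time_measure_def)
    show "range ?A \<subseteq> ?E"
    proof (rule image_subsetI)
      show "?A i \<in> ?E" for i by (intro CollectI exI conjI refl) auto
    qed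
    show "(\<Union>i. ?A i) = UNIV"
    proof safe
      fix t :: real and x :: "real ^ 'n"
      obtain i :: nat where "max \<bar>t\<bar> (norm x) \<le> real i" using real_arch_simple by blast
      then show "(t, x) \<in> (\<Union>i. ?A i)" by (intro UN_I[of i]) (auto simp: abs_le_iff)
    qed auto
    fix i
    have c: "compact (?A i)" by (intro compact_Times) auto
    have "bounded (\<rho> ` ?A i)"
      by (intro compact_imp_bounded compact_continuous_image c continuous_on_subset[OF continuous_on_\<rho>]) auto
    then obtain b where b: "\<And>z. z \<in> ?A i \<Longrightarrow> \<rho> z \<le> b"
      unfolding bounded_iff by (metis abs_le_D1 imageI real_norm_def)
    have [measurable]: "?A i \<in> sets borel" using c by (rule borel_compact)
    have "emeasure ?D (?A i) = (\<integral>\<^sup>+z. ennreal (\<rho> z) * indicator (?A i) z \<partial>lborel)"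
      by (rule emeasure_density) auto
    also have "\<dots> \<le> (\<integral>\<^sup>+z. ennreal b * indicator (?A i) z \<partial>lborel)"
      using b by (intro nn_integral_mono) (auto simp: indicator_def intro: ennreal_leI)
    also have "\<dots> = ennreal b * emeasure lborel (?A i)" by (simp add: nn_integral_cmult)
    also have "\<dots> < \<infinity>" using emeasure_compact_finite[OF c] by (simp add: ennreal_mult_less_top)
    finally show "emeasure \<nu> (?A i) \<noteq> \<infinity>" by (subst eq) auto
  qed (use eq in auto)
qed

end

section \<open>The compact embedding\<close>

locale parabolic_sobolev = stable_evolution A B f U \<mu>0
  for A B :: "real \<Rightarrow> real ^ 'n ^ 'n"
    and f :: "real \<Rightarrow> real ^ 'n"
    and U :: "real \<Rightarrow> real \<Rightarrow> real ^ 'n ^ 'n"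
    and \<mu>0 :: real +
  fixes T M :: real and \<nu> :: "(real \<times> (real ^ 'n)) measure"
  assumes weight: "periodic_weight \<rho> T M"
    and \<nu>: "is_space_time_measure (nu_t U B f) \<nu>"
begin

sublocale periodic_weight \<rho> T M by (rule weight)

text \<open>The common value of two integrals in the definitions of the spaces: the one with respect
  to \<open>\<nu>\<close> in the membership condition and the iterated one with respect to
  \<open>nu_t\<close> in the norm.\<close>

definition sq_int :: "(real \<times> (real ^ 'n) \<Rightarrow> real) \<Rightarrow> ennreal" where
  "sq_int u = square_integral period_weight u"

lemma sq_int_cong: "AE z in lebesgue. u z = v z \<Longrightarrow> sq_int u = sq_int v"
  unfolding sq_int_def AE_completion_iff
  by (rule nn_integral_cong_AE) (auto elim!: eventually_mono)

lemma nn_integral_nu: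
  assumes "u \<in> borel_measurable lebesgue"
  shows "(\<integral>\<^sup>+z\<in>{0<..<T} \<times> UNIV. ennreal ((u z)\<^sup>2) \<partial>\<nu>) = sq_int u"
proof -
  obtain u' where [measurable]: "u' \<in> borel_measurable borel" and u': "AE z in lebesgue. u z = u' z"
    using lebesgue_ex_borel_representative[OF assms] by blast
  have AE: "AE z in \<nu>. u z = u' z"
    unfolding space_time_measure_eq[OF \<nu>]
    by (subst AE_density) (use u' in \<open>auto simp: AE_completion_iff elim!: eventually_mono\<close>)
  have "(\<integral>\<^sup>+z\<in>{0<..<T} \<times> UNIV. ennreal ((u z)\<^sup>2) \<partial>\<nu>) = (\<integral>\<^sup>+z\<in>{0<..<T} \<times> UNIV. ennreal ((u' z)\<^sup>2) \<partial>\<nu>)"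
    by (rule nn_integral_cong_AE) (use AE in \<open>auto elim!: eventually_mono\<close>)
  also have "\<dots> = (\<integral>\<^sup>+z. ennreal (\<rho> z) * (ennreal ((u' z)\<^sup>2) * indicator ({0<..<T} \<times> UNIV) z) \<partial>lborel)"
    unfolding space_time_measure_eq[OF \<nu>] by (rule nn_integral_density) measurable
  also have "\<dots> = sq_int u'"
    unfolding sq_int_def period_weight_def by (intro nn_integral_cong) (simp add: mult_ac)
  also have "\<dots> = sq_int u" by (rule sq_int_cong[OF u', symmetric])
  finally show ?thesis .
qed

text \<open>The slices of a Lebesgue measurable \<open>u\<close> need not all be measurable; for
  almost every \<open>t\<close> they agree almost everywhere with those of a Borel representative,
  which suffices for the iterated integral.\<close>

lemma L2_per_norm_eq:
  assumes "u \<in> borel_measurable lebesgue"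
  shows "L2_per_norm T (nu_t U B f) u = sqrt (1 / T * enn2real (sq_int u))"
proof -
  obtain u' where [measurable]: "u' \<in> borel_measurable borel" and u': "AE z in lebesgue. u z = u' z"
    using lebesgue_ex_borel_representative[OF assms] by blast
  have "AE z in lborel \<Otimes>\<^sub>M lborel. u z = u' z"
    unfolding lborel_prod using u' by (simp add: AE_completion_iff)
  from lborel_pair.AE_pair[OF this] have "AE t in lborel. AE x in lborel. u (t, x) = u' (t, x)" .
  then have "AE t in lborel. (\<integral>\<^sup>+x. ennreal ((u (t, x))\<^sup>2) \<partial>nu_t U B f t) = (\<integral>\<^sup>+x. ennreal (\<rho> (t, x)) * ennreal ((u' (t, x))\<^sup>2) \<partial>lborel)"
  proof eventually_elim
    case (elim t)
    have "AE x in nu_t U B f t. u (t, x) = u' (t, x)"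
      unfolding nu_t_eq by (subst AE_density) (use elim in \<open>auto elim!: eventually_mono\<close>)
    then have "(\<integral>\<^sup>+x. ennreal ((u (t, x))\<^sup>2) \<partial>nu_t U B f t) = (\<integral>\<^sup>+x. ennreal ((u' (t, x))\<^sup>2) \<partial>nu_t U B f t)"
      by (intro nn_integral_cong_AE) (auto elim!: eventually_mono)
    also have "\<dots> = (\<integral>\<^sup>+x. ennreal (\<rho> (t, x)) * ennreal ((u' (t, x))\<^sup>2) \<partial>lborel)"
      unfolding nu_t_eq by (rule nn_integral_density) measurable
    finally show ?case .
  qed
  then have "(\<integral>\<^sup>+t\<in>{0<..<T}. (\<integral>\<^sup>+x. ennreal ((u (t, x))\<^sup>2) \<partial>nu_t U B f t) \<partial>lborel)
    = (\<integral>\<^sup>+t\<in>{0<..<T}. (\<integral>\<^sup>+x. ennreal (\<rho> (t, x)) * ennreal ((u' (t, x))\<^sup>2) \<partial>lborel) \<partial>lborel)"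
    by (intro nn_integral_cong_AE) (auto elim!: eventually_mono)
  also have "\<dots> = (\<integral>\<^sup>+t. \<integral>\<^sup>+x. period_weight (t, x) * ennreal ((u' (t, x))\<^sup>2) \<partial>lborel \<partial>lborel)"
    by (intro nn_integral_cong) (auto simp: period_weight_def indicator_def)
  also have "\<dots> = (\<integral>\<^sup>+z. period_weight z * ennreal ((u' z)\<^sup>2) \<partial>(lborel \<Otimes>\<^sub>M lborel))"
    by (rule lborel.nn_integral_fst) (simp add: lborel_prod)
  also have "\<dots> = sq_int u'" by (simp add: sq_int_def lborel_prod)
  also have "\<dots> = sq_int u" by (rule sq_int_cong[OF u', symmetric])
  finally show ?thesis by (simp add: L2_per_norm_def)
qed

lemma L2_per_iff:
  "u \<in> L2_per T \<nu> \<longleftrightarrow> u \<in> borel_measurable lebesgue \<and> (AE z in lborel. u (z + (T, 0)) = u z) \<and> sq_int u < \<infinity>"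
proof -
  have "(AE z in lebesgue. u z = u (fst z + T, snd z)) \<longleftrightarrow> (AE z in lborel. u (z + (T, 0)) = u z)"
    unfolding AE_completion_iff by (intro AE_cong) (auto simp: plus_prod_def)
  then show ?thesis using nn_integral_nu[of u] by (auto simp: L2_per_def)
qed

lemma L2_per_cong_AE:
  assumes "AE z in lebesgue. u z = v z" "u \<in> borel_measurable lebesgue" "v \<in> L2_per T \<nu>"
  shows "u \<in> L2_per T \<nu>"
proof -
  have eq: "AE z in lborel. u z = v z" using assms(1) by (simp add: AE_completion_iff)
  have "AE z in lborel. v (z + (T, 0)) = v z" using assms(3) by (simp add: L2_per_iff)
  with eq AE_lborel_translate[OF eq, of "(T, 0)"] have "AE z in lborel. u (z + (T, 0)) = u z"
    by eventually_elim simp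
  then show ?thesis using assms sq_int_cong[OF assms(1)] by (simp add: L2_per_iff)
qed

lemma finite_parabolic_directions: "finite (parabolic_directions :: (real \<times> (real ^ 'n)) list set)"
  by (simp add: parabolic_directions_def)

text \<open>\<open>weak_deriv\<close> is a choice and need not be the witness from the definition of
  the space; uniqueness up to null sets transfers membership. The last bound undoes the root and the
  factor \<open>1 / T\<close> in the norm.\<close>

lemma weak_deriv_H12:
  assumes "u \<in> H12_per T \<nu>" "vs \<in> parabolic_directions"
  shows "has_weak_deriv vs u (weak_deriv vs u)" "weak_deriv vs u \<in> L2_per T \<nu>"
    and "L2_per_norm T (nu_t U B f) (weak_deriv vs u) \<le> H12_per_norm T (nu_t U B f) u"
    and "sq_int (weak_deriv vs u) \<le> ennreal (T * (H12_per_norm T (nu_t U B f) u)\<^sup>2)"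
proof -
  obtain w where w: "has_weak_deriv vs u w" "w \<in> L2_per T \<nu>"
    using assms by (auto simp: H12_per_def)
  show 1: "has_weak_deriv vs u (weak_deriv vs u)"
    unfolding weak_deriv_def by (rule someI[of "has_weak_deriv vs u" w, OF w(1)])
  have meas: "weak_deriv vs u \<in> borel_measurable lebesgue"
    using 1 by (auto simp: has_weak_deriv_def intro: locally_integrable_measurable)
  show 2: "weak_deriv vs u \<in> L2_per T \<nu>"
    by (rule L2_per_cong_AE[OF has_weak_deriv_unique[OF 1 w(1)] meas w(2)])
  let ?n = "\<lambda>vs. L2_per_norm T (nu_t U B f) (weak_deriv vs u)"
  have "(?n vs)\<^sup>2 \<le> (\<Sum>vs\<in>parabolic_directions. (?n vs)\<^sup>2)"
    using assms(2) finite_parabolic_directions by (intro member_le_sum) auto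
  then have "sqrt ((?n vs)\<^sup>2) \<le> H12_per_norm T (nu_t U B f) u"
    unfolding H12_per_norm_def by (rule real_sqrt_le_mono)
  then show 3: "?n vs \<le> H12_per_norm T (nu_t U B f) u" by simp
  have "1 / T * enn2real (sq_int (weak_deriv vs u)) = (?n vs)\<^sup>2"
    using T_pos by (simp add: L2_per_norm_eq[OF meas])
  also have "\<dots> \<le> (H12_per_norm T (nu_t U B f) u)\<^sup>2"
    using 3 T_pos by (intro power_mono) (simp_all add: L2_per_norm_eq[OF meas])
  finally have "enn2real (sq_int (weak_deriv vs u)) \<le> T * (H12_per_norm T (nu_t U B f) u)\<^sup>2"
    using T_pos by (simp add: field_simps)
  \<comment> \<open>\<open>enn2real\<close> sends infinity to 0, so the real bound counts only
    together with finiteness, which membership in the space supplies.\<close>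
  then show "sq_int (weak_deriv vs u) \<le> ennreal (T * (H12_per_norm T (nu_t U B f) u)\<^sup>2)"
    using 2 by (auto simp: L2_per_iff ennreal_enn2real_if dest: ennreal_leI split: if_splits)
qed

lemma weak_deriv_Nil_AE:
  assumes "u \<in> H12_per T \<nu>"
  shows "AE z in lebesgue. u z = weak_deriv [] u z" "u \<in> borel_measurable lebesgue"
proof -
  have 1: "has_weak_deriv [] u (weak_deriv [] u)"
    by (rule weak_deriv_H12(1)[OF assms]) (simp add: parabolic_directions_def)
  show "AE z in lebesgue. u z = weak_deriv [] u z"
    using has_weak_deriv_Nil[OF 1] by eventually_elim simp
  show "u \<in> borel_measurable lebesgue"
    using 1 by (auto simp: has_weak_deriv_def intro: locally_integrable_measurable)
qed

lemma Basis_parabolic: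
  assumes "b \<in> (Basis :: (real \<times> (real ^ 'n)) set)"
  shows "[b] \<in> parabolic_directions"
  using assms by (auto simp: Basis_prod_def Basis_vec_def parabolic_directions_def)

text \<open>Compactness is applied to Borel representatives of the sequence and of its first
  derivatives; bounds, periodicity and convergence do not see the change on null sets.\<close>

lemma H12_bounded_sequence:
  fixes u :: "nat \<Rightarrow> real \<times> (real ^ 'n) \<Rightarrow> real"
  assumes u: "\<And>k. u k \<in> H12_per T \<nu>" and bd: "\<And>k. H12_per_norm T (nu_t U B f) (u k) \<le> C"
  shows "\<exists>r v. strict_mono r \<and> v \<in> L2_per T \<nu> \<and>
    (\<lambda>k. L2_per_norm T (nu_t U B f) (\<lambda>z. u (r k) z - v z)) \<longlonglongrightarrow> 0"
proof -
  define K where "K = T * C\<^sup>2"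
  have K: "K \<ge> 0" using T_pos by (simp add: K_def)
  have sq_bd: "sq_int (weak_deriv vs (u k)) \<le> ennreal K" if "vs \<in> parabolic_directions" for vs k
  proof -
    have "0 \<le> H12_per_norm T (nu_t U B f) (u k)" by (simp add: H12_per_norm_def sum_nonneg)
    then have "T * (H12_per_norm T (nu_t U B f) (u k))\<^sup>2 \<le> K"
      unfolding K_def using bd T_pos by (intro mult_left_mono power_mono) auto
    then show ?thesis
      using weak_deriv_H12(4)[OF u that, of k] by (auto elim!: order_trans intro!: ennreal_leI)
  qed
  have "\<exists>u'. u' \<in> borel_measurable borel \<and> (AE z in lebesgue. u k z = u' z)" for k
    using lebesgue_ex_borel_representative[OF weak_deriv_Nil_AE(2)[OF u]] by metis
  then obtain u' where u': "\<And>k. u' k \<in> borel_measurable borel" "\<And>k. AE z in lebesgue. u k z = u' k z"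
    by metis
  note [measurable] = u'(1) weak_deriv_Nil_AE(2)[OF u]
  have ex: "\<exists>w. w \<in> borel_measurable borel \<and> (AE z in lebesgue. weak_deriv [b] (u k) z = w z)"
    if "b \<in> Basis" for k and b :: "real \<times> (real ^ 'n)"
  proof -
    have "weak_deriv [b] (u k) \<in> borel_measurable lebesgue"
      using weak_deriv_H12(2)[OF u Basis_parabolic[OF that], of k] by (simp add: L2_per_iff)
    from lebesgue_ex_borel_representative[OF this] show ?thesis by metis
  qed
  define w where "w k b = (SOME g. g \<in> borel_measurable borel \<and> (AE z in lebesgue. weak_deriv [b] (u k) z = g z))" for k b
  have w: "w k b \<in> borel_measurable borel" "AE z in lebesgue. weak_deriv [b] (u k) z = w k b z" if "b \<in> Basis" for k b
    using someI_ex[OF ex[OF that, of k]] unfolding w_def by auto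
  have Nil: "[] \<in> parabolic_directions" by (simp add: parabolic_directions_def)
  have u'_wd: "AE z in lebesgue. u' k z = weak_deriv [] (u k) z" for k
    using u'(2)[of k] weak_deriv_Nil_AE(1)[OF u[of k]] by eventually_elim simp
  have u'_leb: "u' k \<in> borel_measurable lebesgue" for k
    by (rule measurable_completion) simp
  have w_leb: "w k b \<in> borel_measurable lebesgue" if "b \<in> Basis" for k b
    by (rule measurable_completion) (simp add: w(1)[OF that])
  have u'_L2: "u' k \<in> L2_per T \<nu>" for k
    by (rule L2_per_cong_AE[OF u'_wd u'_leb weak_deriv_H12(2)[OF u Nil]])
  have w_L2: "w k b \<in> L2_per T \<nu>" if b: "b \<in> Basis" for k b
    by (rule L2_per_cong_AE[OF _ w_leb[OF b] weak_deriv_H12(2)[OF u Basis_parabolic[OF b], of k]])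
      (use w(2)[OF b, of k] in \<open>auto elim: eventually_mono\<close>)
  have "\<exists>r. strict_mono (r :: nat \<Rightarrow> nat) \<and>
    (\<lambda>k. \<integral>\<^sup>+z. period_weight z * ennreal ((u' (r k) z - lim (\<lambda>j. u' (r j) z))\<^sup>2) \<partial>lborel) \<longlonglongrightarrow> 0"
  proof (rule compactness[of u' w K])
    show "has_weak_deriv [b] (u' k) (w k b)" if b: "b \<in> Basis" for k b
      by (rule has_weak_deriv_cong_AE[OF weak_deriv_H12(1)[OF u Basis_parabolic[OF b]] _ u'(2) u'_leb w(2)[OF b] w_leb[OF b]])
         (use b in simp)
    show "AE z in lborel. u' k (z + (T, 0)) = u' k z" for k
      using u'_L2[of k] by (simp add: L2_per_iff)
    show "AE z in lborel. w k b (z + (T, 0)) = w k b z" if "b \<in> Basis" for k b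
      using w_L2[OF that, of k] by (simp add: L2_per_iff)
    show "square_integral period_weight (u' k) \<le> ennreal K" for k
      using sq_bd[OF Nil, of k] unfolding sq_int_cong[OF u'_wd, symmetric] by (simp add: sq_int_def)
    show "square_integral period_weight (w k b) \<le> ennreal K" if "b \<in> Basis" for k b
      using sq_bd[OF Basis_parabolic[OF that], of k] unfolding sq_int_cong[OF w(2)[OF that]] by (simp add: sq_int_def)
  qed (use u' w K in auto)
  then obtain r :: "nat \<Rightarrow> nat" where r: "strict_mono r"
    "(\<lambda>k. \<integral>\<^sup>+z. period_weight z * ennreal ((u' (r k) z - lim (\<lambda>j. u' (r j) z))\<^sup>2) \<partial>lborel) \<longlonglongrightarrow> 0"
    by blast
  define v where "v z = lim (\<lambda>j. u' (r j) z)" for z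
  have [measurable]: "v \<in> borel_measurable borel" unfolding v_def by measurable
  have conv: "(\<lambda>k. sq_int (\<lambda>z. u' (r k) z - v z)) \<longlonglongrightarrow> 0"
    using r(2) by (simp add: sq_int_def v_def)
  have "v \<in> L2_per T \<nu>"
    unfolding L2_per_iff
  proof (intro conjI)
    show "v \<in> borel_measurable lebesgue" by (simp add: measurable_completion)
    \<comment> \<open>Off a countable union of null sets all terms are periodic. \<open>lim\<close>
      is total, so equal sequences have equal limits even where they diverge.\<close>
    have "AE z in lborel. \<forall>j. u' (r j) (z + (T, 0)) = u' (r j) z"
      using u'_L2 by (subst AE_all_countable) (simp add: L2_per_iff)
    then show "AE z in lborel. v (z + (T, 0)) = v z"
      by eventually_elim (simp add: v_def)
    have "\<forall>\<^sub>F k in sequentially. sq_int (\<lambda>z. u' (r k) z - v z) < 1"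
      using conv by (rule order_tendstoD(2)) simp
    then obtain k where k: "sq_int (\<lambda>z. u' (r k) z - v z) < 1"
      by (auto simp: eventually_sequentially)
    \<comment> \<open>One square integrable term at finite distance from \<open>v\<close> suffices
      to make \<open>v\<close> square integrable.\<close>
    have "sq_int v = square_integral period_weight (\<lambda>z. 0 - v z)" by (simp add: sq_int_def)
    also have "\<dots> \<le> 2 * square_integral period_weight (\<lambda>z. 0 - u' (r k) z)
        + 2 * square_integral period_weight (\<lambda>z. u' (r k) z - v z)"
      by (rule nn_integral_square_diff_le) measurable
    also have "\<dots> = 2 * sq_int (u' (r k)) + 2 * sq_int (\<lambda>z. u' (r k) z - v z)" by (simp add: sq_int_def)
    also have "\<dots> < \<infinity>"
    proof -
      have "sq_int (\<lambda>z. u' (r k) z - v z) \<noteq> top" "sq_int (u' (r k)) \<noteq> top"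
        using k u'_L2[of "r k"] by (auto simp: L2_per_iff)
      then show ?thesis by (simp add: less_top[symmetric] ennreal_mult_eq_top_iff)
    qed
    finally show "sq_int v < \<infinity>" .
  qed
  moreover have "(\<lambda>k. L2_per_norm T (nu_t U B f) (\<lambda>z. u (r k) z - v z)) \<longlonglongrightarrow> 0"
  proof -
    have eq: "L2_per_norm T (nu_t U B f) (\<lambda>z. u (r k) z - v z) = sqrt (1 / T * enn2real (sq_int (\<lambda>z. u' (r k) z - v z)))" for k
    proof -
      have [measurable]: "v \<in> borel_measurable lebesgue" by (simp add: measurable_completion)
      have "sq_int (\<lambda>z. u (r k) z - v z) = sq_int (\<lambda>z. u' (r k) z - v z)"
        by (rule sq_int_cong) (use u'(2)[of "r k"] in \<open>auto elim!: eventually_mono\<close>)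
      then show ?thesis by (subst L2_per_norm_eq) auto
    qed
    have "(\<lambda>k. enn2real (sq_int (\<lambda>z. u' (r k) z - v z))) \<longlonglongrightarrow> 0"
      by (rule tendsto_enn2real) (use conv in simp_all)
    then have "(\<lambda>k. sqrt (1 / T * enn2real (sq_int (\<lambda>z. u' (r k) z - v z)))) \<longlonglongrightarrow> sqrt (1 / T * 0)"
      by (intro tendsto_real_sqrt tendsto_mult tendsto_const)
    then show ?thesis by (simp add: eq)
  qed
  ultimately show ?thesis using r(1) by blast
qed

lemma H12_compactly_embedded:
  "compactly_embedded (H12_per T \<nu>) (H12_per_norm T (nu_t U B f)) (L2_per T \<nu>) (L2_per_norm T (nu_t U B f))"
  unfolding compactly_embedded_def
proof (intro conjI)
  have Nil: "[] \<in> parabolic_directions" by (simp add: parabolic_directions_def)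
  have in_L2: "u \<in> L2_per T \<nu>" if u: "u \<in> H12_per T \<nu>" for u
    by (rule L2_per_cong_AE[OF weak_deriv_Nil_AE[OF u] weak_deriv_H12(2)[OF u Nil]])
  then show "H12_per T \<nu> \<subseteq> L2_per T \<nu>" by blast
  have "L2_per_norm T (nu_t U B f) u \<le> 1 * H12_per_norm T (nu_t U B f) u" if u: "u \<in> H12_per T \<nu>" for u
  proof -
    have "L2_per_norm T (nu_t U B f) u = L2_per_norm T (nu_t U B f) (weak_deriv [] u)"
      using in_L2[OF u] weak_deriv_H12(2)[OF u Nil] sq_int_cong[OF weak_deriv_Nil_AE(1)[OF u]]
      by (simp add: L2_per_norm_eq L2_per_iff)
    then show ?thesis using weak_deriv_H12(3)[OF u Nil] by simp
  qed
  then show "\<exists>C. \<forall>u\<in>H12_per T \<nu>. L2_per_norm T (nu_t U B f) u \<le> C * H12_per_norm T (nu_t U B f) u"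
    by blast
  show "\<forall>u :: nat \<Rightarrow> real \<times> (real ^ 'n) \<Rightarrow> real. (\<forall>k. u k \<in> H12_per T \<nu>) \<and> (\<exists>C. \<forall>k. H12_per_norm T (nu_t U B f) (u k) \<le> C) \<longrightarrow>
    (\<exists>r v. strict_mono r \<and> v \<in> L2_per T \<nu> \<and>
      (\<lambda>k. L2_per_norm T (nu_t U B f) (\<lambda>z. u (r k) z - v z)) \<longlonglongrightarrow> 0)"
  proof (intro allI impI)
    fix u :: "nat \<Rightarrow> real \<times> (real ^ 'n) \<Rightarrow> real"
    assume u: "(\<forall>k. u k \<in> H12_per T \<nu>) \<and> (\<exists>C. \<forall>k. H12_per_norm T (nu_t U B f) (u k) \<le> C)"
    then obtain C where "\<And>k. H12_per_norm T (nu_t U B f) (u k) \<le> C" by blast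
    with u show "\<exists>r v. strict_mono r \<and> v \<in> L2_per T \<nu> \<and>
        (\<lambda>k. L2_per_norm T (nu_t U B f) (\<lambda>z. u (r k) z - v z)) \<longlonglongrightarrow> 0"
      by (intro H12_bounded_sequence) auto
  qed
qed

end

theorem proposition5p2:
  fixes A B :: "real \<Rightarrow> real ^ 'n ^ 'n"
    and f :: "real \<Rightarrow> real ^ 'n"
    and U :: "real \<Rightarrow> real \<Rightarrow> real ^ 'n ^ 'n"
    and \<nu> :: "(real \<times> (real ^ 'n)) measure"
    and \<mu>0 T :: real
  assumes "continuous_on UNIV A" "bounded (range A)"
    and "continuous_on UNIV B" "bounded (range B)"
    and "continuous_on UNIV f" "bounded (range f)"
    and "\<mu>0 > 0" "\<And>t x. norm (B t *v x) \<ge> \<mu>0 * norm x"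
    and "evolution_family A U"
    and "growth_bound U < 0"
    and "is_space_time_measure (nu_t U B f) \<nu>"
    and "T > 0"
    and "\<And>t. A (t + T) = A t" "\<And>t. B (t + T) = B t" "\<And>t. f (t + T) = f t"
  shows "compactly_embedded (H12_per T \<nu>) (H12_per_norm T (nu_t U B f))
                            (L2_per T \<nu>) (L2_per_norm T (nu_t U B f))"
proof -
  interpret E: stable_evolution A B f U \<mu>0
    by unfold_locales (use assms in auto)
  obtain M where "periodic_weight E.\<rho> T M"
    using E.periodic_weight_\<rho>[OF \<open>T > 0\<close>] by blast
  then interpret parabolic_sobolev A B f U \<mu>0 T M \<nu>
    using assms(11)
    by (intro parabolic_sobolev.intro parabolic_sobolev_axioms.intro E.stable_evolution_axioms)
  show ?thesis by (rule H12_compactly_embedded)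
qed

end
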